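(* For a given statically admissible stress $\tau\in\mathcal T_a$, the canonical dual problem $$(\mathcal P_1^d):\quad\max_{\zeta\in\mathcal S_a}\Big\{\Pi_1^d(\zeta)=-\int_\Omega\Big(\frac{|\tau|^2}{2\zeta}+(\zeta-\mu)\Big(\log\Big(\frac{\zeta-\mu}{\nu}\Big)-1\Big)+\nu\Big)d\Omega\Big\}$$ has a unique solution $\bar\zeta(x)\ge\mu+\nu$. If $\tau$ is a potential field and $\tau\times(\nabla\bar\zeta)=0$ on $\Omega$, then the function $$\bar u(x)=\int_{x_0}^{x}(\bar\zeta(x))^{-1}\,\tau\cdot dx\qquad\forall x_0\in\Gamma_u$$ is a unique solution of $$(\mathcal P_1):\quad\min_{u\in\mathcal U_a}\Big\{\Pi_1(u)=\int_\Omega\Big[\tfrac12\mu|\nabla u|^2+\nu\big(\exp(\tfrac12|\nabla u|^2)-1\big)\Big]d\Omega-\int_{\Gamma_t}t\,u\,d\Gamma\Big\}$$ and $$\Pi_1(\bar u)=\min_{u\in\mathcal U_a}\Pi_1(u)=\max_{\zeta\in\mathcal S_a}\Pi_1^d(\zeta)=\Pi_1^d(\bar\zeta).$$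
   Context: $\Omega\subset\mathbb R^2$ is a sufficiently nice region with boundary $\partial\Omega$ divided into $\Gamma_u$ and $\Gamma_t=\partial\Omega\setminus\Gamma_u$; $n$ is the unit outward normal; $t$ is a given scalar function (shear force) on $\Gamma_t$; $\mu>0$ and $\nu>0$ are material constants. Kinetically admissible space ($p\in\mathbb R$ an exponent determined by the material): $\mathcal U_a=\{u\in C[\bar\Omega;\mathbb R]\mid \nabla u\in L^{2p}[\bar\Omega;\mathbb R^2],\ u(x)=0\ \forall x\in\Gamma_u\}$. Statically admissible space: $\mathcal T_a=\{\tau\in C[\bar\Omega;\mathbb R^2]\mid\nabla\cdot\tau(x)=0\ \forall x\in\Omega,\ n\cdot\tau(x)=t\ \forall x\in\Gamma_t\}$. Dual feasible space: $\mathcal S_a=\{\zeta\in C[\Omega;\mathbb R]\mid\zeta(x)\ge\mu+\nu\ \forall x\in\Omega\}$. A field $\tau$ is a potential field on $\Omega$ if there is a scalar function $\phi$ with $\tau=\nabla\phi$. For plane vector fields $a=(a_1,a_2)$, $b=(b_1,b_2)$, $a\times b=a_1b_2-a_2b_1$.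
   Formalization: The function ū is assumed to be given by the line integral from every base point x₀ in Γ_u at once (so it vanishes on Γ_u); without this the claim fails, e.g. on a disk with constant τ and Γ_u an arc. Γ_u is taken nonempty and p > 0. *)

theory Defs
  imports "HOL-Complex_Analysis.Complex_Analysis"
begin

section \<open>Regions with piecewise smooth boundary\<close>

type_synonym plane = "real^2"

definition to_complex :: "plane \<Rightarrow> complex" where
  "to_complex x = Complex (x $ 1) (x $ 2)"

definition cross2 :: "plane \<Rightarrow> plane \<Rightarrow> real" where
  "cross2 a b = a $ 1 * b $ 2 - a $ 2 * b $ 1"

text \<open>Continuity together with a finite partition of [0,1] such that the curve is continuously
  differentiable with nonvanishing derivative on every closed piece, one-sidedly at the nodes.
  This is stronger than \<^const>\<open>valid_path\<close>, which permits unbounded derivatives near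
  the exceptional points and hence curves of infinite length.\<close>

definition piecewise_regular :: "(real \<Rightarrow> plane) \<Rightarrow> bool" where
  "piecewise_regular \<gamma> \<longleftrightarrow> path \<gamma> \<and>
     (\<exists>P. finite P \<and> {0, 1} \<subseteq> P \<and> P \<subseteq> {0..1} \<and>
        (\<forall>a\<in>P. \<forall>b\<in>P. a < b \<and> {a<..<b} \<inter> P = {} \<longrightarrow>
           (\<exists>d. continuous_on {a..b} d \<and>
              (\<forall>s\<in>{a..b}. (\<gamma> has_vector_derivative d s) (at s within {a..b}) \<and> d s \<noteq> 0))))"

text \<open>\<open>boundary_cycle C \<Omega>\<close>: the boundary of the bounded region \<open>\<Omega>\<close> consists of finitely many
  disjoint closed curves (the elements of \<open>C\<close>), oriented so that the cycle bounds \<open>\<Omega>\<close>, that is,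
  it winds once around the points of \<open>\<Omega>\<close> and not at all around exterior points. Thus \<open>\<Omega>\<close> lies to
  the left of each curve. Corners and holes are allowed.\<close>

definition boundary_cycle :: "(real \<Rightarrow> plane) set \<Rightarrow> plane set \<Rightarrow> bool" where
  "boundary_cycle C \<Omega> \<longleftrightarrow>
     open \<Omega> \<and> connected \<Omega> \<and> bounded \<Omega> \<and> \<Omega> \<noteq> {} \<and> finite C \<and>
     (\<forall>\<gamma>\<in>C. simple_path \<gamma> \<and> pathfinish \<gamma> = pathstart \<gamma> \<and> piecewise_regular \<gamma>) \<and>
     (\<forall>\<gamma>\<in>C. \<forall>\<gamma>'\<in>C. \<gamma> \<noteq> \<gamma>' \<longrightarrow> path_image \<gamma> \<inter> path_image \<gamma>' = {}) \<and>
     frontier \<Omega> = (\<Union>\<gamma>\<in>C. path_image \<gamma>) \<and>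
     (\<forall>z\<in>\<Omega>. (\<Sum>\<gamma>\<in>C. winding_number (to_complex \<circ> \<gamma>) (to_complex z)) = 1) \<and>
     (\<forall>z. z \<notin> closure \<Omega> \<longrightarrow>
        (\<Sum>\<gamma>\<in>C. winding_number (to_complex \<circ> \<gamma>) (to_complex z)) = 0)"

definition one_sided_derivative :: "(real \<Rightarrow> plane) \<Rightarrow> real \<Rightarrow> plane \<Rightarrow> bool" where
  "one_sided_derivative \<gamma> s d \<longleftrightarrow>
     (0 < s \<and> (\<gamma> has_vector_derivative d) (at s within {0..s})) \<or>
     (s < 1 \<and> (\<gamma> has_vector_derivative d) (at s within {s..1}))"

text \<open>Since \<open>\<Omega>\<close> lies to the left of its boundary, the unit outward normal is the unit tangent
  rotated clockwise by a right angle. It exists at \<open>x\<close> iff all one-sided tangents at \<open>x\<close> have the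
  same direction; at a corner no \<open>n\<close> satisfies the predicate. Both parameters 0 and 1 are
  taken into account when \<open>x\<close> is the base point of its curve.\<close>

definition outward_unit_normal :: "(real \<Rightarrow> plane) set \<Rightarrow> plane \<Rightarrow> plane \<Rightarrow> bool" where
  "outward_unit_normal C x n \<longleftrightarrow> x \<in> (\<Union>\<gamma>\<in>C. path_image \<gamma>) \<and>
     (\<forall>\<gamma>\<in>C. \<forall>s\<in>{0..1}. \<gamma> s = x \<longrightarrow>
        (\<forall>d. one_sided_derivative \<gamma> s d \<longrightarrow> n = (1 / norm d) *\<^sub>R vector [d $ 2, - d $ 1]))"

definition boundary_integral ::
    "(real \<Rightarrow> plane) set \<Rightarrow> plane set \<Rightarrow> (plane \<Rightarrow> real) \<Rightarrow> real" where
  "boundary_integral C G f =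
     (\<Sum>\<gamma>\<in>C. integral {0..1}
        (\<lambda>s. indicator G (\<gamma> s) * f (\<gamma> s) * norm (vector_derivative \<gamma> (at s))))"

section \<open>Weak gradients and integrals with extended values\<close>

definition test_function :: "plane set \<Rightarrow> (plane \<Rightarrow> real) \<Rightarrow> (plane \<Rightarrow> plane) \<Rightarrow> bool" where
  "test_function \<Omega> \<phi> \<phi>' \<longleftrightarrow> (\<forall>x. GDERIV \<phi> x :> \<phi>' x) \<and> continuous_on UNIV \<phi>' \<and>
     (\<exists>K. compact K \<and> K \<subseteq> \<Omega> \<and> (\<forall>x. x \<notin> K \<longrightarrow> \<phi> x = 0))"

definition locally_integrable :: "plane set \<Rightarrow> (plane \<Rightarrow> 'a::euclidean_space) \<Rightarrow> bool" where
  "locally_integrable \<Omega> f \<longleftrightarrow>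
     (\<forall>K. compact K \<and> K \<subseteq> \<Omega> \<longrightarrow> integrable (lebesgue_on K) f)"

definition weak_gradient :: "plane set \<Rightarrow> (plane \<Rightarrow> real) \<Rightarrow> (plane \<Rightarrow> plane) \<Rightarrow> bool" where
  "weak_gradient \<Omega> u g \<longleftrightarrow> locally_integrable \<Omega> u \<and> locally_integrable \<Omega> g \<and>
     g \<in> borel_measurable (lebesgue_on \<Omega>) \<and>
     (\<forall>\<phi> \<phi>'. test_function \<Omega> \<phi> \<phi>' \<longrightarrow>
        integral\<^sup>L (lebesgue_on \<Omega>) (\<lambda>x. u x *\<^sub>R \<phi>' x) =
        - integral\<^sup>L (lebesgue_on \<Omega>) (\<lambda>x. \<phi> x *\<^sub>R g x))"

text \<open>Unique up to a null set, which is irrelevant under the integral sign.\<close>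

definition grad :: "plane set \<Rightarrow> (plane \<Rightarrow> real) \<Rightarrow> plane \<Rightarrow> plane" where
  "grad \<Omega> u = (SOME g. weak_gradient \<Omega> u g)"

text \<open>The energies below may be infinite for admissible fields. The Bochner integral would
  assign the value 0 to a non-integrable density, which would make such fields spurious
  optimisers; hence the integral is taken as positive minus negative part in the extended reals.\<close>

definition ext_integral :: "plane set \<Rightarrow> (plane \<Rightarrow> real) \<Rightarrow> ereal" where
  "ext_integral \<Omega> f =
     enn2ereal (\<integral>\<^sup>+x. ennreal (f x) \<partial>lebesgue_on \<Omega>) -
     enn2ereal (\<integral>\<^sup>+x. ennreal (- f x) \<partial>lebesgue_on \<Omega>)"

section \<open>Admissible spaces and the two variational problems\<close>

definition kinematic_space ::
    "real \<Rightarrow> plane set \<Rightarrow> plane set \<Rightarrow> (plane \<Rightarrow> real) set" where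
  "kinematic_space p \<Omega> \<Gamma>\<^sub>u = {u. continuous_on (closure \<Omega>) u \<and>
     (\<exists>g. weak_gradient \<Omega> u g \<and> integrable (lebesgue_on \<Omega>) (\<lambda>x. norm (g x) powr (2 * p))) \<and>
     (\<forall>x\<in>\<Gamma>\<^sub>u. u x = 0)}"

definition static_space ::
    "(real \<Rightarrow> plane) set \<Rightarrow> plane set \<Rightarrow> plane set \<Rightarrow> (plane \<Rightarrow> real) \<Rightarrow> (plane \<Rightarrow> plane) set" where
  "static_space C \<Omega> \<Gamma>\<^sub>t t = {\<tau>. continuous_on (closure \<Omega>) \<tau> \<and>
     (\<forall>x\<in>\<Omega>. \<exists>D. (\<tau> has_derivative D) (at x) \<and> (\<Sum>i\<in>UNIV. D (axis i 1) $ i) = 0) \<and>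
     (\<forall>x\<in>\<Gamma>\<^sub>t. \<forall>n. outward_unit_normal C x n \<longrightarrow> n \<bullet> \<tau> x = t x)}"

definition dual_space :: "real \<Rightarrow> real \<Rightarrow> plane set \<Rightarrow> (plane \<Rightarrow> real) set" where
  "dual_space \<mu> \<nu> \<Omega> = {\<zeta>. continuous_on \<Omega> \<zeta> \<and> (\<forall>x\<in>\<Omega>. \<mu> + \<nu> \<le> \<zeta> x)}"

definition primal_energy ::
    "real \<Rightarrow> real \<Rightarrow> (real \<Rightarrow> plane) set \<Rightarrow> plane set \<Rightarrow> plane set \<Rightarrow> (plane \<Rightarrow> real) \<Rightarrow>
     (plane \<Rightarrow> real) \<Rightarrow> ereal" where
  "primal_energy \<mu> \<nu> C \<Omega> \<Gamma>\<^sub>t t u =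
     ext_integral \<Omega> (\<lambda>x. \<mu> * (norm (grad \<Omega> u x))\<^sup>2 / 2
                        + \<nu> * (exp ((norm (grad \<Omega> u x))\<^sup>2 / 2) - 1))
     - ereal (boundary_integral C \<Gamma>\<^sub>t (\<lambda>x. t x * u x))"

definition dual_energy ::
    "real \<Rightarrow> real \<Rightarrow> plane set \<Rightarrow> (plane \<Rightarrow> plane) \<Rightarrow> (plane \<Rightarrow> real) \<Rightarrow> ereal" where
  "dual_energy \<mu> \<nu> \<Omega> \<tau> \<zeta> =
     - ext_integral \<Omega> (\<lambda>x. (norm (\<tau> x))\<^sup>2 / (2 * \<zeta> x)
                          + (\<zeta> x - \<mu>) * (ln ((\<zeta> x - \<mu>) / \<nu>) - 1) + \<nu>)"

text \<open>Admissible functions are represented by total functions, so uniqueness is equality on the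
  domain \<open>D\<close>.\<close>

definition unique_minimizer ::
    "plane set \<Rightarrow> (plane \<Rightarrow> real) set \<Rightarrow> ((plane \<Rightarrow> real) \<Rightarrow> ereal) \<Rightarrow> (plane \<Rightarrow> real) \<Rightarrow> bool" where
  "unique_minimizer D S J u \<longleftrightarrow> u \<in> S \<and> (\<forall>v\<in>S. J u \<le> J v) \<and>
     (\<forall>v\<in>S. (\<forall>w\<in>S. J v \<le> J w) \<longrightarrow> (\<forall>x\<in>D. v x = u x))"

definition unique_maximizer ::
    "plane set \<Rightarrow> (plane \<Rightarrow> real) set \<Rightarrow> ((plane \<Rightarrow> real) \<Rightarrow> ereal) \<Rightarrow> (plane \<Rightarrow> real) \<Rightarrow> bool" where
  "unique_maximizer D S J u \<longleftrightarrow> u \<in> S \<and> (\<forall>v\<in>S. J v \<le> J u) \<and>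
     (\<forall>v\<in>S. (\<forall>w\<in>S. J w \<le> J v) \<longrightarrow> (\<forall>x\<in>D. v x = u x))"

definition potential_field :: "plane set \<Rightarrow> (plane \<Rightarrow> plane) \<Rightarrow> bool" where
  "potential_field \<Omega> \<tau> \<longleftrightarrow> (\<exists>\<phi>. \<forall>x\<in>\<Omega>. GDERIV \<phi> x :> \<tau> x)"

text \<open>\<open>v\<close> is the value of the line integral of \<open>F\<close> along some path from \<open>x\<^sub>0\<close> to \<open>x\<close>. Only the
  end points may lie on the boundary, as the integrand is given on \<open>\<Omega>\<close> only.\<close>

definition line_integral_value ::
    "plane set \<Rightarrow> (plane \<Rightarrow> plane) \<Rightarrow> plane \<Rightarrow> plane \<Rightarrow> real \<Rightarrow> bool" where
  "line_integral_value \<Omega> F x\<^sub>0 x v \<longleftrightarrow>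
     (\<exists>\<gamma>. valid_path \<gamma> \<and> pathstart \<gamma> = x\<^sub>0 \<and> pathfinish \<gamma> = x \<and> \<gamma> ` {0<..<1} \<subseteq> \<Omega> \<and>
        ((\<lambda>s. F (\<gamma> s) \<bullet> vector_derivative \<gamma> (at s)) has_integral v) {0..1})"

end

theory Submission
  imports Defs
begin

text \<open>
  Put \<open>E = |g|\<^sup>2 / 2\<close>. Young's inequality for the exponential,
  \<open>E s - \<nu> exp E \<le> s (ln (s / \<nu>) - 1)\<close> with \<open>s = \<zeta> - \<mu>\<close>, together with completion of the square in
  \<open>\<zeta> E - \<tau> \<bullet> g\<close> bounds the stored energy density \<open>W(g)\<close> from below by \<open>\<tau> \<bullet> g\<close> minus the
  complementary density \<open>q(\<zeta>)\<close>, whose negative is the integrand of the dual functional. Everything rests on this pointwise duality.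

  The dual problem is solved point by point. The density \<open>q\<close> is stationary exactly where
  \<open>\<zeta>\<^sup>2 ln ((\<zeta> - \<mu>) / \<nu>) = |\<tau>|\<^sup>2 / 2\<close>. The left hand side increases strictly from 0 to infinity on
  \<open>[\<mu> + \<nu>, \<infinity>)\<close>, so there is a unique root, it depends continuously on \<open>|\<tau>|\<close>, and it is the strict minimiser
  of the density (\<open>complementary_minimal\<close>). This is the unique dual solution, continuous up to the boundary
  (\<open>dual_problem_solution\<close>). For this \<open>\<zeta>\<close> the bound becomes an equality precisely for \<open>g = \<tau> / \<zeta>\<close>.

  Path independence of the line integral of \<open>\<tau> / \<zeta>\<close> would follow from closedness of that field if \<open>\<Omega>\<close> were simply
  connected, but holes are allowed and more is true. As \<open>\<tau>\<close> is divergence free and a gradient,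
  \<open>f = \<tau>\<^sub>1 - i \<tau>\<^sub>2\<close> is holomorphic. As \<open>|\<tau>|\<^sup>2\<close> is a differentiable
  function of \<open>\<zeta>\<close>, a gradient of \<open>\<zeta>\<close> collinear with \<open>\<tau>\<close> makes the gradient of \<open>|\<tau>|\<^sup>2\<close> collinear with \<open>\<tau>\<close>, and
  this says that \<open>f' / f\<^sup>2\<close> is real where \<open>f\<close> does not vanish, hence constant by the
  open mapping theorem. Thus \<open>f = 0\<close> or \<open>1 / f(z) = d - c z\<close> with real \<open>c\<close>: the stress is zero, constant, or a
  radial field of strength \<open>1 / |c|\<close> divided by the distance to a point off the closure of \<open>\<Omega>\<close>. In each case
  \<open>\<tau> / \<zeta>\<close> has an explicit primitive
  that is continuous on the closure of \<open>\<Omega>\<close> (\<open>radial_primitive\<close>), and the function \<open>u\<close> of the theorem is the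
  primitive normalised to vanish on \<open>\<Gamma>\<^sub>u\<close>; in particular it is admissible.

  The remaining ingredient is the principle of virtual work: the integral of \<open>\<tau> \<bullet> \<nabla>w\<close> over \<open>\<Omega>\<close> equals the boundary
  integral of \<open>t w\<close>, where an admissible \<open>w\<close> of finite energy is only known to be continuous with an integrable weak gradient
  (\<open>virtual_work\<close>). This is an instance of the Gauss--Green formula for continuous fields with integrable
  weak divergence on a region bounded by piecewise regular curves (\<open>flux_weak_divergence\<close>). The proof of that formula never looks
  at the local shape of the boundary, so corners and cusps cause no trouble:
  for continuously differentiable functions of compact support Green's formula follows by inserting the Cauchy--Pompeiu
  representation into the boundary integral and exchanging the integrals, since the inner integral is then the winding
  number, which is 1 inside and 0 outside; for a continuous field one approximates uniformly by such functions and controls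
  the error in the interior by cutoffs that tend to 1 while their gradients stay bounded in \<open>L\<^sup>1\<close>, which is
  possible because the boundary has finite length.

  Integrating the pointwise bound and using virtual work gives the primal energy of every admissible \<open>w\<close> as an upper bound of
  the maximal dual energy, with equality iff \<open>\<nabla>w = \<tau> / \<zeta>\<close> almost everywhere, and \<open>u\<close> attains it. Two
  minimisers therefore have the same weak gradient, so they differ by a constant on the connected region \<open>\<Omega>\<close>
  (\<open>weak_gradient_eq_imp_constant\<close>), which is 0 because both vanish on the nonempty set \<open>\<Gamma>\<^sub>u\<close>.
\<close>

section \<open>Test functions and integration by parts\<close>

text \<open>Translation invariance gives every difference quotient the integral 0, and the Lipschitz bound
  dominates these quotients, so the limit has integral 0 as well. Allowing a null set \<open>N\<close> of bad
  points makes the lemma applicable to the truncated Cauchy kernel, which has a kink on a circle.\<close>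

lemma directional_derivative_integral_zero:
  fixes f :: "'a::euclidean_space \<Rightarrow> 'b::euclidean_space"
  assumes lip: "\<And>x y. norm (f x - f y) \<le> L * norm (x - y)"
    and supp: "\<And>x. norm x > R \<Longrightarrow> f x = 0"
    and N: "AE x in lborel. x \<notin> N"
    and deriv: "\<And>x. x \<notin> N \<Longrightarrow> ((\<lambda>t. f (x + t *\<^sub>R e)) has_vector_derivative f' x) (at 0)"
    and meas: "f' \<in> borel_measurable lborel"
  shows "integrable lborel f'" "integral\<^sup>L lborel f' = 0"
proof -
  have "continuous_on UNIV f"
  proof (rule continuous_on_iff[THEN iffD2], intro ballI allI impI)
    fix x and \<epsilon> :: real assume "\<epsilon> > 0"
    show "\<exists>d>0. \<forall>x'\<in>UNIV. dist x' x < d \<longrightarrow> dist (f x') (f x) < \<epsilon>"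
    proof (intro exI[of _ "\<epsilon> / (\<bar>L\<bar> + 1)"] conjI ballI impI)
      show "\<epsilon> / (\<bar>L\<bar> + 1) > 0" using \<open>\<epsilon> > 0\<close> by simp
      fix x' assume d: "dist x' x < \<epsilon> / (\<bar>L\<bar> + 1)"
      have "dist (f x') (f x) \<le> L * dist x' x"
        using lip[of x' x] by (simp add: dist_norm)
      also have "\<dots> \<le> (\<bar>L\<bar> + 1) * dist x' x" by (intro mult_right_mono) auto
      also have "\<dots> < \<epsilon>" using d by (simp add: field_simps)
      finally show "dist (f x') (f x) < \<epsilon>" .
    qed
  qed
  then have fm [measurable]: "f \<in> borel_measurable borel"
    by (rule borel_measurable_continuous_onI)
  define q where "q = (\<lambda>(n::nat) x. real (Suc n) *\<^sub>R (f (x + (1 / real (Suc n)) *\<^sub>R e) - f x))"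
  have fint: "integrable lborel f"
  proof -
    have c: "continuous_on (cball 0 R) f"
      using \<open>continuous_on UNIV f\<close> continuous_on_subset by blast
    have "integrable lborel (\<lambda>x. indicator (cball 0 R) x *\<^sub>R f x)"
      using borel_integrable_compact[OF _ c] by simp
    moreover have "(\<lambda>x. indicator (cball 0 R) x *\<^sub>R f x) = f"
      using supp by (auto simp: indicator_def fun_eq_iff not_le)
    ultimately show ?thesis by simp
  qed
  have shift: "integrable lborel (\<lambda>x. f (x + c))" "integral\<^sup>L lborel (\<lambda>x. f (x + c)) = integral\<^sup>L lborel f" for c
  proof -
    have "integrable (distr lborel borel ((+) c)) f" using fint by (simp add: lborel_distr_plus)
    then show "integrable lborel (\<lambda>x. f (x + c))"
      by (subst (asm) integrable_distr_eq) (auto simp: add.commute)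
    have "integral\<^sup>L lborel f = integral\<^sup>L (distr lborel borel ((+) c)) f" by (simp add: lborel_distr_plus)
    also have "\<dots> = integral\<^sup>L lborel (\<lambda>x. f (x + c))"
      by (subst integral_distr) (auto simp: add.commute)
    finally show "integral\<^sup>L lborel (\<lambda>x. f (x + c)) = integral\<^sup>L lborel f" by simp
  qed
  have q0: "integral\<^sup>L lborel (q n) = 0" for n
    unfolding q_def using shift fint by simp
  \<comment> \<open>The step length is at most 1, so all quotients are supported in this ball.\<close>
  define w where "w = (\<lambda>x. indicator (cball (0::'a) (R + norm e)) x *\<^sub>R (L * norm e))"
  have wint: "integrable lborel w"
    unfolding w_def using borel_integrable_compact[of "cball (0::'a) (R + norm e)" "\<lambda>x. L * norm e"] by simp
  have bound: "norm (q n x) \<le> w x" for n x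
  proof (cases "norm x \<le> R + norm e")
    case True
    have "norm (q n x) = real (Suc n) * norm (f (x + (1 / real (Suc n)) *\<^sub>R e) - f x)"
      by (simp add: q_def)
    also have "\<dots> \<le> real (Suc n) * (L * norm ((1 / real (Suc n)) *\<^sub>R e))"
      using lip[of "x + (1 / real (Suc n)) *\<^sub>R e" x] by (intro mult_left_mono) auto
    also have "\<dots> = L * norm e" by simp
    finally show ?thesis using True by (simp add: w_def)
  next
    case False
    have "norm ((1 / real (Suc n)) *\<^sub>R e) \<le> norm e"
      using mult_right_mono[of "1 / real (Suc n)" 1 "norm e"] by (simp add: field_simps)
    then have "norm x - norm e \<le> norm (x + (1 / real (Suc n)) *\<^sub>R e)"
      using norm_diff_ineq[of x "(1 / real (Suc n)) *\<^sub>R e"] by linarith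
    moreover have "0 \<le> norm e" by simp
    ultimately have "f (x + (1 / real (Suc n)) *\<^sub>R e) = 0" "f x = 0"
      using False by (intro supp; linarith)+
    then show ?thesis using False by (simp add: q_def w_def)
  qed
  have lim: "AE x in lborel. (\<lambda>n. q n x) \<longlonglongrightarrow> f' x"
    using N
  proof eventually_elim
    case (elim x)
    have "((\<lambda>t. (f (x + t *\<^sub>R e) - f x - t *\<^sub>R f' x) /\<^sub>R norm t) \<longlongrightarrow> 0) (at 0)"
      using deriv[OF elim] by (simp add: has_vector_derivative_def has_derivative_def)
    then have "((\<lambda>t. norm ((f (x + t *\<^sub>R e) - f x - t *\<^sub>R f' x) /\<^sub>R norm t)) \<longlongrightarrow> 0) (at 0)"
      by (rule tendsto_norm_zero)
    then have "((\<lambda>t. norm ((f (x + t *\<^sub>R e) - f x) /\<^sub>R t - f' x)) \<longlongrightarrow> 0) (at 0)"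
    proof (rule Lim_transform_eventually)
      have "norm ((f (x + t *\<^sub>R e) - f x - t *\<^sub>R f' x) /\<^sub>R norm t) = norm ((f (x + t *\<^sub>R e) - f x) /\<^sub>R t - f' x)"
        if "t \<noteq> 0" for t
      proof -
        have "(f (x + t *\<^sub>R e) - f x) /\<^sub>R t - f' x = (f (x + t *\<^sub>R e) - f x - t *\<^sub>R f' x) /\<^sub>R t"
          using that by (simp add: scaleR_diff_right)
        then show ?thesis by simp
      qed
      then show "\<forall>\<^sub>F t in at 0. norm ((f (x + t *\<^sub>R e) - f x - t *\<^sub>R f' x) /\<^sub>R norm t) = norm ((f (x + t *\<^sub>R e) - f x) /\<^sub>R t - f' x)"
        by (auto simp: eventually_at_filter)
    qed
    then have d: "((\<lambda>t. (f (x + t *\<^sub>R e) - f x) /\<^sub>R t) \<longlongrightarrow> f' x) (at 0)"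
      by (rule LIM_zero_cancel[OF tendsto_norm_zero_cancel])
    have "(\<lambda>n. 1 / real (Suc n)) \<longlonglongrightarrow> 0"
      using lim_1_over_n[where 'a=real] LIMSEQ_Suc by blast
    then have "filterlim (\<lambda>n. 1 / real (Suc n)) (at 0) sequentially"
      by (simp add: filterlim_at)
    with d have "(\<lambda>n. (f (x + (1 / real (Suc n)) *\<^sub>R e) - f x) /\<^sub>R (1 / real (Suc n))) \<longlonglongrightarrow> f' x"
      by (rule filterlim_compose)
    then show ?case by (simp add: q_def)
  qed
  have qm: "q n \<in> borel_measurable lborel" for n unfolding q_def by measurable
  show "integrable lborel f'"
    by (rule integrable_dominated_convergence[OF meas qm wint lim]) (simp add: bound)
  have "(\<lambda>n. integral\<^sup>L lborel (q n)) \<longlonglongrightarrow> integral\<^sup>L lborel f'"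
    by (rule integral_dominated_convergence[OF meas qm wint lim]) (simp add: bound)
  then show "integral\<^sup>L lborel f' = 0" unfolding q0 by (simp add: LIMSEQ_const_iff)
qed

lemma test_function_mono: "test_function A f f' \<Longrightarrow> A \<subseteq> B \<Longrightarrow> test_function B f f'"
  unfolding test_function_def by blast

lemma GDERIV_imp_continuous_on: "(\<And>x. GDERIV f x :> f' x) \<Longrightarrow> continuous_on S (f::plane\<Rightarrow>real)"
  unfolding gderiv_def by (meson has_derivative_continuous continuous_at_imp_continuous_on)

lemma test_function_continuous: "test_function A f f' \<Longrightarrow> continuous_on S f"
  "test_function A f f' \<Longrightarrow> continuous_on S f'"
  unfolding test_function_def using GDERIV_imp_continuous_on continuous_on_subset by blast+

lemma test_function_support:
  assumes "test_function A f f'"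
  obtains K where "compact K" "K \<subseteq> A" "\<And>x. x \<notin> K \<Longrightarrow> f x = 0" "\<And>x. x \<notin> K \<Longrightarrow> f' x = 0"
proof -
  obtain K where K: "compact K" "K \<subseteq> A" "\<And>x. x \<notin> K \<Longrightarrow> f x = 0"
    using assms unfolding test_function_def by blast
  have "f' x = 0" if "x \<notin> K" for x
  proof -
    have "open (- K)" using K(1) compact_imp_closed by blast
    have "GDERIV f x :> f' x" using assms by (simp add: test_function_def)
    then have "((\<lambda>_. 0) has_derivative (\<lambda>h. h \<bullet> f' x)) (at x)"
      unfolding gderiv_def
      by (rule has_derivative_transform_within_open[where s="-K"]) (use that K(3) \<open>open (-K)\<close> in auto)
    then have "(\<lambda>h. h \<bullet> f' x) = (\<lambda>h. 0)"
      using has_derivative_unique has_derivative_const by blast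
    then show ?thesis by (metis inner_eq_zero_iff)
  qed
  then show ?thesis using that K by blast
qed

lemma test_function_bounded:
  assumes "test_function A f f'"
  obtains M R where "M \<ge> 0" "\<And>x. \<bar>f x\<bar> \<le> M" "\<And>x. norm (f' x) \<le> M"
     "\<And>x. norm x > R \<Longrightarrow> f x = 0" "\<And>x. norm x > R \<Longrightarrow> f' x = 0"
proof -
  obtain K where K: "compact K" "\<And>x. x \<notin> K \<Longrightarrow> f x = 0" "\<And>x. x \<notin> K \<Longrightarrow> f' x = 0"
    using test_function_support[OF assms] by metis
  have "compact (f ` K)" "compact (f' ` K)"
    using K(1) test_function_continuous[OF assms] compact_continuous_image by blast+
  then have "bounded (f ` K)" "bounded (f' ` K)" using compact_imp_bounded by auto
  then obtain M1 M2 where M: "\<And>x. x \<in> K \<Longrightarrow> norm (f x) \<le> M1" "\<And>x. x \<in> K \<Longrightarrow> norm (f' x) \<le> M2"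
    unfolding bounded_iff by blast
  obtain R where R: "\<And>x. x \<in> K \<Longrightarrow> norm x \<le> R"
    using compact_imp_bounded[OF K(1)] unfolding bounded_iff by blast
  show ?thesis
  proof (rule that[of "max 0 (max M1 M2)" R])
    show "\<bar>f x\<bar> \<le> max 0 (max M1 M2)" for x using M(1)[of x] K(2)[of x] by (cases "x \<in> K") auto
    show "norm (f' x) \<le> max 0 (max M1 M2)" for x using M(2)[of x] K(3)[of x] by (cases "x \<in> K") auto
    show "f x = 0" if "norm x > R" for x using that R[of x] K(2)[of x] by fastforce
    show "f' x = 0" if "norm x > R" for x using that R[of x] K(3)[of x] by fastforce
  qed auto
qed

lemma test_function_lipschitz:
  assumes "test_function A f f'" "\<And>x. norm (f' x) \<le> M"
  shows "norm (f x - f y) \<le> M * norm (x - y)"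
proof (rule differentiable_bound[where S=UNIV and f'="\<lambda>x h. h \<bullet> f' x"])
  show "(f has_derivative (\<lambda>h. h \<bullet> f' x)) (at x)" for x
    using assms(1) by (simp add: test_function_def gderiv_def)
  show "onorm (\<lambda>h. h \<bullet> f' x) \<le> M" for x
  proof (rule onorm_le)
    fix h :: plane
    have "norm (h \<bullet> f' x) \<le> norm h * norm (f' x)" using Cauchy_Schwarz_ineq2[of h "f' x"] by simp
    also have "\<dots> \<le> norm h * M" using assms(2)[of x] by (intro mult_left_mono) auto
    finally show "norm (h \<bullet> f' x) \<le> M * norm h" by (simp add: mult.commute)
  qed
qed auto

lemma test_function_mult:
  assumes "test_function A f f'" "\<And>x. GDERIV g x :> g' x" "continuous_on UNIV g'"
  shows "test_function A (\<lambda>x. f x * g x) (\<lambda>x. f x *\<^sub>R g' x + g x *\<^sub>R f' x)"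
proof -
  have "continuous_on UNIV g" using assms(2) GDERIV_imp_continuous_on by blast
  moreover have "\<exists>K. compact K \<and> K \<subseteq> A \<and> (\<forall>x. x \<notin> K \<longrightarrow> f x * g x = 0)"
    using test_function_support[OF assms(1)] by (metis mult_zero_left)
  ultimately show ?thesis using assms test_function_continuous[OF assms(1)]
    unfolding test_function_def by (auto intro!: continuous_intros GDERIV_mult)
qed

lemma GDERIV_along_line:
  assumes "GDERIV f x :> D"
  shows "((\<lambda>t. f (x + t *\<^sub>R e)) has_real_derivative (e \<bullet> D)) (at 0)"
proof -
  have "((\<lambda>t. x + t *\<^sub>R e) has_derivative (\<lambda>t. t *\<^sub>R e)) (at (0::real))"
    by (auto intro!: derivative_eq_intros)
  moreover have "(f has_derivative (\<lambda>h. h \<bullet> D)) (at (x + 0 *\<^sub>R e))" using assms by (simp add: gderiv_def)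
  ultimately have "((\<lambda>t. f (x + t *\<^sub>R e)) has_derivative (\<lambda>t. (t *\<^sub>R e) \<bullet> D)) (at (0::real))"
    by (rule has_derivative_compose)
  moreover have "(\<lambda>t. (t *\<^sub>R e) \<bullet> D) = (*) (e \<bullet> D)" by (auto simp: mult.commute)
  ultimately show ?thesis by (simp add: has_field_derivative_def)
qed

lemma test_function_integral_gradient_zero:
  assumes "test_function A f f'"
  shows "integrable lborel f'" "integral\<^sup>L lborel f' = 0"
proof -
  obtain M R where M: "M \<ge> 0" "\<And>x. norm (f' x) \<le> M"
     "\<And>x. norm x > R \<Longrightarrow> f x = 0" "\<And>x. norm x > R \<Longrightarrow> f' x = 0"
    using test_function_bounded[OF assms] by metis
  have c: "continuous_on S f'" for S using test_function_continuous[OF assms] by blast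
  have m: "f' \<in> borel_measurable borel" using c by (rule borel_measurable_continuous_onI)
  have "integrable lborel (\<lambda>x. indicator (cball 0 R) x *\<^sub>R f' x)"
    using borel_integrable_compact[OF _ c] by simp
  moreover have "(\<lambda>x. indicator (cball 0 R) x *\<^sub>R f' x) = f'"
    using M by (auto simp: indicator_def fun_eq_iff not_le)
  ultimately show i: "integrable lborel f'" by simp
  have "e \<bullet> integral\<^sup>L lborel f' = 0" for e
  proof -
    have "integral\<^sup>L lborel (\<lambda>x. e \<bullet> f' x) = 0"
    proof (rule directional_derivative_integral_zero(2)[where f=f and N="{}" and e=e])
      show "norm (f x - f y) \<le> M * norm (x - y)" for x y
        using test_function_lipschitz[OF assms M(2)] .
      show "((\<lambda>t. f (x + t *\<^sub>R e)) has_vector_derivative e \<bullet> f' x) (at 0)" for x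
        using GDERIV_along_line[of f x "f' x" e] assms
        by (simp add: test_function_def has_real_derivative_iff_has_vector_derivative)
    qed (use M m in auto)
    then show ?thesis using i by simp
  qed
  then show "integral\<^sup>L lborel f' = 0" using inner_eq_zero_iff by blast
qed

section \<open>The Cauchy kernel and the Cauchy--Pompeiu formula\<close>

lemma to_complex_simps [simp]:
  "to_complex (x + y) = to_complex x + to_complex y"
  "to_complex (x - y) = to_complex x - to_complex y"
  "to_complex (r *\<^sub>R x) = of_real r * to_complex x"
  "Re (to_complex x) = x $ 1" "Im (to_complex x) = x $ 2"
  by (auto simp: to_complex_def complex_eq_iff)

lemma norm_to_complex [simp]: "norm (to_complex x) = norm x"
  by (simp add: to_complex_def complex_norm norm_vec_def L2_set_def sum_2)

lemma bounded_linear_to_complex: "bounded_linear to_complex"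
  by (rule bounded_linear_intro[where K=1]) (auto simp: scaleR_conv_of_real[where 'a=complex])

lemma norm_to_complex_diff [simp]: "norm (to_complex x - to_complex y) = norm (x - y)"
  by (simp flip: to_complex_simps(2) del: to_complex_simps)

lemma to_complex_0 [simp]: "to_complex 0 = 0" and to_complex_eq_0 [simp]: "to_complex x = 0 \<longleftrightarrow> x = 0"
  by (metis norm_to_complex norm_eq_zero)+

lemma continuous_on_to_complex [continuous_intros]:
  "continuous_on S f \<Longrightarrow> continuous_on S (\<lambda>x. to_complex (f x))"
  using bounded_linear.continuous_on[OF bounded_linear_to_complex] .

lemma to_complex_measurable [measurable]: "to_complex \<in> borel_measurable borel"
  by (intro borel_measurable_continuous_onI continuous_intros)

text \<open>A Lipschitz truncation of \<open>1 / \<xi>\<close>: on the circle of radius \<open>\<epsilon>\<close> one has \<open>1 / \<xi> = cnj \<xi> / \<epsilon>\<^sup>2\<close>, so the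
  two pieces fit together continuously.\<close>

definition cauchy_kernel :: "real \<Rightarrow> plane \<Rightarrow> complex" where
  "cauchy_kernel \<epsilon> \<xi> = (if norm \<xi> \<le> \<epsilon> then cnj (to_complex \<xi>) / (of_real \<epsilon>)\<^sup>2 else 1 / to_complex \<xi>)"

lemma cauchy_kernel_bounds:
  assumes "\<epsilon> > 0"
  shows "norm (cauchy_kernel \<epsilon> x) \<le> 1 / \<epsilon>" "norm (cauchy_kernel \<epsilon> x) \<le> 1 / norm x \<or> x = 0"
proof -
  have "norm x / \<epsilon>\<^sup>2 \<le> 1 / \<epsilon>" if "norm x \<le> \<epsilon>" using that assms by (simp add: field_simps power2_eq_square)
  moreover have "1 / norm x \<le> 1 / \<epsilon>" if "\<not> norm x \<le> \<epsilon>" using that assms by (auto intro!: divide_left_mono mult_pos_pos)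
  ultimately show "norm (cauchy_kernel \<epsilon> x) \<le> 1 / \<epsilon>"
    by (auto simp: cauchy_kernel_def norm_divide norm_power)
  have "norm x / \<epsilon>\<^sup>2 \<le> 1 / norm x" if "norm x \<le> \<epsilon>" "x \<noteq> 0"
    using mult_mono[OF that(1) that(1)] that assms by (simp add: field_simps power2_eq_square)
  then show "norm (cauchy_kernel \<epsilon> x) \<le> 1 / norm x \<or> x = 0"
    by (auto simp: cauchy_kernel_def norm_divide norm_power)
qed

text \<open>Only the case of one point inside and one outside the disc is delicate. There
  \<open>1 / y = cnj y / |y|\<^sup>2\<close>, and the difference splits into the increment of the inner formula and the
  defect \<open>|y| (1 / \<epsilon>\<^sup>2 - 1 / |y|\<^sup>2)\<close>, which is controlled by \<open>|y| - \<epsilon> \<le> |x - y|\<close>; hence the constant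
  \<open>1 + 2\<close>.\<close>

lemma cauchy_kernel_lipschitz:
  assumes "\<epsilon> > 0"
  shows "norm (cauchy_kernel \<epsilon> x - cauchy_kernel \<epsilon> y) \<le> 3 / \<epsilon>\<^sup>2 * norm (x - y)"
proof -
  let ?k = "cauchy_kernel \<epsilon>"
  have mixed: "norm (?k x - ?k y) \<le> 3 / \<epsilon>\<^sup>2 * norm (x - y)" if x: "norm x \<le> \<epsilon>" and y: "\<not> norm y \<le> \<epsilon>" for x y
  proof -
    let ?X = "to_complex x" and ?Y = "to_complex y"
    have y0: "norm y > 0" "?Y \<noteq> 0" using y assms by auto
    have "?Y * cnj ?Y = (of_real (norm y))\<^sup>2"
      by (metis complex_norm_square norm_to_complex of_real_power)
    then have "1 / ?Y = cnj ?Y / (of_real (norm y))\<^sup>2"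
      using y0 by (simp add: field_simps)
    then have "?k x - ?k y = cnj (?X - ?Y) / (of_real \<epsilon>)\<^sup>2 + cnj ?Y * of_real (1/\<epsilon>\<^sup>2 - 1/(norm y)\<^sup>2)"
      using x y by (simp add: cauchy_kernel_def algebra_simps diff_divide_distrib)
    also have "norm \<dots> \<le> norm (cnj (?X - ?Y) / (of_real \<epsilon>)\<^sup>2) + norm (cnj ?Y * of_real (1/\<epsilon>\<^sup>2 - 1/(norm y)\<^sup>2))"
      by (rule norm_triangle_ineq)
    also have "norm (cnj (?X - ?Y) / (of_real \<epsilon>)\<^sup>2) = norm (x - y) / \<epsilon>\<^sup>2"
      by (simp only: norm_divide complex_mod_cnj norm_power norm_of_real power2_abs norm_to_complex_diff)
    also have "norm (cnj ?Y * of_real (1/\<epsilon>\<^sup>2 - 1/(norm y)\<^sup>2)) = norm y * (1/\<epsilon>\<^sup>2 - 1/(norm y)\<^sup>2)"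
    proof -
      have "1/(norm y)\<^sup>2 \<le> 1/\<epsilon>\<^sup>2" using y assms by (intro divide_left_mono mult_pos_pos) (auto intro!: power_mono)
      then show ?thesis unfolding norm_mult norm_of_real by simp
    qed
    also have "\<dots> = (norm y - \<epsilon>) * ((norm y + \<epsilon>) / norm y) / \<epsilon>\<^sup>2"
      using y0 assms by (simp add: field_simps power2_eq_square)
    also have "\<dots> \<le> (norm y - \<epsilon>) * 2 / \<epsilon>\<^sup>2"
      using y y0 assms by (intro divide_right_mono mult_left_mono) (auto simp: field_simps)
    also have "\<dots> \<le> norm (x - y) * 2 / \<epsilon>\<^sup>2"
      using norm_triangle_ineq2[of y x] x assms by (intro divide_right_mono mult_right_mono) (auto simp: norm_minus_commute)
    finally show ?thesis by (simp add: field_simps)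
  qed
  consider "norm x \<le> \<epsilon>" "norm y \<le> \<epsilon>" | "norm x \<le> \<epsilon>" "\<not> norm y \<le> \<epsilon>" | "\<not> norm x \<le> \<epsilon>" "norm y \<le> \<epsilon>"
    | "\<not> norm x \<le> \<epsilon>" "\<not> norm y \<le> \<epsilon>" by blast
  then show ?thesis
  proof cases
    case 1
    then have "?k x - ?k y = cnj (to_complex (x - y)) / (of_real \<epsilon>)\<^sup>2"
      by (simp add: cauchy_kernel_def diff_divide_distrib)
    then have "norm (?k x - ?k y) = norm (x - y) / \<epsilon>\<^sup>2"
      by (simp only: norm_divide complex_mod_cnj norm_power norm_of_real power2_abs norm_to_complex)
    also have "\<dots> \<le> 3 / \<epsilon>\<^sup>2 * norm (x - y)" using assms by (simp add: field_simps)
    finally show ?thesis .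
  next
    case 2 then show ?thesis by (rule mixed)
  next
    case 3 then show ?thesis using mixed[of y x] by (simp add: norm_minus_commute)
  next
    case 4
    then have n: "norm x > \<epsilon>" "norm y > \<epsilon>" "x \<noteq> 0" "y \<noteq> 0" using assms by auto
    then have "?k x - ?k y = to_complex (y - x) / (to_complex x * to_complex y)"
      using 4 by (simp add: cauchy_kernel_def field_simps)
    then have "norm (?k x - ?k y) = norm (x - y) / (norm x * norm y)"
      by (simp only: norm_divide norm_mult norm_to_complex norm_minus_commute)
    also have "\<dots> \<le> norm (x - y) / \<epsilon>\<^sup>2"
      unfolding power2_eq_square using n assms by (intro divide_left_mono mult_mono mult_pos_pos) auto
    also have "\<dots> \<le> 3 / \<epsilon>\<^sup>2 * norm (x - y)" using assms by (simp add: field_simps)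
    finally show ?thesis .
  qed
qed

lemma cauchy_kernel_measurable [measurable]: "cauchy_kernel \<epsilon> \<in> borel_measurable borel"
proof -
  have [measurable]: "cnj \<in> borel_measurable borel"
    by (intro borel_measurable_continuous_onI continuous_intros)
  show ?thesis unfolding cauchy_kernel_def by measurable
qed

lemma cauchy_kernel_derivative:
  assumes "\<epsilon> > 0" "norm x \<noteq> \<epsilon>"
  shows "((\<lambda>t. cauchy_kernel \<epsilon> (x + t *\<^sub>R e)) has_vector_derivative
     (if norm x \<le> \<epsilon> then cnj (to_complex e) / (of_real \<epsilon>)\<^sup>2 else - to_complex e / (to_complex x)\<^sup>2)) (at 0)"
proof (cases "norm x \<le> \<epsilon>")
  case True
  define S where "S = (\<lambda>t. x + t *\<^sub>R e) -` ball 0 \<epsilon>"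
  have S: "open S" unfolding S_def by (intro open_vimage continuous_intros) auto
  have "((\<lambda>t. cnj (to_complex (x + t *\<^sub>R e)) / (of_real \<epsilon>)\<^sup>2) has_vector_derivative cnj (to_complex e) / (of_real \<epsilon>)\<^sup>2) (at 0)"
  proof -
    have "(\<lambda>t. cnj (to_complex (x + t *\<^sub>R e)) / (of_real \<epsilon>)\<^sup>2) =
       (\<lambda>t. cnj (to_complex x) / (of_real \<epsilon>)\<^sup>2 + t *\<^sub>R (cnj (to_complex e) / (of_real \<epsilon>)\<^sup>2))"
      by (simp add: fun_eq_iff scaleR_conv_of_real[where 'a=complex] add_divide_distrib)
    moreover have "((\<lambda>t. a + t *\<^sub>R b) has_vector_derivative b) (at 0)" for a b :: complex
      by (auto simp: has_vector_derivative_def intro!: derivative_eq_intros)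
    ultimately show ?thesis by (simp only:)
  qed
  then have "((\<lambda>t. cauchy_kernel \<epsilon> (x + t *\<^sub>R e)) has_vector_derivative cnj (to_complex e) / (of_real \<epsilon>)\<^sup>2) (at 0)"
    by (rule has_vector_derivative_transform_within_open[OF _ S]) (use True assms in \<open>auto simp: S_def cauchy_kernel_def\<close>)
  then show ?thesis using True by simp
next
  case False
  define S where "S = (\<lambda>t. x + t *\<^sub>R e) -` (- cball 0 \<epsilon>)"
  have S: "open S" unfolding S_def by (intro open_vimage continuous_intros) auto
  have x0: "to_complex x \<noteq> 0" using False assms by auto
  have "((\<lambda>t. 1 / (to_complex x + complex_of_real t * to_complex e)) has_vector_derivative - to_complex e / (to_complex x)\<^sup>2) (at 0)"
  proof -
    have "((\<lambda>z. 1 / (to_complex x + z * to_complex e)) has_field_derivative - to_complex e / (to_complex x)\<^sup>2) (at (complex_of_real 0))"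
      using x0 by (auto intro!: derivative_eq_intros simp: power2_eq_square)
    from has_vector_derivative_real_field[OF this] show ?thesis by simp
  qed
  then have "((\<lambda>t. cauchy_kernel \<epsilon> (x + t *\<^sub>R e)) has_vector_derivative - to_complex e / (to_complex x)\<^sup>2) (at 0)"
    by (rule has_vector_derivative_transform_within_open[OF _ S]) (use False assms in \<open>auto simp: S_def cauchy_kernel_def\<close>)
  then show ?thesis using False by simp
qed

text \<open>Integrate the derivatives of \<open>w \<mapsto> g w * k (z - w)\<close> in both coordinate directions and combine them to
  \<open>\<partial>\<^sub>1 + i \<partial>\<^sub>2\<close>: outside the disc the kernel is holomorphic, so this operator kills it, and inside it
  gives the constant \<open>2 / \<epsilon>\<^sup>2\<close> up to sign, which leaves \<open>2 \<pi>\<close> times the mean of \<open>g\<close> over the disc.\<close>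

lemma cauchy_kernel_average:
  fixes z :: plane
  assumes g: "test_function UNIV g g'" and "\<epsilon> > 0"
  shows "integrable lborel (\<lambda>w. to_complex (g' w) * cauchy_kernel \<epsilon> (z - w))"
    "integral\<^sup>L lborel (\<lambda>w. to_complex (g' w) * cauchy_kernel \<epsilon> (z - w)) =
        of_real (2 / \<epsilon>\<^sup>2 * integral\<^sup>L lborel (\<lambda>w. indicator (cball z \<epsilon>) w * g w))"
proof -
  obtain M R where M: "M \<ge> 0" "\<And>x. \<bar>g x\<bar> \<le> M" "\<And>x. norm (g' x) \<le> M"
     "\<And>x. norm x > R \<Longrightarrow> g x = 0" "\<And>x. norm x > R \<Longrightarrow> g' x = 0"
    using test_function_bounded[OF g] by metis
  have cg: "continuous_on S g" "continuous_on S g'" for S using test_function_continuous[OF g] by auto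
  have gm [measurable]: "g \<in> borel_measurable borel" "g' \<in> borel_measurable borel"
    using cg by (auto intro: borel_measurable_continuous_onI)
  let ?k = "cauchy_kernel \<epsilon>"
  define f where "f = (\<lambda>w. complex_of_real (g w) * ?k (z - w))"
  define D where "D = (\<lambda>e w. complex_of_real (e \<bullet> g' w) * ?k (z - w) - of_real (g w) *
     (if norm (z - w) \<le> \<epsilon> then cnj (to_complex e) / (of_real \<epsilon>)\<^sup>2 else - to_complex e / (to_complex (z - w))\<^sup>2))"
  have lip: "norm (f x - f y) \<le> (M * (3/\<epsilon>\<^sup>2) + M * (1/\<epsilon>)) * norm (x - y)" for x y
  proof -
    have "f x - f y = of_real (g x) * (?k (z - x) - ?k (z - y)) + of_real (g x - g y) * ?k (z - y)"
      by (simp add: f_def algebra_simps)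
    also have "norm \<dots> \<le> \<bar>g x\<bar> * norm (?k (z - x) - ?k (z - y)) + \<bar>g x - g y\<bar> * norm (?k (z - y))"
      by (rule order_trans[OF norm_triangle_ineq]) (simp only: norm_mult norm_of_real)
    also have "\<dots> \<le> M * (3/\<epsilon>\<^sup>2 * norm (x - y)) + (M * norm (x - y)) * (1/\<epsilon>)"
    proof (intro add_mono mult_mono)
      show "norm (?k (z - x) - ?k (z - y)) \<le> 3/\<epsilon>\<^sup>2 * norm (x - y)"
        using cauchy_kernel_lipschitz[OF \<open>\<epsilon> > 0\<close>, of "z - x" "z - y"] by (simp add: norm_minus_commute)
      show "\<bar>g x - g y\<bar> \<le> M * norm (x - y)"
        using test_function_lipschitz[OF g M(3)] by simp
    qed (use M cauchy_kernel_bounds[OF \<open>\<epsilon> > 0\<close>] \<open>\<epsilon> > 0\<close> in auto)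
    also have "\<dots> = (M * (3/\<epsilon>\<^sup>2) + M * (1/\<epsilon>)) * norm (x - y)" by (simp add: algebra_simps)
    finally show ?thesis .
  qed
  have supp: "f x = 0" if "norm x > R" for x using M(4) that by (simp add: f_def)
  have N: "AE w in lborel. w \<notin> sphere z \<epsilon>"
  proof (rule AE_not_in)
    have "sphere z \<epsilon> \<in> null_sets lebesgue" using negligible_sphere[of z \<epsilon>] negligible_iff_null_sets by blast
    moreover have "sphere z \<epsilon> \<in> sets lborel" by (simp add: closed_sphere borel_closed)
    ultimately show "sphere z \<epsilon> \<in> null_sets lborel" using null_sets_completion_iff by blast
  qed
  have deriv: "((\<lambda>t. f (w + t *\<^sub>R e)) has_vector_derivative D e w) (at 0)" if "w \<notin> sphere z \<epsilon>" for w e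
  proof -
    have "((\<lambda>t. ?k (z - w + t *\<^sub>R (- e))) has_vector_derivative (if norm (z - w) \<le> \<epsilon> then cnj (to_complex (- e)) / (of_real \<epsilon>)\<^sup>2 else - to_complex (- e) / (to_complex (z - w))\<^sup>2)) (at 0)"
      by (rule cauchy_kernel_derivative) (use that \<open>\<epsilon> > 0\<close> in \<open>auto simp: dist_norm\<close>)
    moreover have "((\<lambda>t. complex_of_real (g (w + t *\<^sub>R e))) has_vector_derivative of_real (e \<bullet> g' w)) (at 0)"
      using GDERIV_along_line[of g w "g' w" e] g
      by (intro has_vector_derivative_of_real) (auto simp: test_function_def has_real_derivative_iff_has_vector_derivative)
    ultimately have "((\<lambda>t. complex_of_real (g (w + t *\<^sub>R e)) * ?k (z - w + t *\<^sub>R (- e))) has_vector_derivative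
       of_real (g (w + 0 *\<^sub>R e)) * (if norm (z - w) \<le> \<epsilon> then cnj (to_complex (- e)) / (of_real \<epsilon>)\<^sup>2 else - to_complex (- e) / (to_complex (z - w))\<^sup>2)
        + of_real (e \<bullet> g' w) * ?k (z - w + 0 *\<^sub>R (- e))) (at 0)"
      by (intro has_vector_derivative_mult)
    moreover have "to_complex (- e) = - to_complex e" by (simp add: to_complex_def complex_eq_iff)
    ultimately show ?thesis by (cases "norm (z - w) \<le> \<epsilon>") (simp_all add: f_def D_def algebra_simps)
  qed
  have meas: "D e \<in> borel_measurable lborel" for e
    unfolding D_def by measurable
  note I = directional_derivative_integral_zero[OF lip supp N deriv meas]
  \<comment> \<open>The two directional derivatives combine to \<open>\<partial>\<^sub>1 + i \<partial>\<^sub>2\<close>, twice the Cauchy--Riemann operator.\<close>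
  have comb: "D (axis 1 1) w + \<i> * D (axis 2 1) w =
      to_complex (g' w) * ?k (z - w) - of_real (2/\<epsilon>\<^sup>2 * (indicator (cball z \<epsilon>) w * g w))" for w
  proof -
    have t: "to_complex (axis 1 1) = 1" "to_complex (axis 2 1) = \<i>"
      by (auto simp: to_complex_def axis_def complex_eq_iff)
    have g: "axis 1 1 \<bullet> g' w = g' w $ 1" "axis 2 1 \<bullet> g' w = g' w $ 2" by (auto simp: inner_axis' )
    have "to_complex (g' w) = of_real (g' w $ 1) + \<i> * of_real (g' w $ 2)" by (simp add: to_complex_def Complex_eq)
    then show ?thesis using \<open>\<epsilon> > 0\<close> unfolding D_def t g
      by (auto simp: dist_norm indicator_def field_simps)
  qed
  have i1: "integrable lborel (\<lambda>w. D (axis 1 1) w + \<i> * D (axis 2 1) w)"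
    using I(1) by simp
  have "integrable lborel (\<lambda>w. indicator (cball z \<epsilon>) w *\<^sub>R g w)"
    using borel_integrable_compact[OF compact_cball cg(1)] .
  then have i2: "integrable lborel (\<lambda>w. complex_of_real (2/\<epsilon>\<^sup>2 * (indicator (cball z \<epsilon>) w * g w)))"
    by (intro integrable_of_real integrable_mult_right) simp
  have eq: "(\<lambda>w. to_complex (g' w) * ?k (z - w)) = (\<lambda>w. (D (axis 1 1) w + \<i> * D (axis 2 1) w) + of_real (2/\<epsilon>\<^sup>2 * (indicator (cball z \<epsilon>) w * g w)))"
    unfolding comb by simp
  show "integrable lborel (\<lambda>w. to_complex (g' w) * ?k (z - w))"
    unfolding eq using i1 i2 by (rule Bochner_Integration.integrable_add)
  have "integral\<^sup>L lborel (\<lambda>w. D (axis 1 1) w + \<i> * D (axis 2 1) w) = 0"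
    using I by simp
  then have "integral\<^sup>L lborel (\<lambda>w. to_complex (g' w) * ?k (z - w)) = integral\<^sup>L lborel (\<lambda>w. complex_of_real (2/\<epsilon>\<^sup>2 * (indicator (cball z \<epsilon>) w * g w)))"
    unfolding eq using Bochner_Integration.integral_add[OF i1 i2] by simp
  then show "integral\<^sup>L lborel (\<lambda>w. to_complex (g' w) * cauchy_kernel \<epsilon> (z - w)) =
        of_real (2 / \<epsilon>\<^sup>2 * integral\<^sup>L lborel (\<lambda>w. indicator (cball z \<epsilon>) w * g w))"
    by (simp only: integral_complex_of_real integral_mult_right_zero)
qed

text \<open>On the dyadic annulus \<open>\<rho> / 2\<^sup>n\<^sup>+\<^sup>1 < |z - w| \<le> \<rho> / 2\<^sup>n\<close> the integrand is at most \<open>2\<^sup>n\<^sup>+\<^sup>1 / \<rho>\<close>, so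
  the integral is dominated by a geometric series. The series exceeds the exact value \<open>2 \<pi> \<rho>\<close> by a
  factor 2.\<close>

lemma nn_integral_inverse_norm_le:
  fixes z :: plane
  assumes "\<rho> > 0"
  shows "(\<integral>\<^sup>+w. ennreal (indicator (cball z \<rho>) w / norm (z - w)) \<partial>lborel) \<le> ennreal (4 * pi * \<rho>)"
proof -
  have cb [measurable]: "cball z r \<in> sets borel" for r by (simp add: borel_closed)
  define c where "c = (\<lambda>n::nat. 2 ^ Suc n / \<rho>)"
  have cpos: "c n \<ge> 0" for n using assms by (simp add: c_def)
  have "ennreal (indicator (cball z \<rho>) w / norm (z - w)) \<le> (\<Sum>n. ennreal (c n) * indicator (cball z (\<rho> / 2^n)) w)" for w
  proof (cases "w \<in> cball z \<rho> \<and> w \<noteq> z")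
    case True
    then have d: "0 < norm (z - w)" "norm (z - w) \<le> \<rho>" by (auto simp: dist_norm)
    have "\<exists>n. \<rho> / 2 ^ n < norm (z - w)"
    proof -
      obtain n where "(1/2) ^ n < norm (z - w) / \<rho>"
        using real_arch_pow_inv[of "norm (z - w) / \<rho>" "1/2"] d assms by auto
      then have "\<rho> / 2 ^ n < norm (z - w)" using assms by (simp add: field_simps power_divide)
      then show ?thesis ..
    qed
    \<comment> \<open>The point lies in the dyadic annulus that ends at index \<open>m\<close>.\<close>
    define m where "m = (LEAST n. \<rho> / 2 ^ n < norm (z - w))"
    have m: "\<rho> / 2 ^ m < norm (z - w)" unfolding m_def by (rule LeastI_ex) fact
    have "m \<noteq> 0" using m d by (intro notI) simp
    then obtain k where k: "m = Suc k" using not0_implies_Suc by blast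
    have k2: "norm (z - w) \<le> \<rho> / 2 ^ k"
      using not_less_Least[of k "\<lambda>n. \<rho> / 2 ^ n < norm (z - w)"] k unfolding m_def by simp
    have "1 / norm (z - w) \<le> c k"
      using m d assms unfolding k c_def by (simp add: field_simps)
    then have "ennreal (indicator (cball z \<rho>) w / norm (z - w)) \<le> ennreal (c k) * indicator (cball z (\<rho> / 2^k)) w"
      using True k2 by (simp add: dist_norm ennreal_leI)
    also have "\<dots> \<le> (\<Sum>n. ennreal (c n) * indicator (cball z (\<rho> / 2^n)) w)"
    proof -
      define f where "f = (\<lambda>n. ennreal (c n) * indicator (cball z (\<rho> / 2^n)) w)"
      have "f k \<le> suminf f" using sum_le_suminf[of f "{k}"] by simp
      then show ?thesis unfolding f_def .
    qed
    finally show ?thesis .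
  qed auto
  then have "(\<integral>\<^sup>+w. ennreal (indicator (cball z \<rho>) w / norm (z - w)) \<partial>lborel)
      \<le> (\<integral>\<^sup>+w. (\<Sum>n. ennreal (c n) * indicator (cball z (\<rho> / 2^n)) w) \<partial>lborel)"
    by (intro nn_integral_mono) auto
  also have "\<dots> = (\<Sum>n. \<integral>\<^sup>+w. ennreal (c n) * indicator (cball z (\<rho> / 2^n)) w \<partial>lborel)"
    by (intro nn_integral_suminf) measurable
  also have "\<dots> = (\<Sum>n. ennreal ((2 * pi * \<rho>) * (1/2) ^ n))"
  proof (rule suminf_cong)
    fix n
    have "(\<integral>\<^sup>+w. ennreal (c n) * indicator (cball z (\<rho> / 2^n)) w \<partial>lborel) = ennreal (c n) * ennreal (pi * (\<rho> / 2^n)\<^sup>2)"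
      using assms by (subst nn_integral_cmult_indicator) (simp_all add: emeasure_cball unit_ball_vol_2)
    also have "\<dots> = ennreal (c n * (pi * (\<rho> / 2^n)\<^sup>2))" using cpos by (simp add: ennreal_mult)
    also have "c n * (pi * (\<rho> / 2^n)\<^sup>2) = (2 * pi * \<rho>) * (1/2) ^ n"
      using assms by (simp add: c_def power2_eq_square field_simps power_divide)
    finally show "(\<integral>\<^sup>+w. ennreal (c n) * indicator (cball z (\<rho> / 2^n)) w \<partial>lborel) = ennreal ((2 * pi * \<rho>) * (1/2) ^ n)" .
  qed
  also have "\<dots> = ennreal (4 * pi * \<rho>)"
  proof (rule suminf_ennreal_eq)
    show "(\<lambda>n. (2 * pi * \<rho>) * (1/2) ^ n) sums (4 * pi * \<rho>)"
      using sums_mult[OF geometric_sums[of "1/2::real"], of "2 * pi * \<rho>"] by (simp add: mult.assoc)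
  qed (use assms in simp)
  finally show ?thesis .
qed

lemma integrable_inverse_norm:
  fixes z :: plane
  assumes "\<rho> > 0"
  shows "integrable lborel (\<lambda>w. indicator (cball z \<rho>) w / norm (z - w))"
    "integral\<^sup>L lborel (\<lambda>w. indicator (cball z \<rho>) w / norm (z - w)) \<le> 4 * pi * \<rho>"
proof -
  have cb [measurable]: "cball z r \<in> sets borel" for r by (simp add: borel_closed)
  note b = nn_integral_inverse_norm_le[OF assms, of z]
  show "integrable lborel (\<lambda>w. indicator (cball z \<rho>) w / norm (z - w))"
    by (rule integrableI_nonneg) (use b in \<open>auto intro: le_less_trans\<close>)
  show "integral\<^sup>L lborel (\<lambda>w. indicator (cball z \<rho>) w / norm (z - w)) \<le> 4 * pi * \<rho>"
    using enn2real_mono[OF b] assms by (subst integral_eq_nn_integral) auto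
qed

lemma norm_integral_le_integral:
  fixes f :: "'a \<Rightarrow> 'b::{banach, second_countable_topology}"
  assumes "integrable M f" "integrable M g" "\<And>x. x \<in> space M \<Longrightarrow> norm (f x) \<le> g x"
  shows "norm (integral\<^sup>L M f) \<le> integral\<^sup>L M g"
proof -
  have "norm (integral\<^sup>L M f) \<le> integral\<^sup>L M (\<lambda>x. norm (f x))" by (rule integral_norm_bound)
  also have "\<dots> \<le> integral\<^sup>L M g" using assms by (intro Bochner_Integration.integral_mono) auto
  finally show ?thesis .
qed

text \<open>Let \<open>\<epsilon>\<close> tend to 0 in \<open>cauchy_kernel_average\<close>: the left hand sides converge by domination with the
  integrable singularity \<open>1 / |z - w|\<close>, and the means of \<open>g\<close> converge to \<open>g z\<close>.\<close>

lemma cauchy_pompeiu: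
  fixes z :: plane
  assumes g: "test_function UNIV g g'"
  shows "integrable lborel (\<lambda>w. to_complex (g' w) / to_complex (z - w))"
    "integral\<^sup>L lborel (\<lambda>w. to_complex (g' w) / to_complex (z - w)) = of_real (2 * pi * g z)"
proof -
  obtain M R where M: "M \<ge> 0" "\<And>x. \<bar>g x\<bar> \<le> M" "\<And>x. norm (g' x) \<le> M"
     "\<And>x. norm x > R \<Longrightarrow> g x = 0" "\<And>x. norm x > R \<Longrightarrow> g' x = 0"
    using test_function_bounded[OF g] by metis
  have cg: "continuous_on S g" "continuous_on S g'" for S using test_function_continuous[OF g] by auto
  have gm [measurable]: "g \<in> borel_measurable borel" "g' \<in> borel_measurable borel"
    using cg by (auto intro: borel_measurable_continuous_onI)
  \<comment> \<open>The support of \<open>g\<close> lies in the disc of this radius about \<open>z\<close>.\<close>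
  define \<rho> where "\<rho> = \<bar>R\<bar> + norm z + 1"
  have "\<rho> > 0" by (simp add: \<rho>_def add_nonneg_pos)
  define e where "e = (\<lambda>n::nat. 1 / real (Suc n))"
  have e: "e n > 0" for n by (simp add: e_def)
  define F where "F = (\<lambda>n w. to_complex (g' w) * cauchy_kernel (e n) (z - w))"
  define G where "G = (\<lambda>w. to_complex (g' w) / to_complex (z - w))"
  define W where "W = (\<lambda>w. M * (indicator (cball z \<rho>) w / norm (z - w)))"
  have Wint: "integrable lborel W" unfolding W_def by (intro integrable_mult_right integrable_inverse_norm[OF \<open>\<rho> > 0\<close>])
  have lim: "AE w in lborel. (\<lambda>n. F n w) \<longlonglongrightarrow> G w"
    using AE_lborel_singleton[of z]
  proof eventually_elim
    case (elim w)
    have "e \<longlonglongrightarrow> 0" unfolding e_def using lim_1_over_n[where 'a=real] LIMSEQ_Suc by blast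
    then have "\<forall>\<^sub>F n in sequentially. e n < norm (z - w)"
      using elim by (intro order_tendstoD) auto
    then have "\<forall>\<^sub>F n in sequentially. G w = F n w"
      by eventually_elim (auto simp: F_def G_def cauchy_kernel_def)
    then show ?case by (rule Lim_transform_eventually[OF tendsto_const])
  qed
  have bound: "norm (F n w) \<le> W w" if "w \<noteq> z" for n w
  proof (cases "norm w > R")
    case True then show ?thesis using M by (simp add: F_def W_def)
  next
    case False
    have "norm (cauchy_kernel (e n) (z - w)) \<le> 1 / norm (z - w)"
      using cauchy_kernel_bounds(2)[OF e, of n "z - w"] that by auto
    moreover have "w \<in> cball z \<rho>"
      using False norm_triangle_ineq4[of z w] by (auto simp: \<rho>_def dist_norm)
    ultimately show ?thesis unfolding F_def W_def norm_mult using M(1) M(3)[of w]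
      by (intro mult_mono) auto
  qed
  have boundAE: "AE w in lborel. norm (F n w) \<le> W w" for n
    using AE_lborel_singleton[of z] by eventually_elim (rule bound)
  have Gm: "G \<in> borel_measurable lborel" unfolding G_def by measurable
  have Fm: "F n \<in> borel_measurable lborel" for n unfolding F_def by measurable
  show "integrable lborel (\<lambda>w. to_complex (g' w) / to_complex (z - w))"
    using integrable_dominated_convergence[OF Gm Fm Wint lim boundAE] unfolding G_def .
  have L1: "(\<lambda>n. integral\<^sup>L lborel (F n)) \<longlonglongrightarrow> integral\<^sup>L lborel G"
    using integral_dominated_convergence[OF Gm Fm Wint lim boundAE] .
  define A where "A = (\<lambda>n. 2 / (e n)\<^sup>2 * integral\<^sup>L lborel (\<lambda>w. indicator (cball z (e n)) w * g w))"
  have FA: "integral\<^sup>L lborel (F n) = of_real (A n)" for n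
    unfolding F_def A_def by (rule cauchy_kernel_average(2)[OF g e])
  have "\<bar>A n - 2 * pi * g z\<bar> \<le> 2 * pi * M * e n" for n
  proof -
    let ?B = "cball z (e n)"
    have mB: "measure lborel ?B = pi * (e n)\<^sup>2"
      using e[of n] by (simp add: content_cball unit_ball_vol_2)
    have fB: "emeasure lborel ?B < \<infinity>" by (simp add: emeasure_cball e less_imp_le)
    have sB: "?B \<in> sets lborel" by (simp add: borel_closed)
    have ig: "integrable lborel (\<lambda>w. indicator ?B w * g w)"
      using borel_integrable_compact[OF compact_cball cg(1), of z "e n"] by simp
    have ic: "integrable lborel (\<lambda>w. indicator ?B w * c)" for c :: real
      using sB fB by (intro integrable_mult_left) (simp add: integrable_indicator_iff)
    have "integral\<^sup>L lborel (\<lambda>w. indicator ?B w * g w) - pi * (e n)\<^sup>2 * g z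
       = integral\<^sup>L lborel (\<lambda>w. indicator ?B w * g w - indicator ?B w * g z)"
      using Bochner_Integration.integral_diff[OF ig ic[of "g z"]] mB by simp
    also have "\<bar>\<dots>\<bar> \<le> integral\<^sup>L lborel (\<lambda>w. indicator ?B w * (M * e n))"
    proof -
      have "norm (indicator ?B w * g w - indicator ?B w * g z) \<le> indicator ?B w * (M * e n)" for w
      proof (cases "w \<in> ?B")
        case True
        have "norm (g w - g z) \<le> M * norm (w - z)" using test_function_lipschitz[OF g M(3)] .
        also have "\<dots> \<le> M * e n" using True M(1) by (intro mult_left_mono) (auto simp: dist_norm norm_minus_commute)
        finally show ?thesis using True by simp
      qed auto
      then show ?thesis
        using norm_integral_le_integral[of lborel "\<lambda>w. indicator ?B w * g w - indicator ?B w * g z" "\<lambda>w. indicator ?B w * (M * e n)"]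
          Bochner_Integration.integrable_diff[OF ig ic] ic by (simp only: real_norm_def)
    qed
    also have "\<dots> = pi * (e n)\<^sup>2 * (M * e n)" using mB by simp
    finally have *: "\<bar>integral\<^sup>L lborel (\<lambda>w. indicator ?B w * g w) - pi * (e n)\<^sup>2 * g z\<bar> \<le> pi * (e n)\<^sup>2 * (M * e n)" .
    have "A n - 2 * pi * g z = 2 / (e n)\<^sup>2 * (integral\<^sup>L lborel (\<lambda>w. indicator ?B w * g w) - pi * (e n)\<^sup>2 * g z)"
      using e[of n] by (simp add: A_def field_simps)
    then have "\<bar>A n - 2 * pi * g z\<bar> = 2 / (e n)\<^sup>2 * \<bar>integral\<^sup>L lborel (\<lambda>w. indicator ?B w * g w) - pi * (e n)\<^sup>2 * g z\<bar>"
      by (simp only: abs_mult) simp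
    also have "\<dots> \<le> 2 / (e n)\<^sup>2 * (pi * (e n)\<^sup>2 * (M * e n))"
      using * by (intro mult_left_mono) auto
    also have "\<dots> = 2 * pi * M * e n" using e[of n] by (simp add: field_simps)
    finally show ?thesis .
  qed
  moreover have "(\<lambda>n. 2 * pi * M * e n) \<longlonglongrightarrow> 0"
  proof -
    have "e \<longlonglongrightarrow> 0" unfolding e_def using lim_1_over_n[where 'a=real] LIMSEQ_Suc by blast
    from tendsto_mult_right_zero[OF this] show ?thesis .
  qed
  ultimately have "(\<lambda>n. A n - 2 * pi * g z) \<longlonglongrightarrow> 0"
    by (intro Lim_null_comparison[of "\<lambda>n. A n - 2 * pi * g z"]) auto
  then have "A \<longlonglongrightarrow> 2 * pi * g z" by (rule LIM_zero_cancel)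
  then have "(\<lambda>n. integral\<^sup>L lborel (F n)) \<longlonglongrightarrow> of_real (2 * pi * g z)"
    unfolding FA by (rule tendsto_of_real)
  from LIMSEQ_unique[OF L1 this]
  show "integral\<^sup>L lborel (\<lambda>w. to_complex (g' w) / to_complex (z - w)) = of_real (2 * pi * g z)"
    unfolding G_def .
qed

text \<open>Inserting the Cauchy--Pompeiu formula for \<open>g (c s)\<close> and applying Fubini turns the line integral of
  \<open>g\<close> into an area integral of its gradient against the Cauchy transform of the curve, which is a
  winding number up to a factor. The absolute integrability that Fubini needs follows from the bound
  on the integral of \<open>1 / |z - w|\<close>, uniform in \<open>z\<close>.\<close>

lemma cauchy_pompeiu_curve:
  fixes c :: "real \<Rightarrow> plane" and d :: "real \<Rightarrow> complex"
  assumes g: "test_function UNIV g g'"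
    and c [measurable]: "c \<in> borel_measurable borel" and cB: "\<And>s. norm (c s) \<le> B"
    and d [measurable]: "d \<in> borel_measurable borel" and dL: "\<And>s. norm (d s) \<le> L * indicator {0..1} s"
  shows "of_real (2 * pi) * integral\<^sup>L lborel (\<lambda>s. of_real (g (c s)) * d s) =
      integral\<^sup>L lborel (\<lambda>w. to_complex (g' w) * integral\<^sup>L lborel (\<lambda>s. d s / to_complex (c s - w)))"
    "integrable lborel (\<lambda>w. to_complex (g' w) * integral\<^sup>L lborel (\<lambda>s. d s / to_complex (c s - w)))"
proof -
  obtain M R where M: "M \<ge> 0" "\<And>x. \<bar>g x\<bar> \<le> M" "\<And>x. norm (g' x) \<le> M"
     "\<And>x. norm x > R \<Longrightarrow> g x = 0" "\<And>x. norm x > R \<Longrightarrow> g' x = 0"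
    using test_function_bounded[OF g] by metis
  have gm [measurable]: "g \<in> borel_measurable borel" "g' \<in> borel_measurable borel"
    using test_function_continuous[OF g] by (auto intro: borel_measurable_continuous_onI)
  have "L \<ge> 0" using dL[of 0] norm_ge_zero[of "d 0"] by (simp del: norm_ge_zero)
  define \<rho> where "\<rho> = \<bar>R\<bar> + B + 1"
  have "B \<ge> 0" using cB[of 0] norm_ge_zero[of "c 0"] by linarith
  then have "\<rho> > 0" by (simp add: \<rho>_def)
  define H where "H = (\<lambda>s w. d s * (to_complex (g' w) / to_complex (c s - w)))"
  have Hm: "case_prod H \<in> borel_measurable (lborel \<Otimes>\<^sub>M lborel)"
    unfolding H_def by measurable
  have Hi: "integrable lborel (H s)" for s
    unfolding H_def by (intro integrable_mult_right cauchy_pompeiu(1)[OF g])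
  have inner: "integral\<^sup>L lborel (\<lambda>w. norm (H s w)) \<le> L * indicator {0..1} s * (M * (4 * pi * \<rho>))" for s
  proof -
    have "norm (H s w) \<le> L * indicator {0..1} s * (M * (indicator (cball (c s) \<rho>) w / norm (c s - w)))" for w
      unfolding H_def norm_mult norm_divide norm_to_complex
    proof (intro mult_mono dL)
      show "norm (g' w) / norm (c s - w) \<le> M * (indicator (cball (c s) \<rho>) w / norm (c s - w))"
      proof (cases "norm w > R")
        case True then show ?thesis using M by simp
      next
        case False
        then have "w \<in> cball (c s) \<rho>"
          using norm_triangle_ineq4[of "c s" w] cB[of s] by (auto simp: \<rho>_def dist_norm)
        then show ?thesis using M(3)[of w] by (simp add: divide_right_mono)
      qed
    qed (use \<open>L \<ge> 0\<close> in auto)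
    then have "integral\<^sup>L lborel (\<lambda>w. norm (H s w)) \<le>
      integral\<^sup>L lborel (\<lambda>w. L * indicator {0..1} s * (M * (indicator (cball (c s) \<rho>) w / norm (c s - w))))"
      by (intro integral_mono integrable_norm Hi integrable_mult_right integrable_inverse_norm[OF \<open>\<rho> > 0\<close>])
    also have "\<dots> = L * indicator {0..1} s * (M * integral\<^sup>L lborel (\<lambda>w. indicator (cball (c s) \<rho>) w / norm (c s - w)))"
      by (simp only: integral_mult_right_zero)
    also have "\<dots> \<le> L * indicator {0..1} s * (M * (4 * pi * \<rho>))"
      using \<open>L \<ge> 0\<close> M(1) by (intro mult_left_mono integrable_inverse_norm[OF \<open>\<rho> > 0\<close>]) auto
    finally show ?thesis .
  qed
  have "integrable lborel (\<lambda>s. integral\<^sup>L lborel (\<lambda>w. norm (H s w)))"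
  proof (rule Bochner_Integration.integrable_bound)
    show "integrable lborel (\<lambda>s::real. L * indicator {0..1} s * (M * (4 * pi * \<rho>)))" by simp
    show "(\<lambda>s. integral\<^sup>L lborel (\<lambda>w. norm (H s w))) \<in> borel_measurable lborel"
      using Hm by (intro lborel.borel_measurable_lebesgue_integral) (simp add: split_def)
    show "AE s in lborel. norm (integral\<^sup>L lborel (\<lambda>w. norm (H s w))) \<le> norm (L * indicator {0..1} s * (M * (4 * pi * \<rho>)))"
    proof (rule AE_I2)
      fix s
      have "0 \<le> integral\<^sup>L lborel (\<lambda>w. norm (H s w))" by (rule integral_nonneg_AE) simp
      with inner[of s] show "norm (integral\<^sup>L lborel (\<lambda>w. norm (H s w))) \<le> norm (L * indicator {0..1} s * (M * (4 * pi * \<rho>)))"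
        by simp
    qed
  qed
  then have Hp: "integrable (lborel \<Otimes>\<^sub>M lborel) (case_prod H)"
    using Hi by (intro lborel_pair.Fubini_integrable Hm) auto
  have swap: "integral\<^sup>L lborel (\<lambda>w. H s w) = d s * of_real (2 * pi * g (c s))" for s
    unfolding H_def integral_mult_right_zero by (simp only: cauchy_pompeiu(2)[OF g])
  have Hw: "integral\<^sup>L lborel (\<lambda>s. H s w) = to_complex (g' w) * integral\<^sup>L lborel (\<lambda>s. d s / to_complex (c s - w))" for w
  proof -
    have "(\<lambda>s. H s w) = (\<lambda>s. to_complex (g' w) * (d s / to_complex (c s - w)))" by (simp add: H_def fun_eq_iff)
    then show ?thesis by (simp only: integral_mult_right_zero)
  qed
  have "(LINT w|lborel. LINT s|lborel. H s w) = (LINT s|lborel. LINT w|lborel. H s w)"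
    by (rule lborel_pair.Fubini_integral[OF Hp])
  also have "\<dots> = (LINT s|lborel. of_real (2 * pi) * (of_real (g (c s)) * d s))"
    unfolding swap by (intro Bochner_Integration.integral_cong) auto
  also have "\<dots> = of_real (2 * pi) * integral\<^sup>L lborel (\<lambda>s. of_real (g (c s)) * d s)"
    by (simp only: integral_mult_right_zero)
  finally show "of_real (2 * pi) * integral\<^sup>L lborel (\<lambda>s. of_real (g (c s)) * d s) =
      integral\<^sup>L lborel (\<lambda>w. to_complex (g' w) * integral\<^sup>L lborel (\<lambda>s. d s / to_complex (c s - w)))"
    unfolding Hw by simp
  show "integrable lborel (\<lambda>w. to_complex (g' w) * integral\<^sup>L lborel (\<lambda>s. d s / to_complex (c s - w)))"
    using lborel_pair.integrable_snd[OF Hp] unfolding Hw by simp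
qed

section \<open>Piecewise regular curves\<close>

lemma has_integral_curve_from_lborel:
  fixes f k :: "real \<Rightarrow> 'a::euclidean_space"
  assumes "integrable lborel f" "\<And>s. s \<notin> {0..1} \<Longrightarrow> f s = 0" "finite P" "\<And>s. s \<in> {0..1} - P \<Longrightarrow> k s = f s"
  shows "(k has_integral integral\<^sup>L lborel f) {0..1}"
proof (rule has_integral_spike_finite[OF assms(3,4)])
  have "(f has_integral integral\<^sup>L lborel f) UNIV" using assms(1) by (rule has_integral_integral_lborel)
  moreover have "f = (\<lambda>s. if s \<in> {0..1} then f s else 0)" using assms(2) by auto
  ultimately have "((\<lambda>s. if s \<in> {0..1} then f s else 0) has_integral integral\<^sup>L lborel f) UNIV" by simp
  then show "(f has_integral integral\<^sup>L lborel f) {0..1}" by (simp only: has_integral_restrict_UNIV)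
qed auto

lemma piecewise_regular_local:
  assumes P: "finite P" "{0,1} \<subseteq> P" and s: "s \<in> {0..1} - P"
  obtains a b :: real where "a \<in> P" "b \<in> P" "a < s" "s < b" "{a<..<b} \<inter> P = {}"
proof -
  define a where "a = Max {p\<in>P. p < s}"
  define b where "b = Min {p\<in>P. p > s}"
  have "s \<noteq> 0" "s \<noteq> 1" using s P by auto
  then have "0 \<in> {p\<in>P. p < s}" "1 \<in> {p\<in>P. p > s}" using s P by auto
  then have ne: "{p\<in>P. p < s} \<noteq> {}" "{p\<in>P. p > s} \<noteq> {}" by blast+
  have fin: "finite {p\<in>P. p < s}" "finite {p\<in>P. p > s}" using P by auto
  have a: "a \<in> P" "a < s" "\<And>p. p \<in> P \<Longrightarrow> p < s \<Longrightarrow> p \<le> a"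
    using Max_in[OF fin(1) ne(1)] Max_ge[OF fin(1)] unfolding a_def by auto
  have b: "b \<in> P" "b > s" "\<And>p. p \<in> P \<Longrightarrow> p > s \<Longrightarrow> p \<ge> b"
    using Min_in[OF fin(2) ne(2)] Min_le[OF fin(2)] unfolding b_def by auto
  have "{a<..<b} \<inter> P = {}"
  proof (rule ccontr)
    assume "{a<..<b} \<inter> P \<noteq> {}"
    then obtain p where p: "p \<in> P" "a < p" "p < b" by auto
    then have "p \<noteq> s" using s by auto
    then show False using a(3)[of p] b(3)[of p] p by linarith
  qed
  then show ?thesis using that a b by blast
qed

text \<open>Integration along a piecewise regular curve rests on a bounded measurable velocity outside finitely
  many parameters and on the resulting Lipschitz bound. Setting the velocity to 0 outside \<open>[0, 1]\<close>
  permits integration over the whole line. Its measurability is that of a limit of difference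
  quotients.\<close>

lemma piecewise_regular_velocity:
  assumes "piecewise_regular \<gamma>"
  obtains P d L where "finite P" "{0,1} \<subseteq> P" "d \<in> borel_measurable borel" "L > 0"
    "\<And>s. norm (d s) \<le> L * indicator {0..1} s"
    "\<And>s. s \<in> {0..1} - P \<Longrightarrow> (\<gamma> has_vector_derivative d s) (at s) \<and> d s \<noteq> 0"
    "\<And>x y. x \<in> {0..1} \<Longrightarrow> y \<in> {0..1} \<Longrightarrow> norm (\<gamma> x - \<gamma> y) \<le> L * \<bar>x - y\<bar>"
    "valid_path (to_complex \<circ> \<gamma>)"
proof -
  obtain P where P: "finite P" "{0,1} \<subseteq> P" "P \<subseteq> {0..1}"
    and pieces: "\<forall>a\<in>P. \<forall>b\<in>P. a < b \<and> {a<..<b} \<inter> P = {} \<longrightarrow>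
           (\<exists>d. continuous_on {a..b} d \<and>
              (\<forall>s\<in>{a..b}. (\<gamma> has_vector_derivative d s) (at s within {a..b}) \<and> d s \<noteq> 0))"
    using assms unfolding piecewise_regular_def by (elim conjE exE)
  have cont: "continuous_on {0..1} \<gamma>" using assms by (simp add: piecewise_regular_def path_def)
  \<comment> \<open>Pairs of consecutive nodes.\<close>
  define Q where "Q = {(a,b). a \<in> P \<and> b \<in> P \<and> a < b \<and> {a<..<b} \<inter> P = {}}"
  have "finite Q" by (rule finite_subset[of _ "P \<times> P"]) (use P in \<open>auto simp: Q_def\<close>)
  define good where "good = (\<lambda>(a,b) d. continuous_on {a..b} d \<and>
              (\<forall>s\<in>{a..b}. (\<gamma> has_vector_derivative d s) (at s within {a..b}) \<and> d s \<noteq> 0))"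
  have "\<forall>q\<in>Q. \<exists>d. good q d" using pieces by (auto simp: Q_def good_def)
  then obtain D where D: "\<And>q. q \<in> Q \<Longrightarrow> good q (D q)" by metis
  have "\<exists>B. \<forall>s\<in>{fst q..snd q}. norm (D q s) \<le> B" if "q \<in> Q" for q
  proof -
    have "compact (D q ` {fst q..snd q})" using D[OF that]
      by (intro compact_continuous_image) (auto simp: good_def split_def)
    then have "bounded (D q ` {fst q..snd q})" by (rule compact_imp_bounded)
    then show ?thesis unfolding bounded_iff by blast
  qed
  then obtain B where B: "\<And>q s. q \<in> Q \<Longrightarrow> s \<in> {fst q..snd q} \<Longrightarrow> norm (D q s) \<le> B q" by metis
  define L where "L = 1 + (\<Sum>q\<in>Q. \<bar>B q\<bar>)"
  have "L > 0" unfolding L_def by (simp add: add_pos_nonneg sum_nonneg)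
  have BL: "B q \<le> L" if "q \<in> Q" for q
    using member_le_sum[OF that, of "\<lambda>q. \<bar>B q\<bar>"] \<open>finite Q\<close> unfolding L_def by fastforce
  define v where "v = (\<lambda>s. vector_derivative \<gamma> (at s))"
  define d where "d = (\<lambda>s. if s \<in> {0..1} - P then v s else 0)"
  have loc: "\<exists>q\<in>Q. fst q < s \<and> s < snd q \<and> (\<forall>r. fst q < r \<and> r < snd q \<longrightarrow>
      (\<gamma> has_vector_derivative D q r) (at r) \<and> v r = D q r \<and> D q r \<noteq> 0 \<and> norm (D q r) \<le> L)" if s: "s \<in> {0..1} - P" for s
  proof -
    obtain a b where ab: "a \<in> P" "b \<in> P" "a < s" "s < b" "{a<..<b} \<inter> P = {}"
      using piecewise_regular_local[OF P(1,2) s] by blast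
    then have q: "(a,b) \<in> Q" by (auto simp: Q_def)
    have "(\<gamma> has_vector_derivative D (a,b) r) (at r) \<and> v r = D (a,b) r \<and> D (a,b) r \<noteq> 0 \<and> norm (D (a,b) r) \<le> L" if r: "a < r" "r < b" for r
    proof -
      have r': "r \<in> {a..b}" using r by auto
      have "(\<gamma> has_vector_derivative D (a,b) r) (at r within {a..b})"
        using D[OF q] r' by (simp add: good_def)
      moreover have "at r within {a..b} = at r" using r by (simp add: at_within_Icc_at)
      ultimately have 1: "(\<gamma> has_vector_derivative D (a,b) r) (at r)" by simp
      then have "v r = D (a,b) r" unfolding v_def by (rule vector_derivative_at)
      moreover have "D (a,b) r \<noteq> 0" using D[OF q] r' by (simp add: good_def)
      moreover have "norm (D (a,b) r) \<le> L" using B[OF q, of r] BL[OF q] r' by simp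
      ultimately show ?thesis using 1 by blast
    qed
    then show ?thesis using q ab by (intro bexI[of _ "(a,b)"]) auto
  qed
  have vd: "(\<gamma> has_vector_derivative d s) (at s) \<and> d s \<noteq> 0 \<and> norm (d s) \<le> L" if "s \<in> {0..1} - P" for s
    using loc[OF that] that unfolding d_def by auto
  have lip0: "norm (\<gamma> y - \<gamma> x) \<le> L * (y - x)" if xy: "x \<in> {0..1}" "y \<in> {0..1}" "x \<le> y" for x y
  proof -
    have "(d has_integral (\<gamma> y - \<gamma> x)) {x..y}"
    proof (rule fundamental_theorem_of_calculus_interior_strong[OF P(1) xy(3)])
      show "(\<gamma> has_vector_derivative d s) (at s)" if "s \<in> {x<..<y} - P" for s
        using vd[of s] that xy by auto
      show "continuous_on {x..y} \<gamma>" using cont by (rule continuous_on_subset) (use xy in auto)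
    qed
    then have "norm (\<gamma> y - \<gamma> x) \<le> L * measure lborel (cbox x y)"
      using vd xy \<open>L > 0\<close> by (intro has_integral_bound_spike_finite[OF _ P(1), where f=d]) (auto simp: cbox_interval)
    then show ?thesis using xy by simp
  qed
  have lip: "norm (\<gamma> x - \<gamma> y) \<le> L * \<bar>x - y\<bar>" if "x \<in> {0..1}" "y \<in> {0..1}" for x y
  proof (cases "x \<le> y")
    case True then show ?thesis using lip0[of x y] that by (simp add: norm_minus_commute)
  next
    case False then show ?thesis using lip0[of y x] that by simp
  qed
  have "valid_path (to_complex \<circ> \<gamma>)"
    unfolding valid_path_def piecewise_C1_differentiable_on_def
  proof (intro conjI exI[of _ P])
    show "continuous_on {0..1} (to_complex \<circ> \<gamma>)" using cont unfolding comp_def by (rule continuous_on_to_complex)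
    show "to_complex \<circ> \<gamma> C1_differentiable_on {0..1} - P"
      unfolding C1_differentiable_on_def
    proof (intro exI[of _ "\<lambda>s. to_complex (v s)"] conjI ballI)
      fix s assume s: "s \<in> {0..1} - P"
      have "(\<gamma> has_vector_derivative v s) (at s)" using vd[OF s] s by (simp add: d_def)
      from bounded_linear.has_vector_derivative[OF bounded_linear_to_complex this]
      show "(to_complex \<circ> \<gamma> has_vector_derivative to_complex (v s)) (at s)" by (simp add: comp_def)
    next
      have "isCont v s" if s: "s \<in> {0..1} - P" for s
      proof -
        obtain q where q: "q \<in> Q" "fst q < s" "s < snd q" "\<And>r. fst q < r \<Longrightarrow> r < snd q \<Longrightarrow> v r = D q r"
          using loc[OF s] by blast
        have "continuous_on {fst q..snd q} (D q)" using D[OF q(1)] by (simp add: good_def split_def)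
        then have "continuous_on {fst q<..<snd q} (D q)" by (rule continuous_on_subset) auto
        then have "continuous_on {fst q<..<snd q} v" by (rule continuous_on_eq) (use q(4) in auto)
        then show ?thesis using q(2,3) by (simp add: continuous_on_eq_continuous_at)
      qed
      then have "continuous_on ({0..1} - P) v" by (intro continuous_at_imp_continuous_on) auto
      then show "continuous_on ({0..1} - P) (\<lambda>s. to_complex (v s))" by (rule continuous_on_to_complex)
    qed
  qed (rule P)
  moreover have "d \<in> borel_measurable borel"
  proof -
    define c where "c = (\<lambda>s. \<gamma> (max 0 (min 1 s)))"
    have "continuous_on UNIV c" unfolding c_def
      by (rule continuous_on_compose2[OF cont]) (auto intro!: continuous_intros)
    then have [measurable]: "c \<in> borel_measurable borel" by (rule borel_measurable_continuous_onI)
    have [measurable]: "P \<in> sets borel" using P(1) finite_imp_closed borel_closed by blast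
    define q where "q = (\<lambda>(n::nat) s. if s \<in> {0..1} - P then (c (s + 1 / real (Suc n)) - c s) /\<^sub>R (1 / real (Suc n)) else 0)"
    have qm: "q n \<in> borel_measurable borel" for n unfolding q_def by measurable
    have "(\<lambda>n. q n s) \<longlonglongrightarrow> d s" for s
    proof (cases "s \<in> {0..1} - P")
      case True
      have s01: "0 < s" "s < 1" using True P(2) by (auto simp: less_le)
      have "(\<gamma> has_vector_derivative d s) (at s)" using vd[OF True] by blast
      then have T: "((\<lambda>r. (\<gamma> r - \<gamma> s - (r - s) *\<^sub>R d s) /\<^sub>R norm (r - s)) \<longlongrightarrow> 0) (at s)"
        by (simp add: has_vector_derivative_def has_derivative_within diff_diff_eq inverse_eq_divide)
      have e: "(\<lambda>n. 1 / real (Suc n)) \<longlonglongrightarrow> 0"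
        using lim_1_over_n[where 'a=real] LIMSEQ_Suc by blast
      have F: "filterlim (\<lambda>n. s + 1 / real (Suc n)) (at s) sequentially"
        using tendsto_add[OF tendsto_const e, of s] by (simp add: filterlim_at)
      have "(\<lambda>n. (\<gamma> (s + 1 / real (Suc n)) - \<gamma> s - (1 / real (Suc n)) *\<^sub>R d s) /\<^sub>R (1 / real (Suc n))) \<longlonglongrightarrow> 0"
        using filterlim_compose[OF T F] by simp
      then have l: "(\<lambda>n. (\<gamma> (s + 1 / real (Suc n)) - \<gamma> s) /\<^sub>R (1 / real (Suc n)) - d s) \<longlonglongrightarrow> 0"
        by (simp add: scaleR_diff_right)
      have "\<forall>\<^sub>F n in sequentially. 1 / real (Suc n) < 1 - s"
        using e s01 by (intro order_tendstoD) auto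
      then have "\<forall>\<^sub>F n in sequentially. (\<gamma> (s + 1 / real (Suc n)) - \<gamma> s) /\<^sub>R (1 / real (Suc n)) = q n s"
      proof eventually_elim
        case (elim n)
        have "0 \<le> 1 / real (Suc n)" by simp
        then have "c (s + 1 / real (Suc n)) = \<gamma> (s + 1 / real (Suc n))" "c s = \<gamma> s"
          using elim s01 by (auto simp: c_def min_def max_def)
        then show ?case using True by (simp add: q_def)
      qed
      then show ?thesis using LIM_zero_cancel[OF l] by (rule Lim_transform_eventually[rotated])
    next
      case False show ?thesis by (simp only: q_def d_def False if_False tendsto_const)
    qed
    then show ?thesis by (intro borel_measurable_LIMSEQ_metric[OF qm])
  qed
  moreover have "norm (d s) \<le> L * indicator {0..1} s" for s
    using vd[of s] \<open>L > 0\<close> by (auto simp: d_def indicator_def)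
  ultimately show ?thesis using that P vd lip \<open>L > 0\<close> by blast
qed

lemma piecewise_regular_image_negligible:
  assumes "piecewise_regular \<gamma>"
  shows "negligible (path_image \<gamma>)"
proof -
  obtain P d where P: "finite P" "\<And>s. s \<in> {0..1} - P \<Longrightarrow> (\<gamma> has_vector_derivative d s) (at s)"
    by (rule piecewise_regular_velocity[OF assms]) blast
  have "\<gamma> differentiable_on ({0..1} - P)"
    unfolding differentiable_on_def
    by (meson P(2) differentiable_at_withinI differentiableI_vector)
  then have "negligible (\<gamma> ` ({0..1} - P))"
    by (intro negligible_differentiable_image_lowdim) auto
  moreover have "negligible (\<gamma> ` P)" using P(1) by (simp add: negligible_finite)
  ultimately have "negligible (\<gamma> ` ({0..1} - P) \<union> \<gamma> ` P)" by (rule negligible_Un)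
  then show ?thesis by (rule negligible_subset) (auto simp: path_image_def)
qed

section \<open>Green's formula from winding numbers\<close>

text \<open>The vector with components \<open>\<gamma>'\<^sub>2\<close> and \<open>- \<gamma>'\<^sub>1\<close> is the outward normal times the speed, so this is the
  integral of the normal component of \<open>V\<close> over the boundary.\<close>

definition flux :: "(real \<Rightarrow> plane) set \<Rightarrow> (plane \<Rightarrow> plane) \<Rightarrow> real" where
  "flux C V = (\<Sum>\<gamma>\<in>C. integral {0..1} (\<lambda>s. V (\<gamma> s) $ 1 * vector_derivative \<gamma> (at s) $ 2
                                          - V (\<gamma> s) $ 2 * vector_derivative \<gamma> (at s) $ 1))"

lemma clamped_path:
  fixes \<gamma> :: "real \<Rightarrow> plane"
  assumes "continuous_on {0..1} \<gamma>" and c_def: "c = (\<lambda>s. \<gamma> (max 0 (min 1 s)))"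
  shows "continuous_on UNIV c" "\<And>s. c s \<in> path_image \<gamma>" "\<And>s. s \<in> {0..1} \<Longrightarrow> c s = \<gamma> s"
proof -
  show "continuous_on UNIV c" unfolding c_def
    by (rule continuous_on_compose2[OF assms(1)]) (auto intro!: continuous_intros)
  show "c s \<in> path_image \<gamma>" for s unfolding c_def path_image_def by (intro imageI) auto
  show "c s = \<gamma> s" if "s \<in> {0..1}" for s using that by (auto simp: c_def)
qed

lemma integrable_lborel_bounded_support:
  fixes f :: "real \<Rightarrow> 'a::euclidean_space"
  assumes "f \<in> borel_measurable borel" "\<And>s. norm (f s) \<le> B * indicator {0..1} s"
  shows "integrable lborel f" "norm (integral\<^sup>L lborel f) \<le> B"
proof -
  have i: "integrable lborel (\<lambda>s::real. B * indicator {0..1} s)" by simp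
  have n: "norm (f s) \<le> norm (B * indicator {0..1} s)" for s
    using assms(2)[of s] norm_ge_zero[of "f s"] by (auto simp: indicator_def)
  show f: "integrable lborel f"
    by (rule Bochner_Integration.integrable_bound[OF i]) (use assms(1) n in auto)
  have "norm (integral\<^sup>L lborel f) \<le> integral\<^sup>L lborel (\<lambda>s::real. B * indicator {0..1} s)"
    using f i assms(2) by (rule norm_integral_le_integral)
  then show "norm (integral\<^sup>L lborel f) \<le> B" by simp
qed

text \<open>The constant is chosen before the integrand, which is what makes uniform approximation of the
  integrand effective.\<close>

lemma curve_integral_bound:
  assumes "piecewise_regular \<gamma>"
  obtains L where "L > 0"
    "\<And>h M i. continuous_on (path_image \<gamma>) (h :: plane \<Rightarrow> real) \<Longrightarrow> (\<And>x. x \<in> path_image \<gamma> \<Longrightarrow> \<bar>h x\<bar> \<le> M) \<Longrightarrow>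
       (\<lambda>s. h (\<gamma> s) * vector_derivative \<gamma> (at s) $ i) integrable_on {0..1} \<and>
       \<bar>integral {0..1} (\<lambda>s. h (\<gamma> s) * vector_derivative \<gamma> (at s) $ i)\<bar> \<le> M * L"
proof -
  obtain P d L where P: "finite P" and d: "d \<in> borel_measurable borel" and "L > 0"
    and dL: "\<And>s. norm (d s) \<le> L * indicator {0..1} s"
    and dd: "\<And>s. s \<in> {0..1} - P \<Longrightarrow> (\<gamma> has_vector_derivative d s) (at s)"
    by (rule piecewise_regular_velocity[OF assms]) blast
  have cont: "continuous_on {0..1} \<gamma>" using assms by (simp add: piecewise_regular_def path_def)
  show ?thesis
  proof (rule that[OF \<open>L > 0\<close>])
    fix h :: "plane \<Rightarrow> real" and M i
    assume h: "continuous_on (path_image \<gamma>) h" and hM: "\<And>x. x \<in> path_image \<gamma> \<Longrightarrow> \<bar>h x\<bar> \<le> M"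
    define c where "c = (\<lambda>s. \<gamma> (max 0 (min 1 s)))"
    note c = clamped_path[OF cont c_def]
    have "continuous_on UNIV (\<lambda>s. h (c s))"
      by (rule continuous_on_compose2[OF h c(1)]) (use c(2) in auto)
    then have [measurable]: "(\<lambda>s. h (c s)) \<in> borel_measurable borel" by (rule borel_measurable_continuous_onI)
    have "continuous_on UNIV (\<lambda>x::plane. x $ i)" by (intro continuous_intros)
    then have "(\<lambda>x::plane. x $ i) \<in> borel_measurable borel" by (rule borel_measurable_continuous_onI)
    then have [measurable]: "(\<lambda>s. d s $ i) \<in> borel_measurable borel" using d by measurable
    define f where "f = (\<lambda>s. h (c s) * d s $ i)"
    have fm: "f \<in> borel_measurable borel" unfolding f_def by measurable
    have fb: "norm (f s) \<le> (M * L) * indicator {0..1} s" for s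
    proof -
      have "norm (f s) \<le> M * (L * indicator {0..1} s)"
        unfolding f_def norm_mult
        using hM[OF c(2), of s] dL[of s] component_le_norm_cart[of "d s" i] \<open>L > 0\<close>
        by (intro mult_mono) auto
      then show ?thesis by simp
    qed
    note I = integrable_lborel_bounded_support[OF fm fb]
    have "f s = 0" if "s \<notin> {0..1}" for s using fb[of s] that by simp
    moreover have "h (\<gamma> s) * vector_derivative \<gamma> (at s) $ i = f s" if "s \<in> {0..1} - P" for s
      using dd[OF that] c(3)[of s] that by (simp add: f_def vector_derivative_at)
    ultimately have "((\<lambda>s. h (\<gamma> s) * vector_derivative \<gamma> (at s) $ i) has_integral integral\<^sup>L lborel f) {0..1}"
      by (intro has_integral_curve_from_lborel[OF I(1) _ P])
    then show "(\<lambda>s. h (\<gamma> s) * vector_derivative \<gamma> (at s) $ i) integrable_on {0..1} \<and>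
       \<bar>integral {0..1} (\<lambda>s. h (\<gamma> s) * vector_derivative \<gamma> (at s) $ i)\<bar> \<le> M * L"
      using I(2) by (auto simp: integral_unique has_integral_integrable)
  qed
qed

lemma integral_lebesgue_on_eq_lborel:
  fixes f :: "plane \<Rightarrow> 'a::euclidean_space"
  assumes "open \<Omega>" "f \<in> borel_measurable borel"
  shows "integral\<^sup>L (lebesgue_on \<Omega>) f = integral\<^sup>L lborel (\<lambda>x. indicator \<Omega> x *\<^sub>R f x)"
    "integrable (lebesgue_on \<Omega>) f \<longleftrightarrow> integrable lborel (\<lambda>x. indicator \<Omega> x *\<^sub>R f x)"
proof -
  have O [measurable]: "\<Omega> \<in> sets borel" using assms by simp
  have "\<Omega> \<inter> space lebesgue \<in> sets lebesgue" using assms(1) by simp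
  have m: "(\<lambda>x. indicator \<Omega> x *\<^sub>R f x) \<in> borel_measurable lborel" using assms(2) by measurable
  show "integral\<^sup>L (lebesgue_on \<Omega>) f = integral\<^sup>L lborel (\<lambda>x. indicator \<Omega> x *\<^sub>R f x)"
    using m assms(1) by (simp add: integral_restrict_space integral_completion)
  show "integrable (lebesgue_on \<Omega>) f \<longleftrightarrow> integrable lborel (\<lambda>x. indicator \<Omega> x *\<^sub>R f x)"
    using m assms(1) by (simp add: integrable_restrict_space integrable_completion)
qed

text \<open>Sum \<open>cauchy_pompeiu_curve\<close> over the boundary curves. The Cauchy transforms add up to \<open>2 \<pi> i\<close> times
  the total winding number, which is 1 in \<open>\<Omega>\<close>, 0 outside the closure, and undetermined on the
  boundary, a null set. Imaginary and real part give the two formulas.\<close>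

lemma green_test_function:
  fixes C :: "(real \<Rightarrow> plane) set" and g :: "plane \<Rightarrow> real" and g' :: "plane \<Rightarrow> plane"
  assumes C: "boundary_cycle C \<Omega>" and g: "test_function UNIV g g'"
  shows "(\<Sum>\<gamma>\<in>C. integral {0..1} (\<lambda>s. g (\<gamma> s) * vector_derivative \<gamma> (at s) $ 2)) = integral\<^sup>L (lebesgue_on \<Omega>) (\<lambda>x. g' x $ 1)"
    "(\<Sum>\<gamma>\<in>C. integral {0..1} (\<lambda>s. g (\<gamma> s) * vector_derivative \<gamma> (at s) $ 1)) = - integral\<^sup>L (lebesgue_on \<Omega>) (\<lambda>x. g' x $ 2)"
proof -
  have Cfin: "finite C" and O: "open \<Omega>" "bounded \<Omega>" and reg: "\<And>\<gamma>. \<gamma> \<in> C \<Longrightarrow> piecewise_regular \<gamma>"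
    and fr: "frontier \<Omega> = (\<Union>\<gamma>\<in>C. path_image \<gamma>)"
    and w1: "\<And>z. z \<in> \<Omega> \<Longrightarrow> (\<Sum>\<gamma>\<in>C. winding_number (to_complex \<circ> \<gamma>) (to_complex z)) = 1"
    and w0: "\<And>z. z \<notin> closure \<Omega> \<Longrightarrow> (\<Sum>\<gamma>\<in>C. winding_number (to_complex \<circ> \<gamma>) (to_complex z)) = 0"
    using C unfolding boundary_cycle_def by blast+
  have cg: "continuous_on S g" "continuous_on S g'" for S using test_function_continuous[OF g] by auto
  have gm [measurable]: "g \<in> borel_measurable borel" "g' \<in> borel_measurable borel"
    using cg by (auto intro: borel_measurable_continuous_onI)
  have Om [measurable]: "\<Omega> \<in> sets borel" using O(1) by simp
  have tgm [measurable]: "(\<lambda>x. to_complex (g' x)) \<in> borel_measurable borel" by measurable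
  have compm [measurable]: "(\<lambda>x::plane. x $ i) \<in> borel_measurable borel" for i
    by (intro borel_measurable_continuous_onI continuous_intros)
  obtain M where M: "\<And>x. \<bar>g x\<bar> \<le> M" using test_function_bounded[OF g] by metis
  \<comment> \<open>\<open>I\<close> is the complex line integral of \<open>g\<close>, and \<open>K\<close> the Cauchy transform of the curve.\<close>
  define good where "good = (\<lambda>\<gamma> I K. integrable lborel (\<lambda>w. to_complex (g' w) * K w) \<and>
      of_real (2 * pi) * I = integral\<^sup>L lborel (\<lambda>w. to_complex (g' w) * K w) \<and>
      (\<forall>w. w \<notin> path_image \<gamma> \<longrightarrow> K w = 2 * of_real pi * \<i> * winding_number (to_complex \<circ> \<gamma>) (to_complex w)) \<and>
      integral {0..1} (\<lambda>s. g (\<gamma> s) * vector_derivative \<gamma> (at s) $ 2) = Im I \<and>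
      integral {0..1} (\<lambda>s. g (\<gamma> s) * vector_derivative \<gamma> (at s) $ 1) = Re I)"
  have "\<exists>I K. good \<gamma> I K" if mem: "\<gamma> \<in> C" for \<gamma>
    proof -
      obtain P d L where P: "finite P" and d [measurable]: "d \<in> borel_measurable borel" and "L > 0"
        and dL: "\<And>s. norm (d s) \<le> L * indicator {0..1} s"
        and dd: "\<And>s. s \<in> {0..1} - P \<Longrightarrow> (\<gamma> has_vector_derivative d s) (at s)"
        and vp: "valid_path (to_complex \<circ> \<gamma>)"
        by (rule piecewise_regular_velocity[OF reg[OF mem]]) blast
      have cont: "continuous_on {0..1} \<gamma>" using reg[OF mem] by (simp add: piecewise_regular_def path_def)
      define c where "c = (\<lambda>s. \<gamma> (max 0 (min 1 s)))"
      note c = clamped_path[OF cont c_def]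
      have [measurable]: "c \<in> borel_measurable borel" using c(1) by (rule borel_measurable_continuous_onI)
      have pim: "compact (path_image \<gamma>)" using cont by (simp add: path_def compact_path_image)
      obtain B where B: "\<And>s. norm (c s) \<le> B"
        using compact_imp_bounded[OF pim] c(2) unfolding bounded_iff by blast
      define D where "D = (\<lambda>s. to_complex (d s))"
      have Dm [measurable]: "D \<in> borel_measurable borel" unfolding D_def by measurable
      have DL: "norm (D s) \<le> L * indicator {0..1} s" for s using dL by (simp add: D_def)
      have D0: "D s = 0" if "s \<notin> {0..1}" for s using DL[of s] that by simp
      define I where "I = integral\<^sup>L lborel (\<lambda>s. of_real (g (c s)) * D s)"
      define K where "K = (\<lambda>w. integral\<^sup>L lborel (\<lambda>s. D s / to_complex (c s - w)))"
      have 1: "of_real (2 * pi) * I = integral\<^sup>L lborel (\<lambda>w. to_complex (g' w) * K w)"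
        "integrable lborel (\<lambda>w. to_complex (g' w) * K w)"
        unfolding I_def K_def by (rule cauchy_pompeiu_curve[OF g _ B Dm DL]; measurable)+
      have 2: "K w = 2 * of_real pi * \<i> * winding_number (to_complex \<circ> \<gamma>) (to_complex w)" if w: "w \<notin> path_image \<gamma>" for w
      proof -
        have "to_complex w \<notin> path_image (to_complex \<circ> \<gamma>)"
        proof
          assume "to_complex w \<in> path_image (to_complex \<circ> \<gamma>)"
          then obtain s where s: "s \<in> {0..1}" "to_complex w = to_complex (\<gamma> s)" by (auto simp: path_image_def)
          then have "to_complex (w - \<gamma> s) = 0" by simp
          then have "w = \<gamma> s" by (simp del: to_complex_simps)
          then show False using s w by (auto simp: path_image_def)
        qed
        from winding_number_valid_path[OF vp this]
        have "2 * of_real pi * \<i> * winding_number (to_complex \<circ> \<gamma>) (to_complex w) =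
           contour_integral (to_complex \<circ> \<gamma>) (\<lambda>z. 1 / (z - to_complex w))" by simp
        also have "\<dots> = integral {0..1} (\<lambda>s. 1 / (to_complex (\<gamma> s) - to_complex w) * vector_derivative (to_complex \<circ> \<gamma>) (at s))"
          by (simp add: contour_integral_integral)
        also have "\<dots> = K w"
        proof (rule integral_unique)
          define f where "f = (\<lambda>s. D s / to_complex (c s - w))"
          obtain \<delta> where \<delta>: "\<delta> > 0" "\<And>x. x \<in> path_image \<gamma> \<Longrightarrow> \<delta> \<le> dist w x"
            using separate_point_closed[OF compact_imp_closed[OF pim] w] by blast
          have fm: "f \<in> borel_measurable borel" unfolding f_def by measurable
          have fb: "norm (f s) \<le> L / \<delta> * indicator {0..1} s" for s
          proof -
            have "\<delta> \<le> norm (c s - w)" using \<delta>(2)[OF c(2)[of s]] by (simp add: dist_norm norm_minus_commute)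
            then have "norm (f s) \<le> (L * indicator {0..1} s) / \<delta>"
              unfolding f_def norm_divide norm_to_complex using \<delta>(1) DL[of s] \<open>L > 0\<close> by (intro frac_le) auto
            then show ?thesis by simp
          qed
          have "1 / (to_complex (\<gamma> s) - to_complex w) * vector_derivative (to_complex \<circ> \<gamma>) (at s) = f s" if "s \<in> {0..1} - P" for s
          proof -
            have "(to_complex \<circ> \<gamma> has_vector_derivative D s) (at s)"
              using bounded_linear.has_vector_derivative[OF bounded_linear_to_complex dd[OF that]] by (simp add: comp_def D_def)
            then show ?thesis using c(3)[of s] that by (simp add: f_def vector_derivative_at)
          qed
          then have "((\<lambda>s. 1 / (to_complex (\<gamma> s) - to_complex w) * vector_derivative (to_complex \<circ> \<gamma>) (at s)) has_integral integral\<^sup>L lborel f) {0..1}"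
            using D0 by (intro has_integral_curve_from_lborel[OF integrable_lborel_bounded_support(1)[OF fm fb] _ P]) (auto simp: f_def)
          then show "((\<lambda>s. 1 / (to_complex (\<gamma> s) - to_complex w) * vector_derivative (to_complex \<circ> \<gamma>) (at s)) has_integral K w) {0..1}"
            unfolding K_def f_def .
        qed
        finally show ?thesis by simp
      qed
      have 3: "((\<lambda>s. of_real (g (\<gamma> s)) * to_complex (vector_derivative \<gamma> (at s))) has_integral I) {0..1}"
        unfolding I_def
      proof (rule has_integral_curve_from_lborel[OF _ _ P])
        show "integrable lborel (\<lambda>s. of_real (g (c s)) * D s)"
        proof (rule integrable_lborel_bounded_support(1))
          show "norm (of_real (g (c s)) * D s) \<le> M * L * indicator {0..1} s" for s
          proof -
            have "norm (of_real (g (c s)) * D s) \<le> M * (L * indicator {0..1} s)"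
              unfolding norm_mult using DL[of s] M[of "c s"] by (intro mult_mono) auto
            then show ?thesis by simp
          qed
        qed measurable
        show "of_real (g (\<gamma> s)) * to_complex (vector_derivative \<gamma> (at s)) = of_real (g (c s)) * D s" if "s \<in> {0..1} - P" for s
          using dd[OF that] c(3)[of s] that by (simp add: D_def vector_derivative_at)
      qed (use D0 in simp)
      have "((\<lambda>s. Im (of_real (g (\<gamma> s)) * to_complex (vector_derivative \<gamma> (at s)))) has_integral Im I) {0..1}"
        "((\<lambda>s. Re (of_real (g (\<gamma> s)) * to_complex (vector_derivative \<gamma> (at s)))) has_integral Re I) {0..1}"
        using has_integral_linear[OF 3 bounded_linear_Im] has_integral_linear[OF 3 bounded_linear_Re] by (simp_all add: comp_def)
      then have "good \<gamma> I K" using 1 2 unfolding good_def by (auto simp: integral_unique)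
      then show ?thesis by blast
    qed
  then have "\<exists>I K. \<forall>\<gamma>\<in>C. good \<gamma> (I \<gamma>) (K \<gamma>)" by metis
  then obtain I K where IK: "\<And>\<gamma>. \<gamma> \<in> C \<Longrightarrow> integrable lborel (\<lambda>w. to_complex (g' w) * K \<gamma> w)"
      "\<And>\<gamma>. \<gamma> \<in> C \<Longrightarrow> of_real (2 * pi) * I \<gamma> = integral\<^sup>L lborel (\<lambda>w. to_complex (g' w) * K \<gamma> w)"
      "\<And>\<gamma> w. \<gamma> \<in> C \<Longrightarrow> w \<notin> path_image \<gamma> \<Longrightarrow> K \<gamma> w = 2 * of_real pi * \<i> * winding_number (to_complex \<circ> \<gamma>) (to_complex w)"
      "\<And>\<gamma>. \<gamma> \<in> C \<Longrightarrow> integral {0..1} (\<lambda>s. g (\<gamma> s) * vector_derivative \<gamma> (at s) $ 2) = Im (I \<gamma>)"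
      "\<And>\<gamma>. \<gamma> \<in> C \<Longrightarrow> integral {0..1} (\<lambda>s. g (\<gamma> s) * vector_derivative \<gamma> (at s) $ 1) = Re (I \<gamma>)"
    unfolding good_def by blast
  have "of_real (2 * pi) * (\<Sum>\<gamma>\<in>C. I \<gamma>) = (\<Sum>\<gamma>\<in>C. integral\<^sup>L lborel (\<lambda>w. to_complex (g' w) * K \<gamma> w))"
    unfolding sum_distrib_left using IK(2) by (intro sum.cong) auto
  also have "\<dots> = integral\<^sup>L lborel (\<lambda>w. \<Sum>\<gamma>\<in>C. to_complex (g' w) * K \<gamma> w)"
    using IK(1) by (intro Bochner_Integration.integral_sum[symmetric]) auto
  also have "\<dots> = integral\<^sup>L lborel (\<lambda>w. (2 * of_real pi * \<i>) * (indicator \<Omega> w *\<^sub>R to_complex (g' w)))"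
  proof (rule integral_cong_AE)
    have "negligible (frontier \<Omega>)" unfolding fr
      using Cfin reg by (intro negligible_Union) (auto intro: piecewise_regular_image_negligible)
    then have "frontier \<Omega> \<in> null_sets lborel"
      by (simp add: negligible_iff_null_sets null_sets_completion_iff frontier_closed borel_closed)
    then have "AE w in lborel. w \<notin> frontier \<Omega>" by (rule AE_not_in)
    then show "AE w in lborel. (\<Sum>\<gamma>\<in>C. to_complex (g' w) * K \<gamma> w) = (2 * of_real pi * \<i>) * (indicator \<Omega> w *\<^sub>R to_complex (g' w))"
    proof eventually_elim
      case (elim w)
      then have "(\<Sum>\<gamma>\<in>C. K \<gamma> w) = (\<Sum>\<gamma>\<in>C. 2 * of_real pi * \<i> * winding_number (to_complex \<circ> \<gamma>) (to_complex w))"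
        using fr IK(3) by (intro sum.cong) auto
      also have "\<dots> = 2 * of_real pi * \<i> * indicator \<Omega> w"
      proof (cases "w \<in> \<Omega>")
        case True then show ?thesis using w1[OF True] by (simp flip: sum_distrib_left)
      next
        case False
        then have "w \<notin> closure \<Omega>" using elim O(1) by (simp add: frontier_def interior_open)
        then show ?thesis using w0 False by (simp flip: sum_distrib_left)
      qed
      finally have "(\<Sum>\<gamma>\<in>C. K \<gamma> w) = 2 * of_real pi * \<i> * indicator \<Omega> w" .
      then show ?case by (cases "w \<in> \<Omega>") (simp_all flip: sum_distrib_left)
    qed
    show "(\<lambda>w. \<Sum>\<gamma>\<in>C. to_complex (g' w) * K \<gamma> w) \<in> borel_measurable lborel"
      using IK(1) by (intro borel_measurable_sum) auto
    show "(\<lambda>w. (2 * of_real pi * \<i>) * (indicator \<Omega> w *\<^sub>R to_complex (g' w))) \<in> borel_measurable lborel"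
      by measurable
  qed
  also have "\<dots> = of_real (2 * pi) * (\<i> * integral\<^sup>L lborel (\<lambda>w. indicator \<Omega> w *\<^sub>R to_complex (g' w)))"
    by (simp only: integral_mult_right_zero) simp
  also have "integral\<^sup>L lborel (\<lambda>w. indicator \<Omega> w *\<^sub>R to_complex (g' w)) = to_complex (integral\<^sup>L lborel (\<lambda>w. indicator \<Omega> w *\<^sub>R g' w))"
  proof -
    have "integrable lborel (\<lambda>w. indicator \<Omega> w *\<^sub>R g' w)"
      using test_function_integral_gradient_zero(1)[OF g] O(1) by (intro integrable_mult_indicator) auto
    from integral_bounded_linear[OF bounded_linear_to_complex this] show ?thesis
      by (simp add: scaleR_conv_of_real[where 'a=complex])
  qed
  finally have S: "(\<Sum>\<gamma>\<in>C. I \<gamma>) = \<i> * to_complex (integral\<^sup>L lborel (\<lambda>w. indicator \<Omega> w *\<^sub>R g' w))"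
    by simp
  have comp: "integral\<^sup>L lborel (\<lambda>w. indicator \<Omega> w *\<^sub>R g' w) $ i = integral\<^sup>L (lebesgue_on \<Omega>) (\<lambda>x. g' x $ i)" for i
  proof -
    have "integrable lborel (\<lambda>w. indicator \<Omega> w *\<^sub>R g' w)"
      using test_function_integral_gradient_zero(1)[OF g] O(1) by (intro integrable_mult_indicator) auto
    from integral_bounded_linear[OF bounded_linear_vec_nth this, of i]
    show ?thesis by (subst integral_lebesgue_on_eq_lborel(1)[OF O(1)]) auto
  qed
  have "(\<Sum>\<gamma>\<in>C. Im (I \<gamma>)) = integral\<^sup>L (lebesgue_on \<Omega>) (\<lambda>x. g' x $ 1)"
    unfolding Im_sum[symmetric] S by (simp add: comp)
  then show "(\<Sum>\<gamma>\<in>C. integral {0..1} (\<lambda>s. g (\<gamma> s) * vector_derivative \<gamma> (at s) $ 2)) = integral\<^sup>L (lebesgue_on \<Omega>) (\<lambda>x. g' x $ 1)"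
    using IK(4) by simp
  have "(\<Sum>\<gamma>\<in>C. Re (I \<gamma>)) = - integral\<^sup>L (lebesgue_on \<Omega>) (\<lambda>x. g' x $ 2)"
    unfolding Re_sum[symmetric] S by (simp add: comp)
  then show "(\<Sum>\<gamma>\<in>C. integral {0..1} (\<lambda>s. g (\<gamma> s) * vector_derivative \<gamma> (at s) $ 1)) = - integral\<^sup>L (lebesgue_on \<Omega>) (\<lambda>x. g' x $ 2)"
    using IK(5) by simp
qed

lemma flux_bound:
  assumes "finite C" and reg: "\<And>\<gamma>. \<gamma> \<in> C \<Longrightarrow> piecewise_regular \<gamma>"
  obtains L where "L \<ge> 0"
    "\<And>V W \<epsilon>. continuous_on (\<Union>\<gamma>\<in>C. path_image \<gamma>) V \<Longrightarrow> continuous_on (\<Union>\<gamma>\<in>C. path_image \<gamma>) W \<Longrightarrow>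
       (\<And>x. x \<in> (\<Union>\<gamma>\<in>C. path_image \<gamma>) \<Longrightarrow> norm (V x - W x) \<le> \<epsilon>) \<Longrightarrow> \<bar>flux C V - flux C W\<bar> \<le> \<epsilon> * L"
proof -
  let ?J = "\<lambda>(\<gamma> :: real \<Rightarrow> plane) (h :: plane \<Rightarrow> real) (i::2). integral {0..1} (\<lambda>s. h (\<gamma> s) * vector_derivative \<gamma> (at s) $ i)"
  define ok where "ok = (\<lambda>\<gamma> L. L > 0 \<and> (\<forall>(h :: plane \<Rightarrow> real) M i. continuous_on (path_image \<gamma>) h \<longrightarrow> (\<forall>x \<in> path_image \<gamma>. \<bar>h x\<bar> \<le> M) \<longrightarrow>
       (\<lambda>s. h (\<gamma> s) * vector_derivative \<gamma> (at s) $ i) integrable_on {0..1} \<and> \<bar>?J \<gamma> h i\<bar> \<le> M * L))"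
  have "\<exists>L. ok \<gamma> L" if "\<gamma> \<in> C" for \<gamma>
    unfolding ok_def by (rule curve_integral_bound[OF reg[OF that]]) blast
  then obtain L where ok: "\<And>\<gamma>. \<gamma> \<in> C \<Longrightarrow> ok \<gamma> (L \<gamma>)" by metis
  have L: "\<And>\<gamma>. \<gamma> \<in> C \<Longrightarrow> L \<gamma> > 0"
    and LL: "\<And>\<gamma> (h :: plane \<Rightarrow> real) M i. \<gamma> \<in> C \<Longrightarrow> continuous_on (path_image \<gamma>) h \<Longrightarrow> (\<forall>x \<in> path_image \<gamma>. \<bar>h x\<bar> \<le> M) \<Longrightarrow>
       (\<lambda>s. h (\<gamma> s) * vector_derivative \<gamma> (at s) $ i) integrable_on {0..1} \<and> \<bar>?J \<gamma> h i\<bar> \<le> M * L \<gamma>"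
    using ok unfolding ok_def by blast+
  have int: "(\<lambda>s. h (\<gamma> s) * vector_derivative \<gamma> (at s) $ i) integrable_on {0..1}"
    if \<gamma>: "\<gamma> \<in> C" and h: "continuous_on (path_image \<gamma>) h" for \<gamma> and h :: "plane \<Rightarrow> real" and i
  proof -
    have "path \<gamma>" using reg[OF \<gamma>] by (simp add: piecewise_regular_def)
    then have "compact (h ` path_image \<gamma>)" using h by (intro compact_continuous_image compact_path_image)
    then have "bounded (h ` path_image \<gamma>)" by (rule compact_imp_bounded)
    then obtain M where "\<forall>x \<in> path_image \<gamma>. \<bar>h x\<bar> \<le> M" unfolding bounded_iff by auto
    then show ?thesis using LL[OF \<gamma> h] by blast
  qed
  show ?thesis
  proof (rule that[of "\<Sum>\<gamma>\<in>C. 2 * L \<gamma>"])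
    show "(\<Sum>\<gamma>\<in>C. 2 * L \<gamma>) \<ge> 0" using L by (intro sum_nonneg) (simp add: less_imp_le)
  next
    fix V W :: "plane \<Rightarrow> plane" and \<epsilon> :: real
    assume V: "continuous_on (\<Union>\<gamma>\<in>C. path_image \<gamma>) V" and W: "continuous_on (\<Union>\<gamma>\<in>C. path_image \<gamma>) W"
      and \<epsilon>: "\<And>x. x \<in> (\<Union>\<gamma>\<in>C. path_image \<gamma>) \<Longrightarrow> norm (V x - W x) \<le> \<epsilon>"
    let ?I = "\<lambda>(\<gamma> :: real \<Rightarrow> plane) (V :: plane \<Rightarrow> plane). integral {0..1} (\<lambda>s. V (\<gamma> s) $ 1 * vector_derivative \<gamma> (at s) $ 2
                                          - V (\<gamma> s) $ 2 * vector_derivative \<gamma> (at s) $ (1::2))"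
    have "\<bar>?I \<gamma> V - ?I \<gamma> W\<bar> \<le> \<epsilon> * (2 * L \<gamma>)" if \<gamma>: "\<gamma> \<in> C" for \<gamma>
    proof -
      have cV: "continuous_on (path_image \<gamma>) (\<lambda>x. V x $ i)" and cW: "continuous_on (path_image \<gamma>) (\<lambda>x. W x $ i)" for i
        using \<gamma> continuous_on_subset[OF V, of "path_image \<gamma>"] continuous_on_subset[OF W, of "path_image \<gamma>"]
        by (auto intro!: continuous_intros)
      have cD: "continuous_on (path_image \<gamma>) (\<lambda>x. V x $ i - W x $ i)" for i using cV[of i] cW[of i] by (rule continuous_on_diff)
      have bD: "\<forall>x \<in> path_image \<gamma>. \<bar>V x $ i - W x $ i\<bar> \<le> \<epsilon>" for i
      proof
        fix x assume "x \<in> path_image \<gamma>"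
        then have "norm (V x - W x) \<le> \<epsilon>" using \<gamma> \<epsilon> by blast
        then show "\<bar>V x $ i - W x $ i\<bar> \<le> \<epsilon>" using component_le_norm_cart[of "V x - W x" i] by simp
      qed
      have e: "?I \<gamma> U = ?J \<gamma> (\<lambda>x. U x $ 1) 2 - ?J \<gamma> (\<lambda>x. U x $ 2) 1" if "\<And>i. continuous_on (path_image \<gamma>) (\<lambda>x. U x $ i)" for U :: "plane \<Rightarrow> plane"
        using int[OF \<gamma> that] by (intro Henstock_Kurzweil_Integration.integral_diff)
      have d: "?J \<gamma> (\<lambda>x. V x $ i) j - ?J \<gamma> (\<lambda>x. W x $ i) j = ?J \<gamma> (\<lambda>x. V x $ i - W x $ i) j" for i j
        by (simp add: left_diff_distrib Henstock_Kurzweil_Integration.integral_diff int[OF \<gamma> cV] int[OF \<gamma> cW])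
      have "\<bar>?J \<gamma> (\<lambda>x. V x $ i - W x $ i) j\<bar> \<le> \<epsilon> * L \<gamma>" for i j
        using LL[OF \<gamma> cD bD] by blast
      from this[of 1 2] this[of 2 1] show ?thesis
        unfolding e[OF cV] e[OF cW] d[symmetric] by (simp add: algebra_simps abs_if split: if_splits)
    qed
    then have "(\<Sum>\<gamma>\<in>C. \<bar>?I \<gamma> V - ?I \<gamma> W\<bar>) \<le> (\<Sum>\<gamma>\<in>C. \<epsilon> * (2 * L \<gamma>))" by (rule sum_mono)
    moreover have "\<bar>flux C V - flux C W\<bar> \<le> (\<Sum>\<gamma>\<in>C. \<bar>?I \<gamma> V - ?I \<gamma> W\<bar>)"
      unfolding flux_def sum_subtractf[symmetric] by (rule sum_abs)
    ultimately show "\<bar>flux C V - flux C W\<bar> \<le> \<epsilon> * (\<Sum>\<gamma>\<in>C. 2 * L \<gamma>)"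
      by (simp add: sum_distrib_left)
  qed
qed

section \<open>Cutoff functions near the boundary\<close>

text \<open>A continuously differentiable step from 0 to 1 on the interval \<open>[0, 1]\<close>, made of two nested squares
  of positive parts.\<close>

definition smooth_step :: "real \<Rightarrow> real" where
  "smooth_step q = 1 - (max 0 (1 - (max 0 q)\<^sup>2))\<^sup>2"

definition smooth_step' :: "real \<Rightarrow> real" where
  "smooth_step' q = 4 * max 0 (1 - (max 0 q)\<^sup>2) * max 0 q"

lemma DERIV_square_pos_part: "((\<lambda>q. (max 0 q)\<^sup>2) has_real_derivative 2 * max 0 q) (at (q::real))"
proof -
  consider "q < 0" | "q > 0" | "q = 0" by linarith
  then show ?thesis
  proof cases
    case 1
    have "((\<lambda>q. 0) has_real_derivative 2 * max 0 q) (at q)" using 1 by (simp add: max_def)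
    then show ?thesis
      by (rule DERIV_cong_ev[THEN iffD1, rotated -1]) (use 1 eventually_nhds_in_open[of "{..<0}" q] in \<open>auto elim!: eventually_mono simp: max_def\<close>)
  next
    case 2
    have "((\<lambda>q. q\<^sup>2) has_real_derivative 2 * max 0 q) (at q)" using 2 by (auto intro!: derivative_eq_intros simp: max_def)
    then show ?thesis
      by (rule DERIV_cong_ev[THEN iffD1, rotated -1]) (use 2 eventually_nhds_in_open[of "{0<..}" q] in \<open>auto elim!: eventually_mono simp: max_def\<close>)
  next
    case 3
    have "((\<lambda>h. ((max 0 h)\<^sup>2) / h) \<longlongrightarrow> 0) (at (0::real))"
    proof (rule Lim_null_comparison)
      show "\<forall>\<^sub>F h in at 0. norm (((max 0 h)\<^sup>2) / h) \<le> \<bar>h::real\<bar>"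
        by (intro always_eventually) (auto simp: max_def power2_eq_square)
      show "((\<lambda>h::real. \<bar>h\<bar>) \<longlongrightarrow> 0) (at 0)" by (rule tendsto_rabs_zero) simp
    qed
    then show ?thesis using 3 by (simp add: has_field_derivative_iff)
  qed
qed

lemma DERIV_smooth_step: "(smooth_step has_real_derivative smooth_step' q) (at q)"
proof -
  have "((\<lambda>q. 1 - (max 0 q)\<^sup>2) has_real_derivative - (2 * max 0 q)) (at q)"
    using DERIV_diff[OF DERIV_const DERIV_square_pos_part] by simp
  from DERIV_chain2[OF DERIV_square_pos_part this]
  have "((\<lambda>q. 1 - (max 0 (1 - (max 0 q)\<^sup>2))\<^sup>2) has_real_derivative - (2 * max 0 (1 - (max 0 q)\<^sup>2) * - (2 * max 0 q))) (at q)"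
    using DERIV_diff[OF DERIV_const[of 1], of "\<lambda>q. (max 0 (1 - (max 0 q)\<^sup>2))\<^sup>2"] by fastforce
  then show ?thesis unfolding smooth_step_def[abs_def] smooth_step'_def by (simp add: mult.assoc)
qed

lemma continuous_on_smooth_step' [continuous_intros]:
  "continuous_on S f \<Longrightarrow> continuous_on S (\<lambda>x. smooth_step' (f x))"
  unfolding smooth_step'_def by (intro continuous_intros)

lemma smooth_step_props:
  shows "0 \<le> smooth_step q" "smooth_step q \<le> 1" "q \<le> 0 \<Longrightarrow> smooth_step q = 0" "q \<ge> 1 \<Longrightarrow> smooth_step q = 1"
    "\<bar>smooth_step' q\<bar> \<le> 4" "q \<le> 0 \<or> q \<ge> 1 \<Longrightarrow> smooth_step' q = 0"
proof -
  let ?a = "max 0 (1 - (max 0 q)\<^sup>2)"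
  have a: "0 \<le> ?a" "?a \<le> 1" by auto
  then have "?a\<^sup>2 \<le> 1" by (simp add: power_le_one)
  then show "0 \<le> smooth_step q" "smooth_step q \<le> 1" by (auto simp: smooth_step_def)
  show "q \<le> 0 \<Longrightarrow> smooth_step q = 0" by (simp add: smooth_step_def max_def)
  have big: "?a = 0" if "q \<ge> 1"
  proof -
    have "1 \<le> (max 0 q)\<^sup>2" using that by (intro one_le_power) simp
    then have "1 - (max 0 q)\<^sup>2 \<le> 0" by linarith
    then show ?thesis by (rule max_absorb1)
  qed
  then show "q \<ge> 1 \<Longrightarrow> smooth_step q = 1" by (simp add: smooth_step_def)
  show 0: "q \<le> 0 \<or> q \<ge> 1 \<Longrightarrow> smooth_step' q = 0" using big by (auto simp: smooth_step'_def max_def)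
  show "\<bar>smooth_step' q\<bar> \<le> 4"
  proof (cases "q \<le> 0 \<or> q \<ge> 1")
    case False
    then have "?a * max 0 q \<le> 1 * 1" using a by (intro mult_mono) auto
    then show ?thesis using a by (simp add: smooth_step'_def abs_mult mult.assoc)
  qed (use 0 in simp)
qed

lemma GDERIV_square_dist: "GDERIV (\<lambda>x::plane. (norm (x - a))\<^sup>2) x :> 2 *\<^sub>R (x - a)"
  unfolding gderiv_def power2_norm_eq_inner
  by (auto intro!: derivative_eq_intros simp: inner_commute)

text \<open>Vanishes on the disc of radius \<open>2 r\<close> and equals 1 outside the disc of radius \<open>3 r\<close>: the squared
  distance runs from \<open>4 r\<^sup>2\<close> to \<open>4 r\<^sup>2 + 5 r\<^sup>2\<close> in between. The square keeps the function
  differentiable at \<open>a\<close>.\<close>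

definition bump_out :: "plane \<Rightarrow> real \<Rightarrow> plane \<Rightarrow> real" where
  "bump_out a r x = smooth_step (((norm (x - a))\<^sup>2 - 4 * r\<^sup>2) / (5 * r\<^sup>2))"

definition bump_out' :: "plane \<Rightarrow> real \<Rightarrow> plane \<Rightarrow> plane" where
  "bump_out' a r x = (smooth_step' (((norm (x - a))\<^sup>2 - 4 * r\<^sup>2) / (5 * r\<^sup>2)) * (2 / (5 * r\<^sup>2))) *\<^sub>R (x - a)"

lemma bump_out_props:
  assumes "r > 0"
  shows "0 \<le> bump_out a r x" "bump_out a r x \<le> 1"
    "norm (x - a) \<le> 2 * r \<Longrightarrow> bump_out a r x = 0" "norm (x - a) \<ge> 3 * r \<Longrightarrow> bump_out a r x = 1"
    "GDERIV (bump_out a r) x :> bump_out' a r x" "continuous_on UNIV (bump_out' a r)"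
    "norm (bump_out' a r x) \<le> 5 / r * indicator (cball a (3 * r)) x"
proof -
  show "0 \<le> bump_out a r x" "bump_out a r x \<le> 1" by (auto simp: bump_out_def smooth_step_props)
  have "(norm (x - a))\<^sup>2 \<le> 4 * r\<^sup>2" if "norm (x - a) \<le> 2 * r"
    using power_mono[OF that, of 2] by (simp add: power_mult_distrib)
  then show "norm (x - a) \<le> 2 * r \<Longrightarrow> bump_out a r x = 0"
    unfolding bump_out_def using assms by (intro smooth_step_props) (simp add: divide_le_0_iff)
  have far: "((norm (x - a))\<^sup>2 - 4 * r\<^sup>2) / (5 * r\<^sup>2) \<ge> 1" if "norm (x - a) \<ge> 3 * r"
    using power_mono[OF that, of 2] assms by (simp add: power_mult_distrib field_simps)
  then show "norm (x - a) \<ge> 3 * r \<Longrightarrow> bump_out a r x = 1"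
    unfolding bump_out_def by (intro smooth_step_props)
  show "GDERIV (bump_out a r) x :> bump_out' a r x"
  proof -
    have "((\<lambda>y. smooth_step ((y - 4 * r\<^sup>2) / (5 * r\<^sup>2))) has_real_derivative smooth_step' ((y - 4 * r\<^sup>2) / (5 * r\<^sup>2)) * (1 / (5 * r\<^sup>2))) (at y)" for y
      using DERIV_chain2[OF DERIV_smooth_step DERIV_cdivide[OF DERIV_diff[OF DERIV_ident DERIV_const]]] by simp
    from GDERIV_DERIV_compose[OF GDERIV_square_dist this]
    show ?thesis unfolding bump_out_def[abs_def] bump_out'_def by (simp add: mult_ac)
  qed
  show "continuous_on UNIV (bump_out' a r)" unfolding bump_out'_def[abs_def]
    using assms by (intro continuous_intros) auto
  show "norm (bump_out' a r x) \<le> 5 / r * indicator (cball a (3 * r)) x"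
  proof (cases "norm (x - a) < 3 * r")
    case True
    have "norm (bump_out' a r x) \<le> (4 * (2 / (5 * r\<^sup>2))) * (3 * r)"
      unfolding bump_out'_def norm_scaleR abs_mult using True smooth_step_props(5) assms
      by (intro mult_mono) auto
    also have "\<dots> \<le> 5 / r" using assms by (simp add: field_simps power2_eq_square)
    finally show ?thesis using True by (simp add: dist_norm norm_minus_commute)
  next
    case False
    then have "smooth_step' (((norm (x - a))\<^sup>2 - 4 * r\<^sup>2) / (5 * r\<^sup>2)) = 0"
      using far by (intro smooth_step_props) auto
    then show ?thesis using assms by (simp add: bump_out'_def)
  qed
qed

text \<open>All factors lie in \<open>[0, 1]\<close>, so the product rule bounds the gradient of the product by the sum of
  the gradients.\<close>

lemma bump_out_product:
  assumes "r > 0" "finite A"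
  obtains \<eta>' where "\<And>x. GDERIV (\<lambda>x. \<Prod>a\<in>A. bump_out a r x) x :> \<eta>' x" "continuous_on UNIV \<eta>'"
    "\<And>x. norm (\<eta>' x) \<le> (\<Sum>a\<in>A. 5 / r * indicator (cball a (3 * r)) x)"
proof -
  have "\<exists>\<eta>'. (\<forall>x. GDERIV (\<lambda>x. \<Prod>a\<in>A. bump_out a r x) x :> \<eta>' x) \<and> continuous_on UNIV \<eta>' \<and>
    (\<forall>x. norm (\<eta>' x) \<le> (\<Sum>a\<in>A. 5 / r * indicator (cball a (3 * r)) x))"
    using assms(2)
  proof induction
    case empty
    show ?case by (rule exI[of _ "\<lambda>_. 0"]) (auto intro!: GDERIV_const)
  next
    case (insert b A)
    then obtain \<eta>' where \<eta>: "\<And>x. GDERIV (\<lambda>x. \<Prod>a\<in>A. bump_out a r x) x :> \<eta>' x" "continuous_on UNIV \<eta>'"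
       "\<And>x. norm (\<eta>' x) \<le> (\<Sum>a\<in>A. 5 / r * indicator (cball a (3 * r)) x)" by blast
    let ?P = "\<lambda>x. \<Prod>a\<in>A. bump_out a r x"
    note B = bump_out_props[OF assms(1)]
    have P01: "0 \<le> ?P x" "?P x \<le> 1" for x using B(1,2) by (auto intro!: prod_nonneg prod_le_1)
    have cP: "continuous_on UNIV ?P" using \<eta>(1) by (rule GDERIV_imp_continuous_on)
    have cb: "continuous_on UNIV (bump_out b r)" using B(5) by (rule GDERIV_imp_continuous_on)
    let ?D = "\<lambda>x. bump_out b r x *\<^sub>R \<eta>' x + ?P x *\<^sub>R bump_out' b r x"
    have "GDERIV (\<lambda>x. \<Prod>a\<in>insert b A. bump_out a r x) x :> ?D x" for x
      using GDERIV_mult[OF B(5) \<eta>(1)] insert.hyps by simp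
    moreover have "continuous_on UNIV ?D"
      by (rule continuous_on_add[OF continuous_on_scaleR[OF cb \<eta>(2)] continuous_on_scaleR[OF cP B(6)]])
    moreover have "norm (?D x) \<le> (\<Sum>a\<in>insert b A. 5 / r * indicator (cball a (3 * r)) x)" for x
    proof -
      have "norm (?D x) \<le> bump_out b r x * norm (\<eta>' x) + ?P x * norm (bump_out' b r x)"
        by (rule order_trans[OF norm_triangle_ineq]) (use B(1) P01(1)[of x] in simp)
      also have "\<dots> \<le> 1 * norm (\<eta>' x) + 1 * norm (bump_out' b r x)"
        using B(2) P01(2) by (intro add_mono mult_right_mono) auto
      also have "\<dots> \<le> (\<Sum>a\<in>A. 5 / r * indicator (cball a (3 * r)) x) + 5 / r * indicator (cball b (3 * r)) x"
        using \<eta>(3)[of x] B(7)[of b x] by linarith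
      finally show ?thesis using insert.hyps by simp
    qed
    ultimately show ?case by (intro exI[of _ ?D]) blast
  qed
  then show ?thesis using that by blast
qed

text \<open>Cover the boundary by about \<open>n\<close> discs of radius \<open>r = L / (n + 1)\<close> centred on it, which is possible
  because the curves are Lipschitz, and cut out each of them with \<open>bump_out\<close>. The gradient of one
  factor has size of order \<open>1 / r\<close> on an area of order \<open>r\<^sup>2\<close>; summed over the discs this is of order
  \<open>n r\<close>, hence bounded. What bounds it is the length of the boundary.\<close>

lemma boundary_cutoffs:
  assumes C: "boundary_cycle C \<Omega>"
  obtains K :: real and \<eta> :: "nat \<Rightarrow> plane \<Rightarrow> real" and \<eta>' :: "nat \<Rightarrow> plane \<Rightarrow> plane"
  where "K \<ge> 0" "\<And>n. test_function \<Omega> (\<eta> n) (\<eta>' n)" "\<And>n x. 0 \<le> \<eta> n x" "\<And>n x. \<eta> n x \<le> 1"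
    "\<And>x. x \<in> \<Omega> \<Longrightarrow> (\<lambda>n. \<eta> n x) \<longlonglongrightarrow> 1"
    "\<And>n. integral\<^sup>L (lebesgue_on \<Omega>) (\<lambda>x. norm (\<eta>' n x)) \<le> K"
proof -
  have Cfin: "finite C" and O: "open \<Omega>" "bounded \<Omega>" and reg: "\<And>\<gamma>. \<gamma> \<in> C \<Longrightarrow> piecewise_regular \<gamma>"
    and fr: "frontier \<Omega> = (\<Union>\<gamma>\<in>C. path_image \<gamma>)"
    using C unfolding boundary_cycle_def by blast+
  have "\<exists>l>0. \<forall>x\<in>{0..1}. \<forall>y\<in>{0..1}. norm (\<gamma> x - \<gamma> y) \<le> l * \<bar>x - y\<bar>" if "\<gamma> \<in> C" for \<gamma>
    by (rule piecewise_regular_velocity[OF reg[OF that]]) blast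
  then obtain l where l: "\<And>\<gamma>. \<gamma> \<in> C \<Longrightarrow> l \<gamma> > 0"
    "\<And>\<gamma> x y. \<gamma> \<in> C \<Longrightarrow> x \<in> {0..1} \<Longrightarrow> y \<in> {0..1} \<Longrightarrow> norm (\<gamma> x - \<gamma> y) \<le> l \<gamma> * \<bar>x - y\<bar>" by metis
  define L where "L = 1 + (\<Sum>\<gamma>\<in>C. l \<gamma>)"
  have "L > 0" unfolding L_def using l(1) by (simp add: add_pos_nonneg sum_nonneg less_imp_le)
  have lL: "l \<gamma> \<le> L" if "\<gamma> \<in> C" for \<gamma>
    using member_le_sum[OF that, of l] Cfin l(1) unfolding L_def by (fastforce simp: less_imp_le)
  define r where "r = (\<lambda>n::nat. L / real (Suc n))"
  have r: "r n > 0" for n using \<open>L > 0\<close> by (simp add: r_def)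
  \<comment> \<open>Equidistant parameters: by the Lipschitz bound every boundary point is within \<open>r n\<close> of one of them.\<close>
  define A where "A = (\<lambda>n::nat. (\<lambda>(\<gamma>,i). \<gamma> (real i / real (Suc n))) ` (C \<times> {..Suc n}))"
  have Afin: "finite (A n)" for n unfolding A_def using Cfin by simp
  have Acard: "card (A n) \<le> card C * (n + 2)" for n
    unfolding A_def using card_image_le[of "C \<times> {..Suc n}"] Cfin by (simp add: card_cartesian_product)
  have Afr: "A n \<subseteq> frontier \<Omega>" for n
    unfolding A_def fr path_image_def by (auto simp: divide_simps)
  have Anear: "\<exists>a\<in>A n. norm (x - a) \<le> r n" if xfr: "x \<in> frontier \<Omega>" for x n
  proof -
    obtain \<gamma> s where s: "\<gamma> \<in> C" "s \<in> {0..1}" "x = \<gamma> s" using xfr fr unfolding path_image_def by auto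
    define i where "i = nat \<lfloor>s * real (Suc n)\<rfloor>"
    have i: "real i \<le> s * real (Suc n)" "s * real (Suc n) \<le> real i + 1"
      using s(2) unfolding i_def by (auto simp del: of_nat_Suc)
    have "s * real (Suc n) \<le> 1 * real (Suc n)" by (rule mult_right_mono) (use s(2) in auto)
    then have "real i \<le> 1 * real (Suc n)" by (rule order_trans[OF i(1)])
    then have "i \<le> Suc n" by (simp del: of_nat_Suc)
    then have a: "\<gamma> (real i / real (Suc n)) \<in> A n" "real i / real (Suc n) \<in> {0..1}"
      unfolding A_def using s(1) by (auto simp: divide_simps)
    have "\<bar>s - real i / real (Suc n)\<bar> \<le> 1 / real (Suc n)"
    proof -
      have "s - real i / real (Suc n) = (s * real (Suc n) - real i) / real (Suc n)"
        by (simp add: diff_divide_distrib del: of_nat_Suc)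
      moreover have "0 \<le> (s * real (Suc n) - real i) / real (Suc n)"
        using i(1) by (intro divide_nonneg_nonneg) (simp_all del: of_nat_Suc)
      moreover have "(s * real (Suc n) - real i) / real (Suc n) \<le> 1 / real (Suc n)"
        using i(2) by (intro divide_right_mono) (simp_all del: of_nat_Suc)
      ultimately show ?thesis by (simp only: abs_of_nonneg)
    qed
    then have "norm (x - \<gamma> (real i / real (Suc n))) \<le> L * (1 / real (Suc n))"
      using l(2)[OF s(1) s(2) a(2)] s(3) lL[OF s(1)] \<open>L > 0\<close>
      by (meson abs_ge_zero less_imp_le mult_mono order_trans)
    then show ?thesis using a(1) by (auto simp: r_def)
  qed
  define P where "P = (\<lambda>n x. \<Prod>a\<in>A n. bump_out a (r n) x)"
  have "\<forall>n. \<exists>\<eta>'. (\<forall>x. GDERIV (P n) x :> \<eta>' x) \<and> continuous_on UNIV \<eta>' \<and>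
      (\<forall>x. norm (\<eta>' x) \<le> (\<Sum>a\<in>A n. 5 / r n * indicator (cball a (3 * r n)) x))"
    unfolding P_def by (intro allI, rule bump_out_product[OF r Afin]) blast
  then obtain P' where P': "\<And>n x. GDERIV (P n) x :> P' n x" "\<And>n. continuous_on UNIV (P' n)"
      "\<And>n x. norm (P' n x) \<le> (\<Sum>a\<in>A n. 5 / r n * indicator (cball a (3 * r n)) x)" by metis
  have P01: "0 \<le> P n x" "P n x \<le> 1" for n x
    using bump_out_props(1,2)[OF r[of n]] unfolding P_def by (auto intro!: prod_nonneg prod_le_1)
  \<comment> \<open>Vanishing on the disc of twice the radius makes the product vanish in a whole \<open>r n\<close>-neighbourhood of
    the boundary.\<close>
  have P0: "P n x = 0" if yfr: "y \<in> frontier \<Omega>" "dist y x < r n" for n x y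
  proof -
    obtain a where a: "a \<in> A n" "norm (y - a) \<le> r n" using Anear yfr(1) by blast
    have "norm (x - a) \<le> norm (x - y) + norm (y - a)" using norm_triangle_ineq[of "x - y" "y - a"] by simp
    then have "norm (x - a) \<le> 2 * r n" using a(2) yfr(2) by (simp add: dist_norm norm_minus_commute)
    then have "bump_out a (r n) x = 0" by (rule bump_out_props(3)[OF r])
    then show ?thesis unfolding P_def using a(1) Afin by auto
  qed
  define \<eta> where "\<eta> = (\<lambda>n x. if x \<in> \<Omega> then P n x else 0)"
  define \<eta>' where "\<eta>' = (\<lambda>n x. if x \<in> \<Omega> then P' n x else 0)"
  \<comment> \<open>The compact support of the cutoff: points of the closure at distance at least \<open>r n\<close> from the
    boundary.\<close>
  define K where "K = (\<lambda>n. closure \<Omega> - (\<Union>y\<in>frontier \<Omega>. ball y (r n)))"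
  have Kc: "compact (K n)" for n
    unfolding K_def using O(2) by (intro compact_diff open_UN) auto
  have KO: "K n \<subseteq> \<Omega>" for n
    using r[of n] O(1) unfolding K_def frontier_def interior_open[OF O(1)] by auto
  have zero: "\<eta> n x = 0" if "x \<notin> K n" for n x
  proof (cases "x \<in> \<Omega>")
    case True
    then have "x \<in> closure \<Omega>" using closure_subset by auto
    then obtain y where "y \<in> frontier \<Omega>" "dist y x < r n" using \<open>x \<notin> K n\<close> unfolding K_def by auto
    then show ?thesis using P0 by (simp add: \<eta>_def)
  qed (simp add: \<eta>_def)
  have op: "open (- K n)" for n using Kc compact_imp_closed by blast
  have GD: "GDERIV (\<eta> n) x :> \<eta>' n x" for n x
  proof (cases "x \<in> \<Omega>")
    case True
    have "(P n has_derivative (\<lambda>h. h \<bullet> P' n x)) (at x)" using P'(1) by (simp add: gderiv_def)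
    then have "(\<eta> n has_derivative (\<lambda>h. h \<bullet> P' n x)) (at x)"
      by (rule has_derivative_transform_within_open[OF _ O(1) True]) (simp add: \<eta>_def)
    then show ?thesis using True by (simp add: gderiv_def \<eta>'_def)
  next
    case False
    then have x: "x \<in> - K n" using KO by auto
    have "((\<lambda>_. 0) has_derivative (\<lambda>h. 0)) (at x)" by simp
    then have "(\<eta> n has_derivative (\<lambda>h. 0)) (at x)"
      by (rule has_derivative_transform_within_open[OF _ op x]) (simp add: zero)
    then show ?thesis using False by (simp add: gderiv_def \<eta>'_def)
  qed
  have \<eta>'0: "\<eta>' n x = 0" if "x \<in> - K n" for n x
  proof -
    have "((\<lambda>_. 0) has_derivative (\<lambda>h. 0)) (at x)" by simp
    then have "(\<eta> n has_derivative (\<lambda>h. 0)) (at x)"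
      by (rule has_derivative_transform_within_open[OF _ op that]) (simp add: zero)
    moreover have "(\<eta> n has_derivative (\<lambda>h. h \<bullet> \<eta>' n x)) (at x)" using GD by (simp add: gderiv_def)
    ultimately have "(\<lambda>h. h \<bullet> \<eta>' n x) = (\<lambda>h. 0)" by (rule has_derivative_unique[symmetric])
    then show ?thesis by (metis inner_eq_zero_iff)
  qed
  have cont: "continuous_on UNIV (\<eta>' n)" for n
  proof -
    have "continuous_on \<Omega> (\<eta>' n)"
      by (rule continuous_on_eq[OF continuous_on_subset[OF P'(2)[of n]]]) (auto simp: \<eta>'_def)
    moreover have "continuous_on (- K n) (\<eta>' n)"
      by (rule continuous_on_eq[of _ "\<lambda>_. 0"]) (auto simp: \<eta>'0)
    ultimately have "continuous_on (\<Omega> \<union> - K n) (\<eta>' n)" using O(1) op by (intro continuous_on_open_Un)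
    moreover have "\<Omega> \<union> - K n = UNIV" using KO by auto
    ultimately show ?thesis by simp
  qed
  have test: "test_function \<Omega> (\<eta> n) (\<eta>' n)" for n
    unfolding test_function_def by (intro conjI allI GD cont exI[of _ "K n"] Kc KO) (use zero in auto)
  have lim: "(\<lambda>n. \<eta> n x) \<longlonglongrightarrow> 1" if x: "x \<in> \<Omega>" for x
  proof -
    have "x \<notin> frontier \<Omega>" using x O(1) by (simp add: frontier_def interior_open)
    then obtain d where d: "d > 0" "\<And>y. y \<in> frontier \<Omega> \<Longrightarrow> d \<le> dist x y"
      using separate_point_closed[OF frontier_closed] by blast
    have "r \<longlonglongrightarrow> 0"
    proof -
      have "(\<lambda>n. L * (1 / real (Suc n))) \<longlonglongrightarrow> L * 0"
        using lim_1_over_n[where 'a=real] LIMSEQ_Suc by (intro tendsto_mult tendsto_const) blast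
      then show ?thesis by (simp add: r_def)
    qed
    then have "\<forall>\<^sub>F n in sequentially. r n < d / 3" using d(1) by (intro order_tendstoD) auto
    then have "\<forall>\<^sub>F n in sequentially. 1 = \<eta> n x"
    proof eventually_elim
      case (elim n)
      have "bump_out a (r n) x = 1" if "a \<in> A n" for a
        using d(2)[of a] Afr[of n] that elim by (intro bump_out_props(4)[OF r]) (auto simp: dist_norm)
      then show ?case using x by (simp add: \<eta>_def P_def)
    qed
    then show ?thesis by (rule Lim_transform_eventually[OF tendsto_const])
  qed
  \<comment> \<open>A disc of radius \<open>3 r\<close> contributes \<open>(5 / r) * 9 \<pi> r\<^sup>2\<close>, and there are at most \<open>n + 2\<close> discs per
    curve.\<close>
  define KK where "KK = 5 * 9 * pi * (real (card C) * (2 * L))"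
  have "KK \<ge> 0" unfolding KK_def using \<open>L > 0\<close> by simp
  have bd: "integral\<^sup>L (lebesgue_on \<Omega>) (\<lambda>x. norm (\<eta>' n x)) \<le> KK" for n
  proof -
    have [measurable]: "cball a b \<in> sets borel" for a :: plane and b by (simp add: borel_closed)
    have i1: "integrable lborel (\<lambda>x. norm (\<eta>' n x))"
      using test_function_integral_gradient_zero(1)[OF test] by (rule integrable_norm)
    have "(\<lambda>x. norm (\<eta>' n x)) \<in> borel_measurable borel"
      using cont by (intro borel_measurable_continuous_onI continuous_intros)
    then have "integral\<^sup>L (lebesgue_on \<Omega>) (\<lambda>x. norm (\<eta>' n x)) = integral\<^sup>L lborel (\<lambda>x. indicator \<Omega> x *\<^sub>R norm (\<eta>' n x))"
      by (rule integral_lebesgue_on_eq_lborel(1)[OF O(1)])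
    also have "(\<lambda>x. indicator \<Omega> x *\<^sub>R norm (\<eta>' n x)) = (\<lambda>x. norm (\<eta>' n x))"
      by (auto simp: \<eta>'_def fun_eq_iff)
    also have "integral\<^sup>L lborel (\<lambda>x. norm (\<eta>' n x)) \<le> integral\<^sup>L lborel (\<lambda>x. \<Sum>a\<in>A n. 5 / r n * indicator (cball a (3 * r n)) x)"
    proof (rule Bochner_Integration.integral_mono[OF i1])
      show "integrable lborel (\<lambda>x. \<Sum>a\<in>A n. 5 / r n * indicator (cball a (3 * r n)) x)"
        by (intro Bochner_Integration.integrable_sum integrable_mult_right) (simp add: integrable_indicator_iff emeasure_cball r less_imp_le)
      show "norm (\<eta>' n x) \<le> (\<Sum>a\<in>A n. 5 / r n * indicator (cball a (3 * r n)) x)" for x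
        using P'(3)[of n x] order_trans[OF norm_ge_zero P'(3)[of n x]] by (simp add: \<eta>'_def)
    qed
    also have "\<dots> = (\<Sum>a\<in>A n. 5 / r n * measure lborel (cball a (3 * r n)))"
      by (subst Bochner_Integration.integral_sum) (auto intro!: integrable_mult_right simp: integrable_indicator_iff emeasure_cball r less_imp_le)
    also have "\<dots> = (\<Sum>a\<in>A n. 5 * 9 * pi * r n)"
    proof (rule sum.cong)
      fix a :: plane
      have "measure lborel (cball a (3 * r n)) = pi * (3 * r n)\<^sup>2"
        using r[of n] by (simp add: content_cball unit_ball_vol_2)
      then show "5 / r n * measure lborel (cball a (3 * r n)) = 5 * 9 * pi * r n"
        using r[of n] by (simp add: power2_eq_square field_simps)
    qed simp
    also have "\<dots> = 5 * 9 * pi * (real (card (A n)) * r n)" by simp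
    also have "\<dots> \<le> 5 * 9 * pi * (real (card C) * (2 * L))"
    proof (rule mult_left_mono)
      have "real (card (A n)) * r n \<le> real (card C * (n + 2)) * r n"
        using Acard[of n] r[of n] by (intro mult_right_mono) (auto simp del: of_nat_mult)
      also have "\<dots> = real (card C) * (real (n + 2) * r n)" by (simp only: of_nat_mult mult.assoc)
      also have "\<dots> \<le> real (card C) * (2 * L)"
      proof (rule mult_left_mono)
        have "real (n + 2) \<le> 2 * real (Suc n)" by simp
        then have "real (n + 2) * r n \<le> 2 * real (Suc n) * r n" using r[of n] by (intro mult_right_mono) auto
        also have "\<dots> = 2 * L" by (simp add: r_def del: of_nat_Suc)
        finally show "real (n + 2) * r n \<le> 2 * L" .
      qed simp
      finally show "real (card (A n)) * r n \<le> real (card C) * (2 * L)" .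
    qed simp
    finally show ?thesis unfolding KK_def .
  qed
  show ?thesis
    by (rule that[OF \<open>KK \<ge> 0\<close> test _ _ lim bd]) (auto simp: \<eta>_def P01)
qed

section \<open>The Gauss--Green formula for weak divergences\<close>

text \<open>Continuously differentiable functions form an algebra that separates points, which is what the
  Stone--Weierstrass theorem asks for.\<close>

definition C1_function :: "(plane \<Rightarrow> real) \<Rightarrow> bool" where
  "C1_function f \<longleftrightarrow> (\<exists>f'. (\<forall>x. GDERIV f x :> f' x) \<and> continuous_on UNIV f')"

lemma C1_function_continuous: "C1_function f \<Longrightarrow> continuous_on S f"
  unfolding C1_function_def by (blast intro: GDERIV_imp_continuous_on)

lemma C1_function_const: "C1_function (\<lambda>x. c)"
  unfolding C1_function_def by (intro exI[of _ "\<lambda>_. 0"]) (auto intro: GDERIV_const)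

lemma C1_function_add:
  assumes "C1_function f" "C1_function g"
  shows "C1_function (\<lambda>x. f x + g x)"
proof -
  obtain f' g' where "\<And>x. GDERIV f x :> f' x" "continuous_on UNIV f'" "\<And>x. GDERIV g x :> g' x" "continuous_on UNIV g'"
    using assms unfolding C1_function_def by blast
  then show ?thesis unfolding C1_function_def
    by (intro exI[of _ "\<lambda>x. f' x + g' x"]) (auto intro!: GDERIV_add continuous_intros)
qed

lemma C1_function_mult:
  assumes "C1_function f" "C1_function g"
  shows "C1_function (\<lambda>x. f x * g x)"
proof -
  obtain f' g' where "\<And>x. GDERIV f x :> f' x" "continuous_on UNIV f'" "\<And>x. GDERIV g x :> g' x" "continuous_on UNIV g'"
    using assms unfolding C1_function_def by blast
  then show ?thesis unfolding C1_function_def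
    using C1_function_continuous[OF assms(1)] C1_function_continuous[OF assms(2)]
    by (intro exI[of _ "\<lambda>x. f x *\<^sub>R g' x + g x *\<^sub>R f' x"]) (auto intro!: GDERIV_mult continuous_intros)
qed

lemma C1_function_coordinate: "C1_function (\<lambda>x. x $ i)"
proof -
  have "GDERIV (\<lambda>x. x $ i) x :> axis i 1" for x :: plane
    unfolding gderiv_def by (auto intro!: derivative_eq_intros bounded_linear_imp_has_derivative simp: inner_axis)
  then show ?thesis unfolding C1_function_def by (intro exI[of _ "\<lambda>_. axis i 1"]) auto
qed

lemma C1_function_smooth_step:
  assumes "C1_function f"
  shows "C1_function (\<lambda>x. smooth_step (f x))"
proof -
  obtain f' where f': "\<And>x. GDERIV f x :> f' x" "continuous_on UNIV f'" using assms unfolding C1_function_def by blast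
  have "GDERIV (\<lambda>x. smooth_step (f x)) x :> smooth_step' (f x) *\<^sub>R f' x" for x
    by (rule GDERIV_DERIV_compose[OF f'(1) DERIV_smooth_step])
  then show ?thesis unfolding C1_function_def using f'(2) C1_function_continuous[OF assms]
    by (intro exI[of _ "\<lambda>x. smooth_step' (f x) *\<^sub>R f' x"]) (auto intro!: continuous_intros)
qed

text \<open>Approximate by Stone--Weierstrass and multiply with a cutoff that is 1 on \<open>S\<close>.\<close>

lemma test_function_dense:
  fixes f :: "plane \<Rightarrow> real"
  assumes S: "compact S" and f: "continuous_on S f" and "e > 0"
  obtains g g' where "test_function UNIV g g'" "\<And>x. x \<in> S \<Longrightarrow> \<bar>f x - g x\<bar> < e"
proof -
  have "\<exists>g. C1_function g \<and> (\<forall>x \<in> S. \<bar>f x - g x\<bar> < e)"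
  proof (rule Stone_Weierstrass_HOL[OF S _ _ _ _ _ f \<open>e > 0\<close>])
    show "\<exists>h. C1_function h \<and> h x \<noteq> h y" if xy: "x \<in> S \<and> y \<in> S \<and> x \<noteq> y" for x y
    proof -
      obtain i where "x $ i \<noteq> y $ i" using xy by (auto simp: vec_eq_iff)
      then show ?thesis using C1_function_coordinate[of i] by blast
    qed
  qed (auto intro: C1_function_const C1_function_add C1_function_mult C1_function_continuous)
  then obtain g where g: "C1_function g" "\<And>x. x \<in> S \<Longrightarrow> \<bar>f x - g x\<bar> < e" by blast
  obtain g' where g': "\<And>x. GDERIV g x :> g' x" "continuous_on UNIV g'" using g(1) unfolding C1_function_def by blast
  obtain R where R: "R > 0" "\<And>x. x \<in> S \<Longrightarrow> norm x \<le> R"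
    using compact_imp_bounded[OF S] bounded_pos by metis
  define \<theta> where "\<theta> = (\<lambda>x. 1 - bump_out 0 R x)"
  have "test_function UNIV \<theta> (\<lambda>x. - bump_out' 0 R x)"
    unfolding test_function_def
  proof (intro conjI allI)
    show "GDERIV \<theta> x :> - bump_out' 0 R x" for x
      unfolding \<theta>_def using GDERIV_diff[OF GDERIV_const bump_out_props(5)[OF R(1)], of 1 0 x] by simp
    show "continuous_on UNIV (\<lambda>x. - bump_out' 0 R x)" using bump_out_props(6)[OF R(1)] by (intro continuous_intros)
    show "\<exists>K. compact K \<and> K \<subseteq> UNIV \<and> (\<forall>x. x \<notin> K \<longrightarrow> \<theta> x = 0)"
      using bump_out_props(4)[OF R(1), of _ 0] by (intro exI[of _ "cball 0 (3 * R)"]) (auto simp: \<theta>_def)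
  qed
  from test_function_mult[OF this g'] have t: "test_function UNIV (\<lambda>x. \<theta> x * g x) (\<lambda>x. \<theta> x *\<^sub>R g' x + g x *\<^sub>R - bump_out' 0 R x)" .
  have eq: "\<theta> x * g x = g x" if "x \<in> S" for x
    using bump_out_props(3)[OF R(1), of x 0] R(2)[OF that] R(1) by (simp add: \<theta>_def)
  show ?thesis
  proof (rule that[OF t])
    show "\<bar>f x - \<theta> x * g x\<bar> < e" if "x \<in> S" for x unfolding eq[OF that] using g(2)[OF that] .
  qed
qed

lemma test_function_integral_gradient_zero_on:
  assumes O: "open \<Omega>" and t: "test_function \<Omega> f f'"
  shows "integrable (lebesgue_on \<Omega>) f'" "integral\<^sup>L (lebesgue_on \<Omega>) f' = 0"
proof -
  obtain Q where Q: "Q \<subseteq> \<Omega>" "\<And>x. x \<notin> Q \<Longrightarrow> f' x = 0" using test_function_support[OF t] by metis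
  have m: "f' \<in> borel_measurable borel" using test_function_continuous(2)[OF t] by (rule borel_measurable_continuous_onI)
  have e: "(\<lambda>x. indicator \<Omega> x *\<^sub>R f' x) = f'"
  proof
    fix x show "indicator \<Omega> x *\<^sub>R f' x = f' x" using Q(1) Q(2)[of x] by (cases "x \<in> \<Omega>") auto
  qed
  show "integrable (lebesgue_on \<Omega>) f'" "integral\<^sup>L (lebesgue_on \<Omega>) f' = 0"
    using integral_lebesgue_on_eq_lborel[OF O m] test_function_integral_gradient_zero[OF t] unfolding e by simp_all
qed

text \<open>Off the support of \<open>\<phi>\<close> the product is locally zero, so it is differentiable everywhere although \<open>u\<close>
  is so on \<open>\<Omega>\<close> only.\<close>

lemma test_function_mult_local:
  assumes O: "open \<Omega>" and \<phi>: "test_function \<Omega> \<phi> \<phi>'"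
    and u: "\<And>x. x \<in> \<Omega> \<Longrightarrow> GDERIV u x :> F x" and F: "continuous_on \<Omega> F"
  shows "test_function \<Omega> (\<lambda>x. \<phi> x * u x) (\<lambda>x. \<phi> x *\<^sub>R F x + u x *\<^sub>R \<phi>' x)"
proof -
  obtain K where K: "compact K" "K \<subseteq> \<Omega>" "\<And>x. x \<notin> K \<Longrightarrow> \<phi> x = 0" "\<And>x. x \<notin> K \<Longrightarrow> \<phi>' x = 0"
    using test_function_support[OF \<phi>] by metis
  have op: "open (- K)" using K(1) compact_imp_closed by blast
  have U: "\<Omega> \<union> - K = UNIV" using K(2) by auto
  let ?D = "\<lambda>x. \<phi> x *\<^sub>R F x + u x *\<^sub>R \<phi>' x"
  have "GDERIV (\<lambda>x. \<phi> x * u x) x :> ?D x" for x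
  proof (cases "x \<in> \<Omega>")
    case True
    show ?thesis using \<phi> by (intro GDERIV_mult u True) (simp add: test_function_def)
  next
    case False
    then have x: "x \<in> - K" using K(2) by auto
    have "((\<lambda>_. 0) has_derivative (\<lambda>h. h \<bullet> 0)) (at x)" by simp
    then have "((\<lambda>x. \<phi> x * u x) has_derivative (\<lambda>h. h \<bullet> 0)) (at x)"
      by (rule has_derivative_transform_within_open[OF _ op x]) (use K(3) in simp)
    then show ?thesis using x K(3,4) by (simp add: gderiv_def)
  qed
  moreover have "continuous_on UNIV ?D"
  proof -
    have "continuous_on \<Omega> u"
      using u unfolding gderiv_def by (meson has_derivative_continuous continuous_at_imp_continuous_on)
    then have "continuous_on \<Omega> ?D" using F test_function_continuous[OF \<phi>] by (intro continuous_intros) auto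
    moreover have "continuous_on (- K) ?D"
      by (rule continuous_on_eq[of _ "\<lambda>_. 0"]) (use K(3,4) in auto)
    ultimately have "continuous_on (\<Omega> \<union> - K) ?D" using O op by (intro continuous_on_open_Un)
    then show ?thesis unfolding U .
  qed
  ultimately show ?thesis unfolding test_function_def
    using K by (intro conjI allI exI[of _ K]) auto
qed

text \<open>Approximate \<open>V\<close> within \<open>\<epsilon>\<close> by a field \<open>W\<close> with test functions as components and divergence \<open>q\<close>. The
  fluxes differ by \<open>O(\<epsilon>)\<close>, and Green's formula applies to \<open>W\<close>. With the cutoffs \<open>\<eta>\<^sub>n\<close> the integral of
  \<open>\<eta>\<^sub>n (h - q)\<close> is that of \<open>(W - V) \<bullet> \<nabla>\<eta>\<^sub>n\<close>, hence \<open>O(\<epsilon>)\<close> uniformly in \<open>n\<close>, and it converges to the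
  integral of \<open>h - q\<close>.\<close>

lemma flux_weak_divergence:
  fixes V :: "plane \<Rightarrow> plane" and h :: "plane \<Rightarrow> real"
  assumes C: "boundary_cycle C \<Omega>" and V: "continuous_on (closure \<Omega>) V" and h: "integrable (lebesgue_on \<Omega>) h"
    and weak: "\<And>\<phi> \<phi>'. test_function \<Omega> \<phi> \<phi>' \<Longrightarrow>
        integral\<^sup>L (lebesgue_on \<Omega>) (\<lambda>x. V x \<bullet> \<phi>' x) = - integral\<^sup>L (lebesgue_on \<Omega>) (\<lambda>x. \<phi> x * h x)"
  shows "flux C V = integral\<^sup>L (lebesgue_on \<Omega>) h"
proof -
  have Cfin: "finite C" and O: "open \<Omega>" "bounded \<Omega>" and reg: "\<And>\<gamma>. \<gamma> \<in> C \<Longrightarrow> piecewise_regular \<gamma>"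
    and fr: "frontier \<Omega> = (\<Union>\<gamma>\<in>C. path_image \<gamma>)"
    using C unfolding boundary_cycle_def by blast+
  have frc: "(\<Union>\<gamma>\<in>C. path_image \<gamma>) \<subseteq> closure \<Omega>" using fr by (auto simp: frontier_def)
  have cc: "compact (closure \<Omega>)" using O(2) by simp
  obtain L where L: "L \<ge> 0"
    "\<And>V W \<epsilon>. continuous_on (\<Union>\<gamma>\<in>C. path_image \<gamma>) V \<Longrightarrow> continuous_on (\<Union>\<gamma>\<in>C. path_image \<gamma>) W \<Longrightarrow>
       (\<And>x. x \<in> (\<Union>\<gamma>\<in>C. path_image \<gamma>) \<Longrightarrow> norm (V x - W x) \<le> \<epsilon>) \<Longrightarrow> \<bar>flux C V - flux C W\<bar> \<le> \<epsilon> * L"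
    by (rule flux_bound[OF Cfin reg]) blast+
  obtain K \<eta> \<eta>' where K: "K \<ge> 0" and test: "\<And>n. test_function \<Omega> (\<eta> n) (\<eta>' n)" and \<eta>01: "\<And>n x. 0 \<le> \<eta> n x" "\<And>n x. \<eta> n x \<le> 1"
    and lim: "\<And>x. x \<in> \<Omega> \<Longrightarrow> (\<lambda>n. \<eta> n x) \<longlonglongrightarrow> 1"
    and bd: "\<And>n. integral\<^sup>L (lebesgue_on \<Omega>) (\<lambda>x. norm (\<eta>' n x)) \<le> K"
    using boundary_cutoffs[OF C] by blast
  have sp: "space (lebesgue_on \<Omega>) = \<Omega>" by simp
  have cm: "f \<in> borel_measurable (lebesgue_on \<Omega>)" if "continuous_on \<Omega> f" for f :: "plane \<Rightarrow> 'b::euclidean_space"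
    using that O(1) by (intro continuous_imp_measurable_on_sets_lebesgue) auto
  have ti: "integrable (lebesgue_on \<Omega>) f'" if "test_function UNIV f f'" for f f'
  proof -
    have m: "f' \<in> borel_measurable borel" using test_function_continuous(2)[OF that] by (rule borel_measurable_continuous_onI)
    have "integrable lborel (\<lambda>x. indicator \<Omega> x *\<^sub>R f' x)"
      using test_function_integral_gradient_zero(1)[OF that] O(1) by (intro integrable_mult_indicator) auto
    then show ?thesis using integral_lebesgue_on_eq_lborel(2)[OF O(1) m] by simp
  qed
  have tU: "test_function UNIV (\<eta> n) (\<eta>' n)" for n using test by (rule test_function_mono) simp
  have main: "\<bar>flux C V - integral\<^sup>L (lebesgue_on \<Omega>) h\<bar> \<le> \<epsilon> * (L + K)" if "\<epsilon> > 0" for \<epsilon>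
  proof -
    have cV: "continuous_on (closure \<Omega>) (\<lambda>x. V x $ i)" for i using V by (intro continuous_intros)
    have "\<epsilon> / 2 > 0" using that by simp
    \<comment> \<open>Half the tolerance for each component, as the norm is bounded by the sum of the two.\<close>
    have "\<forall>i. \<exists>g g'. test_function UNIV g g' \<and> (\<forall>x\<in>closure \<Omega>. \<bar>V x $ i - g x\<bar> < \<epsilon> / 2)"
      by (intro allI, rule test_function_dense[OF cc cV \<open>\<epsilon>/2 > 0\<close>]) blast
    then obtain G G' where G: "\<And>i. test_function UNIV (G i) (G' i)" "\<And>i x. x \<in> closure \<Omega> \<Longrightarrow> \<bar>V x $ i - G i x\<bar> < \<epsilon> / 2" by metis
    define W :: "plane \<Rightarrow> plane" where "W = (\<lambda>x. \<chi> i. G i x)"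
    have VW: "norm (V x - W x) \<le> \<epsilon>" if "x \<in> closure \<Omega>" for x
    proof -
      have "norm (V x - W x) \<le> (\<Sum>i\<in>UNIV. \<bar>(V x - W x) $ i\<bar>)" by (rule norm_le_l1_cart)
      also have "\<dots> \<le> \<epsilon>" using G(2)[OF that, of 1] G(2)[OF that, of 2] by (simp add: sum_2 W_def)
      finally show ?thesis .
    qed
    have cW: "continuous_on T W" for T
      unfolding W_def by (intro continuous_on_vec_lambda test_function_continuous(1)[OF G(1)])
    define q where "q = (\<lambda>x. G' 1 x $ 1 + G' 2 x $ (2::2))"
    have iG: "integrable (lebesgue_on \<Omega>) (\<lambda>x. G' i x $ j)" for i j
      using integrable_bounded_linear[OF bounded_linear_vec_nth ti[OF G(1)]] .
    have qi: "integrable (lebesgue_on \<Omega>) q" unfolding q_def using iG by (intro Bochner_Integration.integrable_add)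
    have fluxW: "flux C W = integral\<^sup>L (lebesgue_on \<Omega>) q"
    proof -
      have I: "(\<lambda>s. G i (\<gamma> s) * vector_derivative \<gamma> (at s) $ j) integrable_on {0..1}" if mem: "\<gamma> \<in> C" for \<gamma> i j
      proof -
        have c: "continuous_on (path_image \<gamma>) (G i)" by (rule test_function_continuous(1)[OF G(1)])
        obtain M where M: "\<And>x. \<bar>G i x\<bar> \<le> M" using test_function_bounded[OF G(1)] by metis
        show ?thesis by (rule curve_integral_bound[OF reg[OF mem]]) (use c M in blast)
      qed
      have "flux C W = (\<Sum>\<gamma>\<in>C. integral {0..1} (\<lambda>s. G 1 (\<gamma> s) * vector_derivative \<gamma> (at s) $ 2) - integral {0..1} (\<lambda>s. G 2 (\<gamma> s) * vector_derivative \<gamma> (at s) $ 1))"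
        unfolding flux_def W_def using I by (intro sum.cong) (simp_all add: Henstock_Kurzweil_Integration.integral_diff)
      also have "\<dots> = integral\<^sup>L (lebesgue_on \<Omega>) (\<lambda>x. G' 1 x $ 1) + integral\<^sup>L (lebesgue_on \<Omega>) (\<lambda>x. G' 2 x $ 2)"
        unfolding sum_subtractf green_test_function(1)[OF C G(1)] green_test_function(2)[OF C G(1)] by simp
      also have "\<dots> = integral\<^sup>L (lebesgue_on \<Omega>) q"
        unfolding q_def using iG by (intro Bochner_Integration.integral_add[symmetric])
      finally show ?thesis .
    qed
    have fl: "\<bar>flux C V - flux C W\<bar> \<le> \<epsilon> * L"
      using V cW frc VW by (intro L(2)) (auto intro: continuous_on_subset)
    have step: "\<bar>integral\<^sup>L (lebesgue_on \<Omega>) (\<lambda>x. \<eta> n x * (h x - q x))\<bar> \<le> \<epsilon> * K" for n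
    proof -
      have cx: "continuous_on T (\<eta> n)" "continuous_on T (\<eta>' n)" for T using test_function_continuous[OF test] by auto
      have i1: "integrable (lebesgue_on \<Omega>) (\<lambda>x. \<eta> n x * k x)" if k: "integrable (lebesgue_on \<Omega>) k" for k
      proof (rule Bochner_Integration.integrable_bound[OF k])
        show "(\<lambda>x. \<eta> n x * k x) \<in> borel_measurable (lebesgue_on \<Omega>)" using k cm[OF cx(1)] by auto
        show "AE x in lebesgue_on \<Omega>. norm (\<eta> n x * k x) \<le> norm (k x)"
          using \<eta>01[of n] by (intro AE_I2) (simp add: abs_mult mult_left_le_one_le)
      qed
      have i2: "integrable (lebesgue_on \<Omega>) (\<lambda>x. U x \<bullet> \<eta>' n x)" if U: "continuous_on (closure \<Omega>) U" for U
      proof -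
        have "bounded (U ` closure \<Omega>)" using U cc compact_continuous_image compact_imp_bounded by blast
        then obtain B where B: "\<And>x. x \<in> closure \<Omega> \<Longrightarrow> norm (U x) \<le> B" unfolding bounded_iff by blast
        have cU: "continuous_on \<Omega> U" using U closure_subset continuous_on_subset by blast
        show ?thesis
        proof (rule Bochner_Integration.integrable_bound)
          show "integrable (lebesgue_on \<Omega>) (\<lambda>x. B * norm (\<eta>' n x))" using ti[OF tU] by simp
          show "(\<lambda>x. U x \<bullet> \<eta>' n x) \<in> borel_measurable (lebesgue_on \<Omega>)"
            using cU cx by (intro cm continuous_intros)
          show "AE x in lebesgue_on \<Omega>. norm (U x \<bullet> \<eta>' n x) \<le> norm (B * norm (\<eta>' n x))"
          proof (rule AE_I2)
            fix x assume "x \<in> space (lebesgue_on \<Omega>)"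
            then have "norm (U x) \<le> B" using B closure_subset sp by blast
            have "norm (U x \<bullet> \<eta>' n x) \<le> norm (U x) * norm (\<eta>' n x)" using Cauchy_Schwarz_ineq2 by simp
            also have "\<dots> \<le> B * norm (\<eta>' n x)" using \<open>norm (U x) \<le> B\<close> by (intro mult_right_mono) auto
            also have "\<dots> \<le> norm (B * norm (\<eta>' n x))" by simp
            finally show "norm (U x \<bullet> \<eta>' n x) \<le> norm (B * norm (\<eta>' n x))" .
          qed
        qed
      qed
      have ibp: "integral\<^sup>L (lebesgue_on \<Omega>) (\<lambda>x. \<eta> n x * q x) = - integral\<^sup>L (lebesgue_on \<Omega>) (\<lambda>x. W x \<bullet> \<eta>' n x)"
      proof -
        have z: "integral\<^sup>L (lebesgue_on \<Omega>) (\<lambda>x. \<eta> n x * G' i x $ i + G i x * \<eta>' n x $ i) = 0" for i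
        proof -
          let ?F = "\<lambda>x. \<eta> n x *\<^sub>R G' i x + G i x *\<^sub>R \<eta>' n x"
          have t: "test_function \<Omega> (\<lambda>x. \<eta> n x * G i x) ?F"
            using G(1)[of i] by (intro test_function_mult[OF test]) (auto simp: test_function_def)
          note I = test_function_integral_gradient_zero_on[OF O(1) t]
          then have "integral\<^sup>L (lebesgue_on \<Omega>) (\<lambda>x. ?F x $ i) = 0"
            using integral_bounded_linear[OF bounded_linear_vec_nth, of "lebesgue_on \<Omega>" ?F i] by simp
          then show ?thesis by simp
        qed
        have e: "\<eta> n x * q x + W x \<bullet> \<eta>' n x = (\<eta> n x * G' 1 x $ 1 + G 1 x * \<eta>' n x $ 1) + (\<eta> n x * G' 2 x $ 2 + G 2 x * \<eta>' n x $ 2)" for x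
          by (simp add: q_def W_def inner_vec_def sum_2 algebra_simps)
        have zi: "integrable (lebesgue_on \<Omega>) (\<lambda>x. \<eta> n x * G' i x $ i + G i x * \<eta>' n x $ i)" for i
        proof -
          have "integrable (lebesgue_on \<Omega>) (\<lambda>x. (G i x *\<^sub>R axis i 1) \<bullet> \<eta>' n x)"
            by (intro i2 continuous_intros test_function_continuous(1)[OF G(1)])
          then have "integrable (lebesgue_on \<Omega>) (\<lambda>x. G i x * \<eta>' n x $ i)" by (simp add: inner_axis')
          then show ?thesis using i1[OF iG] by (intro Bochner_Integration.integrable_add)
        qed
        have "integral\<^sup>L (lebesgue_on \<Omega>) (\<lambda>x. \<eta> n x * q x) + integral\<^sup>L (lebesgue_on \<Omega>) (\<lambda>x. W x \<bullet> \<eta>' n x)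
            = integral\<^sup>L (lebesgue_on \<Omega>) (\<lambda>x. \<eta> n x * q x + W x \<bullet> \<eta>' n x)"
          using i1[OF qi] i2[OF cW] by (rule Bochner_Integration.integral_add[symmetric])
        also have "\<dots> = 0" unfolding e using z zi by (simp add: Bochner_Integration.integral_add)
        finally show ?thesis by simp
      qed
      have "integral\<^sup>L (lebesgue_on \<Omega>) (\<lambda>x. \<eta> n x * (h x - q x)) = integral\<^sup>L (lebesgue_on \<Omega>) (\<lambda>x. \<eta> n x * h x) - integral\<^sup>L (lebesgue_on \<Omega>) (\<lambda>x. \<eta> n x * q x)"
        unfolding right_diff_distrib using i1[OF h] i1[OF qi] by (rule Bochner_Integration.integral_diff)
      also have "\<dots> = integral\<^sup>L (lebesgue_on \<Omega>) (\<lambda>x. W x \<bullet> \<eta>' n x) - integral\<^sup>L (lebesgue_on \<Omega>) (\<lambda>x. V x \<bullet> \<eta>' n x)"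
        using weak[OF test[of n]] ibp by simp
      also have "\<dots> = integral\<^sup>L (lebesgue_on \<Omega>) (\<lambda>x. W x \<bullet> \<eta>' n x - V x \<bullet> \<eta>' n x)"
        using i2[OF cW] i2[OF V] by (rule Bochner_Integration.integral_diff[symmetric])
      also have "\<bar>\<dots>\<bar> \<le> integral\<^sup>L (lebesgue_on \<Omega>) (\<lambda>x. \<epsilon> * norm (\<eta>' n x))"
        unfolding real_norm_def[symmetric]
      proof (rule norm_integral_le_integral)
        show "integrable (lebesgue_on \<Omega>) (\<lambda>x. W x \<bullet> \<eta>' n x - V x \<bullet> \<eta>' n x)" using i2[OF cW] i2[OF V] by (rule Bochner_Integration.integrable_diff)
        show "integrable (lebesgue_on \<Omega>) (\<lambda>x. \<epsilon> * norm (\<eta>' n x))" using ti[OF tU] by simp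
        fix x assume "x \<in> space (lebesgue_on \<Omega>)"
        then have x: "x \<in> closure \<Omega>" using closure_subset sp by blast
        have "norm (W x \<bullet> \<eta>' n x - V x \<bullet> \<eta>' n x) \<le> norm (W x - V x) * norm (\<eta>' n x)"
          using Cauchy_Schwarz_ineq2[of "W x - V x" "\<eta>' n x"] by (simp add: inner_diff_left)
        also have "\<dots> \<le> \<epsilon> * norm (\<eta>' n x)" using VW[OF x] by (intro mult_right_mono) (auto simp: norm_minus_commute)
        finally show "norm (W x \<bullet> \<eta>' n x - V x \<bullet> \<eta>' n x) \<le> \<epsilon> * norm (\<eta>' n x)" .
      qed
      also have "\<dots> = \<epsilon> * integral\<^sup>L (lebesgue_on \<Omega>) (\<lambda>x. norm (\<eta>' n x))" by simp
      also have "\<dots> \<le> \<epsilon> * K" using bd \<open>\<epsilon> > 0\<close> by (intro mult_left_mono) auto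
      finally show ?thesis .
    qed
    have hq: "integrable (lebesgue_on \<Omega>) (\<lambda>x. h x - q x)" using h qi by (rule Bochner_Integration.integrable_diff)
    have "(\<lambda>n. integral\<^sup>L (lebesgue_on \<Omega>) (\<lambda>x. \<eta> n x * (h x - q x))) \<longlonglongrightarrow> integral\<^sup>L (lebesgue_on \<Omega>) (\<lambda>x. h x - q x)"
    proof (rule integral_dominated_convergence[where w="\<lambda>x. norm (h x - q x)"])
      show "(\<lambda>x. \<eta> n x * (h x - q x)) \<in> borel_measurable (lebesgue_on \<Omega>)" for n
        using hq cm[OF test_function_continuous(1)[OF test]] by auto
      show "AE x in lebesgue_on \<Omega>. (\<lambda>n. \<eta> n x * (h x - q x)) \<longlonglongrightarrow> h x - q x"
        using lim by (intro AE_I2) (auto intro!: tendsto_eq_intros)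
      show "AE x in lebesgue_on \<Omega>. norm (\<eta> n x * (h x - q x)) \<le> norm (h x - q x)" for n
        using \<eta>01[of n] by (intro AE_I2) (simp add: abs_mult mult_left_le_one_le)
    qed (use hq in auto)
    then have "\<bar>integral\<^sup>L (lebesgue_on \<Omega>) (\<lambda>x. h x - q x)\<bar> \<le> \<epsilon> * K"
      by (intro tendsto_upperbound[OF tendsto_rabs]) (use step in auto)
    then have "\<bar>integral\<^sup>L (lebesgue_on \<Omega>) h - integral\<^sup>L (lebesgue_on \<Omega>) q\<bar> \<le> \<epsilon> * K"
      using Bochner_Integration.integral_diff[OF h qi] by simp
    then show ?thesis using fl fluxW by (simp add: distrib_left)
  qed
  have "\<bar>flux C V - integral\<^sup>L (lebesgue_on \<Omega>) h\<bar> \<le> 0 + \<delta>" if "\<delta> > 0" for \<delta>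
  proof -
    have "L + K + 1 > 0" using L(1) K by simp
    have "\<bar>flux C V - integral\<^sup>L (lebesgue_on \<Omega>) h\<bar> \<le> \<delta> / (L + K + 1) * (L + K)"
      by (rule main) (use that \<open>L + K + 1 > 0\<close> in simp)
    also have "\<dots> \<le> \<delta>" using that L(1) K by (simp add: field_simps)
    finally show ?thesis by simp
  qed
  then have "\<bar>flux C V - integral\<^sup>L (lebesgue_on \<Omega>) h\<bar> \<le> 0" by (rule field_le_epsilon)
  then show ?thesis by simp
qed

section \<open>Divergence-free potential fields with a collinearity condition\<close>

definition from_complex :: "complex \<Rightarrow> plane" where
  "from_complex z = vector [Re z, Im z]"

lemma from_complex_simps [simp]: "from_complex z $ 1 = Re z" "from_complex z $ 2 = Im z"
  "to_complex (from_complex z) = z" "from_complex (to_complex x) = x"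
  by (simp_all add: from_complex_def to_complex_def vec_eq_iff forall_2)

lemma bounded_linear_from_complex: "bounded_linear from_complex"
  by (rule bounded_linear_intro[where K=1])
     (simp_all add: vec_eq_iff forall_2 flip: norm_to_complex)

lemma plane_eq_axes: "(h :: plane) = h $ 1 *\<^sub>R axis 1 1 + h $ 2 *\<^sub>R axis 2 1"
  by (simp add: vec_eq_iff forall_2 axis_def)

text \<open>The mean value theorem is applied to \<open>s \<mapsto> \<phi> (x + h b + s a) - \<phi> (x + s a)\<close>, and the gradient is
  expanded to first order at \<open>x\<close>.\<close>

lemma second_difference_estimate:
  fixes \<phi> :: "plane \<Rightarrow> real" and \<tau> :: "plane \<Rightarrow> plane"
  assumes O: "open \<Omega>" "x \<in> \<Omega>" and pot: "\<And>y. y \<in> \<Omega> \<Longrightarrow> GDERIV \<phi> y :> \<tau> y"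
    and D: "(\<tau> has_derivative D) (at x)" and "\<epsilon> > 0"
  shows "\<exists>\<delta>>0. \<forall>h. 0 < h \<and> h < \<delta> \<longrightarrow>
     \<bar>\<phi> (x + h *\<^sub>R a + h *\<^sub>R b) - \<phi> (x + h *\<^sub>R a) - \<phi> (x + h *\<^sub>R b) + \<phi> x - h\<^sup>2 * (D b \<bullet> a)\<bar>
       \<le> \<epsilon> * h\<^sup>2 * ((2 * norm a + norm b) * norm a)"
proof -
  obtain d1 where d1: "d1 > 0" "ball x d1 \<subseteq> \<Omega>" using O open_contains_ball by blast
  obtain d2 where d2: "d2 > 0" "\<And>y. norm (y - x) < d2 \<Longrightarrow> norm (\<tau> y - \<tau> x - D (y - x)) \<le> \<epsilon> * norm (y - x)"
    using D \<open>\<epsilon> > 0\<close> unfolding has_derivative_at_alt by blast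
  have lin: "bounded_linear D" using D by (rule has_derivative_bounded_linear)
  define N where "N = norm a + norm b + 1"
  have N: "N > 0" by (simp add: N_def add_nonneg_pos)
  define \<delta> where "\<delta> = min d1 d2 / N"
  have "\<delta> > 0" using d1 d2 N by (simp add: \<delta>_def)
  moreover have "\<bar>\<phi> (x + h *\<^sub>R a + h *\<^sub>R b) - \<phi> (x + h *\<^sub>R a) - \<phi> (x + h *\<^sub>R b) + \<phi> x - h\<^sup>2 * (D b \<bullet> a)\<bar>
       \<le> \<epsilon> * h\<^sup>2 * ((2 * norm a + norm b) * norm a)" if h: "0 < h" "h < \<delta>" for h
  proof -
    have hN: "h * N < min d1 d2" using h N by (simp add: \<delta>_def pos_less_divide_eq)
    have small: "norm (s *\<^sub>R a + k *\<^sub>R b) < min d1 d2" if "0 \<le> s" "s \<le> h" "0 \<le> k" "k \<le> h" for s k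
    proof -
      have "norm (s *\<^sub>R a + k *\<^sub>R b) \<le> s * norm a + k * norm b"
        using norm_triangle_ineq[of "s *\<^sub>R a" "k *\<^sub>R b"] that by simp
      also have "\<dots> \<le> h * norm a + h * norm b" using that by (intro add_mono mult_right_mono) auto
      also have "\<dots> \<le> h * N" using h unfolding N_def by (simp add: algebra_simps)
      finally show ?thesis using hN by linarith
    qed
    define G where "G = (\<lambda>s. \<phi> (x + h *\<^sub>R b + s *\<^sub>R a) - \<phi> (x + s *\<^sub>R a))"
    have der: "(G has_real_derivative (a \<bullet> \<tau> (x + h *\<^sub>R b + s *\<^sub>R a) - a \<bullet> \<tau> (x + s *\<^sub>R a))) (at s)" if s: "0 \<le> s" "s \<le> h" for s
    proof -
      have *: "((\<lambda>s. \<phi> (y + s *\<^sub>R a)) has_real_derivative (a \<bullet> \<tau> (y + s *\<^sub>R a))) (at s)" if y: "y + s *\<^sub>R a \<in> \<Omega>" for y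
      proof -
        have "((\<lambda>t. \<phi> (y + s *\<^sub>R a + t *\<^sub>R a)) has_real_derivative (a \<bullet> \<tau> (y + s *\<^sub>R a))) (at 0)"
          by (rule GDERIV_along_line[OF pot[OF y]])
        then have "((\<lambda>t. \<phi> (y + (s + t) *\<^sub>R a)) has_real_derivative (a \<bullet> \<tau> (y + s *\<^sub>R a))) (at 0)"
          by (simp add: scaleR_add_left add.assoc)
        then show ?thesis using DERIV_shift[of "\<lambda>s. \<phi> (y + s *\<^sub>R a)" _ 0 s] by (simp add: add.commute)
      qed
      have "x + h *\<^sub>R b + s *\<^sub>R a \<in> ball x d1" "x + s *\<^sub>R a \<in> ball x d1"
        using small[of s h] small[of s 0] s h by (auto simp: dist_norm add.commute norm_minus_commute add.assoc)
      then show ?thesis unfolding G_def using d1(2) by (intro DERIV_diff *) auto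
    qed
    obtain s where s: "0 < s" "s < h" "G h - G 0 = h * (a \<bullet> \<tau> (x + h *\<^sub>R b + s *\<^sub>R a) - a \<bullet> \<tau> (x + s *\<^sub>R a))"
      using MVT2[OF h(1) der] by auto
    let ?u = "h *\<^sub>R b + s *\<^sub>R a" and ?v = "s *\<^sub>R a"
    have 1: "norm (\<tau> (x + ?u) - \<tau> x - D ?u) \<le> \<epsilon> * norm ?u" "norm (\<tau> (x + ?v) - \<tau> x - D ?v) \<le> \<epsilon> * norm ?v"
      using d2(2)[of "x + ?u"] d2(2)[of "x + ?v"] small[of s h] small[of s 0] s h by (auto simp: add.commute)
    have Dl: "D ?u - D ?v = h *\<^sub>R D b" using lin by (simp add: linear_add linear_cmul bounded_linear.linear)
    have "a \<bullet> \<tau> (x + h *\<^sub>R b + s *\<^sub>R a) - a \<bullet> \<tau> (x + s *\<^sub>R a) - h * (D b \<bullet> a)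
       = a \<bullet> ((\<tau> (x + ?u) - \<tau> x - D ?u) - (\<tau> (x + ?v) - \<tau> x - D ?v))"
    proof -
      have "a \<bullet> ((\<tau> (x + ?u) - \<tau> x - D ?u) - (\<tau> (x + ?v) - \<tau> x - D ?v)) = a \<bullet> \<tau> (x + ?u) - a \<bullet> \<tau> (x + ?v) - a \<bullet> (D ?u - D ?v)"
        by (simp add: inner_diff_right inner_add_right algebra_simps)
      then show ?thesis unfolding Dl by (simp add: inner_commute add.assoc)
    qed
    also have "\<bar>\<dots>\<bar> \<le> norm a * norm ((\<tau> (x + ?u) - \<tau> x - D ?u) - (\<tau> (x + ?v) - \<tau> x - D ?v))"
      by (rule Cauchy_Schwarz_ineq2)
    also have "\<dots> \<le> norm a * (\<epsilon> * norm ?u + \<epsilon> * norm ?v)"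
      using norm_triangle_ineq4[of "\<tau> (x + ?u) - \<tau> x - D ?u" "\<tau> (x + ?v) - \<tau> x - D ?v"] 1 by (intro mult_left_mono) auto
    also have "\<dots> \<le> norm a * (\<epsilon> * (h * norm b + h * norm a) + \<epsilon> * (h * norm a))"
    proof -
      have "norm ?v \<le> h * norm a" using s by (simp add: mult_right_mono)
      moreover have "norm ?u \<le> h * norm b + norm ?v" using norm_triangle_ineq[of "h *\<^sub>R b" ?v] h by simp
      ultimately show ?thesis using \<open>\<epsilon> > 0\<close> by (intro mult_left_mono add_mono) auto
    qed
    also have "\<dots> = \<epsilon> * h * ((2 * norm a + norm b) * norm a)" by (simp add: algebra_simps)
    finally have 2: "\<bar>a \<bullet> \<tau> (x + h *\<^sub>R b + s *\<^sub>R a) - a \<bullet> \<tau> (x + s *\<^sub>R a) - h * (D b \<bullet> a)\<bar> \<le> \<epsilon> * h * ((2 * norm a + norm b) * norm a)" .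
    have "\<phi> (x + h *\<^sub>R a + h *\<^sub>R b) - \<phi> (x + h *\<^sub>R a) - \<phi> (x + h *\<^sub>R b) + \<phi> x = G h - G 0"
      by (simp add: G_def add_ac)
    then have "\<phi> (x + h *\<^sub>R a + h *\<^sub>R b) - \<phi> (x + h *\<^sub>R a) - \<phi> (x + h *\<^sub>R b) + \<phi> x - h\<^sup>2 * (D b \<bullet> a)
       = h * (a \<bullet> \<tau> (x + h *\<^sub>R b + s *\<^sub>R a) - a \<bullet> \<tau> (x + s *\<^sub>R a) - h * (D b \<bullet> a))"
      unfolding s(3) by (simp add: algebra_simps power2_eq_square)
    then have "\<bar>\<phi> (x + h *\<^sub>R a + h *\<^sub>R b) - \<phi> (x + h *\<^sub>R a) - \<phi> (x + h *\<^sub>R b) + \<phi> x - h\<^sup>2 * (D b \<bullet> a)\<bar>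
       = h * \<bar>a \<bullet> \<tau> (x + h *\<^sub>R b + s *\<^sub>R a) - a \<bullet> \<tau> (x + s *\<^sub>R a) - h * (D b \<bullet> a)\<bar>"
      using h by (simp add: abs_mult)
    also have "\<dots> \<le> h * (\<epsilon> * h * ((2 * norm a + norm b) * norm a))"
      using 2 h by (intro mult_left_mono) auto
    finally show ?thesis by (simp add: power2_eq_square mult_ac)
  qed
  ultimately show ?thesis by blast
qed

text \<open>Schwarz's theorem for a gradient that is differentiable, but possibly not continuously so: the
  second difference quotient is symmetric in \<open>a\<close> and \<open>b\<close>, and it tends to both sides of the claim.\<close>

lemma potential_derivative_symmetric:
  fixes \<phi> :: "plane \<Rightarrow> real" and \<tau> :: "plane \<Rightarrow> plane"
  assumes O: "open \<Omega>" "x \<in> \<Omega>" and pot: "\<And>y. y \<in> \<Omega> \<Longrightarrow> GDERIV \<phi> y :> \<tau> y"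
    and D: "(\<tau> has_derivative D) (at x)"
  shows "D b \<bullet> a = D a \<bullet> b"
proof -
  define M where "M = (2 * norm a + norm b) * norm a + (2 * norm b + norm a) * norm b"
  have "M \<ge> 0" by (simp add: M_def)
  have "\<bar>D b \<bullet> a - D a \<bullet> b\<bar> \<le> 0 + e" if "e > 0" for e
  proof -
    define \<epsilon> where "\<epsilon> = e / (M + 1)"
    have \<epsilon>: "\<epsilon> > 0" using that \<open>M \<ge> 0\<close> by (simp add: \<epsilon>_def)
    obtain d1 where d1: "d1 > 0" "\<And>h. 0 < h \<Longrightarrow> h < d1 \<Longrightarrow>
       \<bar>\<phi> (x + h *\<^sub>R a + h *\<^sub>R b) - \<phi> (x + h *\<^sub>R a) - \<phi> (x + h *\<^sub>R b) + \<phi> x - h\<^sup>2 * (D b \<bullet> a)\<bar> \<le> \<epsilon> * h\<^sup>2 * ((2 * norm a + norm b) * norm a)"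
      using second_difference_estimate[OF O pot D \<epsilon>, of a b] by blast
    obtain d2 where d2: "d2 > 0" "\<And>h. 0 < h \<Longrightarrow> h < d2 \<Longrightarrow>
       \<bar>\<phi> (x + h *\<^sub>R b + h *\<^sub>R a) - \<phi> (x + h *\<^sub>R b) - \<phi> (x + h *\<^sub>R a) + \<phi> x - h\<^sup>2 * (D a \<bullet> b)\<bar> \<le> \<epsilon> * h\<^sup>2 * ((2 * norm b + norm a) * norm b)"
      using second_difference_estimate[OF O pot D \<epsilon>, of b a] by blast
    define h where "h = min d1 d2 / 2"
    have h: "0 < h" "h < d1" "h < d2" using d1 d2 by (auto simp: h_def)
    have sw: "x + h *\<^sub>R b + h *\<^sub>R a = x + h *\<^sub>R a + h *\<^sub>R b" by (simp add: add_ac)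
    have "\<bar>h\<^sup>2 * (D b \<bullet> a) - h\<^sup>2 * (D a \<bullet> b)\<bar> \<le> \<epsilon> * h\<^sup>2 * ((2 * norm a + norm b) * norm a) + \<epsilon> * h\<^sup>2 * ((2 * norm b + norm a) * norm b)"
      using d1(2)[OF h(1,2)] d2(2)[OF h(1,3)] unfolding sw by linarith
    then have "h\<^sup>2 * \<bar>D b \<bullet> a - D a \<bullet> b\<bar> \<le> h\<^sup>2 * (\<epsilon> * M)"
      unfolding right_diff_distrib[symmetric] abs_mult M_def by (simp add: algebra_simps)
    then have "\<bar>D b \<bullet> a - D a \<bullet> b\<bar> \<le> \<epsilon> * M" using h by simp
    also have "\<dots> \<le> e" using that \<open>M \<ge> 0\<close> by (simp add: \<epsilon>_def field_simps)
    finally show ?thesis by simp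
  qed
  then have "\<bar>D b \<bullet> a - D a \<bullet> b\<bar> \<le> 0" by (rule field_le_epsilon)
  then show ?thesis by simp
qed

text \<open>Where \<open>f \<noteq> 0\<close> the function \<open>f' / f\<^sup>2 = - (1 / f)'\<close> has the argument of \<open>f' (cnj f)\<^sup>2\<close>, so it is
  real, hence constant by the open mapping theorem, and \<open>1 / f\<close> is affine with a real slope. An
  isolated zero of \<open>f\<close> is impossible, as \<open>1 / f\<close> would be affine near it and therefore bounded.\<close>

lemma holomorphic_reciprocal_linear:
  assumes S: "open S" "connected S" and hol: "f holomorphic_on S"
    and real: "\<And>z. z \<in> S \<Longrightarrow> Im (deriv f z * (cnj (f z))\<^sup>2) = 0"
  shows "(\<forall>z\<in>S. f z = 0) \<or> (\<exists>c d. \<forall>z\<in>S. f z * (d - of_real c * z) = 1)"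
proof -
  have linear: "\<exists>c d. \<forall>z\<in>U. f z * (d - of_real c * z) = 1"
    if U: "open U" "connected U" "U \<subseteq> S" "U \<noteq> {}" "\<And>z. z \<in> U \<Longrightarrow> f z \<noteq> 0" for U
  proof -
    have holU: "f holomorphic_on U" using hol U(3) holomorphic_on_subset by blast
    \<comment> \<open>The negative of the derivative of \<open>1 / f\<close>.\<close>
    define q where "q = (\<lambda>z. deriv f z / (f z)\<^sup>2)"
    have qh: "q holomorphic_on U" unfolding q_def using U holU
      by (intro holomorphic_intros holomorphic_deriv) auto
    have qr: "Im (q z) = 0" if "z \<in> U" for z
    proof -
      have fz: "f z \<noteq> 0" using U(5) that by blast
      have "(f z)\<^sup>2 * (cnj (f z))\<^sup>2 = (of_real ((norm (f z))\<^sup>2))\<^sup>2"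
        by (simp only: complex_norm_square power_mult_distrib)
      then have "q z = deriv f z * (cnj (f z))\<^sup>2 / of_real (((norm (f z))\<^sup>2)\<^sup>2)"
        unfolding q_def using fz by (simp add: field_simps)
      moreover have "Im (deriv f z * (cnj (f z))\<^sup>2) = 0" using real that U(3) by blast
      ultimately show ?thesis by (simp only: Im_divide_of_real)
    qed
    have "q constant_on U"
    proof (rule ccontr)
      assume "\<not> q constant_on U"
      then have "open (q ` U)" using open_mapping_thm[OF qh U(1,2) U(1) subset_refl] by blast
      moreover obtain z where "z \<in> U" using U(4) by blast
      ultimately obtain e where e: "e > 0" "ball (q z) e \<subseteq> q ` U" by (meson imageI open_contains_ball)
      have "q z + \<i> * of_real (e / 2) \<in> ball (q z) e" using e(1) by (simp add: dist_norm norm_mult)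
      then obtain w where "w \<in> U" "q w = q z + \<i> * of_real (e / 2)" using e(2) by auto
      then have "Im (q w) = Im (q z) + e / 2" by simp
      then show False using qr[OF \<open>w \<in> U\<close>] qr[OF \<open>z \<in> U\<close>] e(1) by simp
    qed
    then obtain k where k: "\<And>z. z \<in> U \<Longrightarrow> q z = k" unfolding constant_on_def by blast
    obtain z0 where z0: "z0 \<in> U" using U(4) by blast
    have kr: "k = of_real (Re k)" using qr[OF z0] k[OF z0] by (simp add: complex_eq_iff)
    have "((\<lambda>z. inverse (f z) + k * z) has_field_derivative 0) (at z)" if "z \<in> U" for z
    proof -
      have fz: "f z \<noteq> 0" using U(5) that by blast
      have "(f has_field_derivative deriv f z) (at z)" using holU U(1) that by (simp add: holomorphic_derivI)
      moreover have "deriv f z = k * (f z)\<^sup>2" using k[OF that] fz by (simp add: q_def field_simps)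
      ultimately show ?thesis using fz by (auto intro!: derivative_eq_intros simp: power2_eq_square)
    qed
    then have der: "\<And>z. z \<in> U \<Longrightarrow> ((\<lambda>z. inverse (f z) + k * z) has_field_derivative 0) (at z)" .
    then have "continuous_on U (\<lambda>z. inverse (f z) + k * z)"
      by (meson DERIV_isCont continuous_at_imp_continuous_on)
    then obtain d where d: "\<And>z. z \<in> U \<Longrightarrow> inverse (f z) + k * z = d"
      using DERIV_zero_connected_constant[OF U(2,1) finite.emptyI] der by blast
    have "f z * (d - of_real (Re k) * z) = 1" if "z \<in> U" for z
    proof -
      have "d - of_real (Re k) * z = inverse (f z)" using d[OF that] unfolding kr[symmetric] by (simp add: algebra_simps)
      then show ?thesis using U(5)[OF that] by simp
    qed
    then show ?thesis by blast
  qed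
  show ?thesis
  proof (cases "\<forall>z\<in>S. f z = 0")
    case False
    then obtain b where b: "b \<in> S" "f b \<noteq> 0" by blast
    have nz: "f z \<noteq> 0" if z: "z \<in> S" for z
    proof
      assume fz: "f z = 0"
      obtain r where r: "0 < r" "ball z r \<subseteq> S" "\<And>w. w \<in> ball z r - {z} \<Longrightarrow> f w \<noteq> 0"
        using isolated_zeros[OF hol S z fz b] by blast
      let ?U = "ball z r - {z}"
      have "connected ?U" by (rule connected_punctured_ball) simp
      moreover have "?U \<noteq> {}"
      proof -
        have "z + of_real (r/2) \<in> ?U" using r(1) by (simp add: dist_norm)
        then show ?thesis by blast
      qed
      ultimately obtain c d where cd: "\<And>w. w \<in> ?U \<Longrightarrow> f w * (d - of_real c * w) = 1"
        using linear[of ?U] r by (metis Diff_subset open_ball open_delete order_trans)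
      have "isCont f z" using hol S(1) z holomorphic_on_imp_continuous_on continuous_on_eq_continuous_at by blast
      then have "isCont (\<lambda>w. f w * (d - of_real c * w)) z" by (intro continuous_intros)
      then have "((\<lambda>w. f w * (d - of_real c * w)) \<longlongrightarrow> 0) (at z)" using fz by (simp add: isCont_def)
      moreover have "\<forall>\<^sub>F w in at z. f w * (d - of_real c * w) = 1"
        using cd r(1) unfolding eventually_at by (intro exI[of _ r]) (auto simp: dist_commute)
      ultimately have "((\<lambda>w. 1) \<longlongrightarrow> (0::complex)) (at z)" by (rule Lim_transform_eventually)
      then show False by (simp add: tendsto_const_iff)
    qed
    then show ?thesis using linear[of S] S b by blast
  qed simp
qed

text \<open>The symmetry of the derivative of \<open>\<tau>\<close> and its vanishing trace are the Cauchy--Riemann equations of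
  \<open>\<tau>\<^sub>1 - i \<tau>\<^sub>2\<close>.\<close>

lemma potential_divergence_free_holomorphic:
  fixes \<phi> :: "plane \<Rightarrow> real" and \<tau> :: "plane \<Rightarrow> plane"
  assumes O: "open \<Omega>" and pot: "\<And>y. y \<in> \<Omega> \<Longrightarrow> GDERIV \<phi> y :> \<tau> y"
    and div: "\<And>x. x \<in> \<Omega> \<Longrightarrow> \<exists>D. (\<tau> has_derivative D) (at x) \<and> (\<Sum>i\<in>UNIV. D (axis i 1) $ i) = 0"
    and f: "f = (\<lambda>z. cnj (to_complex (\<tau> (from_complex z))))" and S: "S = from_complex -` \<Omega>"
  shows "open S" "f holomorphic_on S"
    "\<And>x. x \<in> \<Omega> \<Longrightarrow> (\<tau> has_derivative (\<lambda>h. from_complex (cnj (deriv f (to_complex x) * to_complex h)))) (at x)"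
proof -
  show oS: "open S" unfolding S
    using O bounded_linear.continuous_on[OF bounded_linear_from_complex continuous_on_id] by (rule open_vimage)
  have key: "\<exists>A. (f has_field_derivative A) (at (to_complex x)) \<and> (\<tau> has_derivative (\<lambda>h. from_complex (cnj (A * to_complex h)))) (at x)"
    if x: "x \<in> \<Omega>" for x
  proof -
    obtain D where D: "(\<tau> has_derivative D) (at x)" "(\<Sum>i\<in>UNIV. D (axis i 1) $ i) = 0" using div[OF x] by blast
    define a where "a = D (axis 1 1) $ 1"
    define b where "b = D (axis 1 1) $ 2"
    have "D (axis 2 1) \<bullet> axis 1 1 = D (axis 1 1) \<bullet> axis 2 1"
      by (rule potential_derivative_symmetric[OF O x pot D(1)])
    then have b2: "D (axis 2 1) $ 1 = b" by (simp add: b_def inner_axis)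
    have a2: "D (axis 2 1) $ 2 = - a" using D(2) by (simp add: sum_2 a_def)
    define A where "A = Complex a (- b)"
    have lin: "linear D" using D(1) has_derivative_linear by blast
    have Dh: "D h = from_complex (cnj (A * to_complex h))" for h
    proof -
      have "D h = h $ 1 *\<^sub>R D (axis 1 1) + h $ 2 *\<^sub>R D (axis 2 1)"
      proof -
        have "D h = D (h $ 1 *\<^sub>R axis 1 1 + h $ 2 *\<^sub>R axis 2 1)" by (rule arg_cong[OF plane_eq_axes])
        then show ?thesis by (simp only: linear_add[OF lin] linear_cmul[OF lin])
      qed
      then show ?thesis using a2 b2 by (simp add: vec_eq_iff forall_2 A_def flip: a_def b_def)
    qed
    have "((\<lambda>z. \<tau> (from_complex z)) has_derivative (\<lambda>k. D (from_complex k))) (at (to_complex x))"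
      using has_derivative_compose[OF bounded_linear_imp_has_derivative[OF bounded_linear_from_complex], of \<tau> D "to_complex x" UNIV] D(1) by simp
    from bounded_linear.has_derivative[OF bounded_linear_compose[OF bounded_linear_cnj bounded_linear_to_complex] this]
    have "(f has_derivative (\<lambda>k. cnj (to_complex (D (from_complex k))))) (at (to_complex x))"
      unfolding f by (simp add: comp_def)
    then have "(f has_derivative (*) A) (at (to_complex x))" by (simp add: Dh)
    then have "(f has_field_derivative A) (at (to_complex x))" by (simp add: has_field_derivative_def)
    moreover have "D = (\<lambda>h. from_complex (cnj (A * to_complex h)))" using Dh by auto
    ultimately show ?thesis using D(1) by blast
  qed
  show "f holomorphic_on S"
  proof (rule holomorphic_onI)
    fix z assume "z \<in> S"
    then have "from_complex z \<in> \<Omega>" by (simp add: S)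
    from key[OF this] show "f field_differentiable at z within S"
      by (metis field_differentiable_at_within field_differentiable_def from_complex_simps(3))
  qed
  show "(\<tau> has_derivative (\<lambda>h. from_complex (cnj (deriv f (to_complex x) * to_complex h)))) (at x)" if "x \<in> \<Omega>" for x
    using key[OF that] DERIV_imp_deriv by blast
qed

lemma GDERIV_components:
  fixes \<tau> :: "plane \<Rightarrow> plane"
  assumes "(\<tau> has_derivative (\<lambda>h. from_complex (cnj (A * to_complex h)))) (at x)"
  shows "GDERIV (\<lambda>x. \<tau> x $ 1) x :> from_complex (cnj A)"
    "GDERIV (\<lambda>x. \<tau> x $ 2) x :> from_complex (- \<i> * cnj A)"
proof -
  have i: "h \<bullet> k = h $ 1 * k $ 1 + h $ 2 * k $ 2" for h k :: plane by (simp add: inner_vec_def sum_2)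
  have "((\<lambda>x. \<tau> x $ i) has_derivative (\<lambda>h. from_complex (cnj (A * to_complex h)) $ i)) (at x)" for i
    using bounded_linear.has_derivative[OF bounded_linear_vec_nth assms] .
  from this[of 1] this[of 2] show "GDERIV (\<lambda>x. \<tau> x $ 1) x :> from_complex (cnj A)"
    "GDERIV (\<lambda>x. \<tau> x $ 2) x :> from_complex (- \<i> * cnj A)"
    unfolding gderiv_def i by (simp_all add: algebra_simps)
qed

text \<open>Differentiating the relation between \<open>\<zeta>\<close> and \<open>|\<tau>|\<^sup>2 / 2\<close> shows that the gradient of the latter is a
  multiple of that of \<open>\<zeta>\<close>, hence collinear with \<open>\<tau>\<close>. With \<open>A\<close> the complex derivative of \<open>\<tau>\<^sub>1 - i \<tau>\<^sub>2\<close>,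
  this gradient is the complex number \<open>cnj (A \<tau>)\<close>, and the cross product of \<open>\<tau>\<close> with it is
  \<open>- Im (A \<tau>\<^sup>2)\<close>.\<close>

lemma collinear_gradient_condition:
  fixes \<tau> :: "plane \<Rightarrow> plane" and \<zeta> :: "plane \<Rightarrow> real"
  assumes O: "open \<Omega>" "x \<in> \<Omega>"
    and \<tau>: "(\<tau> has_derivative (\<lambda>h. from_complex (cnj (A * to_complex h)))) (at x)"
    and eq: "\<And>y. y \<in> \<Omega> \<Longrightarrow> H (\<zeta> y) = (norm (\<tau> y))\<^sup>2 / 2"
    and H: "(H has_real_derivative c) (at (\<zeta> x))"
    and \<zeta>: "GDERIV \<zeta> x :> g" and cross: "cross2 (\<tau> x) g = 0"
  shows "Im (A * (to_complex (\<tau> x))\<^sup>2) = 0"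
proof -
  let ?G = "\<tau> x $ 1 *\<^sub>R from_complex (cnj A) + \<tau> x $ 2 *\<^sub>R from_complex (- \<i> * cnj A)"
  have n: "(norm v)\<^sup>2 / 2 = (1/2) * (v $ 1 * v $ 1) + (1/2) * (v $ 2 * v $ 2)" for v :: plane
    unfolding power2_norm_eq_inner by (simp add: inner_vec_def sum_2)
  note c1 = GDERIV_components(1)[OF \<tau>] and c2 = GDERIV_components(2)[OF \<tau>]
  have "GDERIV (\<lambda>x. (1/2) * (\<tau> x $ 1 * \<tau> x $ 1) + (1/2) * (\<tau> x $ 2 * \<tau> x $ 2)) x :> ?G"
    by (rule GDERIV_subst[OF GDERIV_add[OF GDERIV_mult[OF GDERIV_const GDERIV_mult[OF c1 c1]] GDERIV_mult[OF GDERIV_const GDERIV_mult[OF c2 c2]]]])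
       (simp add: scaleR_add_left[symmetric])
  then have "((\<lambda>y. (norm (\<tau> y))\<^sup>2 / 2) has_derivative (\<lambda>h. h \<bullet> ?G)) (at x)"
    unfolding n gderiv_def .
  moreover have "((\<lambda>y. (norm (\<tau> y))\<^sup>2 / 2) has_derivative (\<lambda>h. h \<bullet> (c *\<^sub>R g))) (at x)"
  proof (rule has_derivative_transform_within_open[OF _ O])
    show "((\<lambda>y. H (\<zeta> y)) has_derivative (\<lambda>h. h \<bullet> (c *\<^sub>R g))) (at x)"
      using GDERIV_DERIV_compose[OF \<zeta> H] by (simp add: gderiv_def)
  qed (use eq in simp)
  ultimately have "(\<lambda>h. h \<bullet> ?G) = (\<lambda>h. h \<bullet> (c *\<^sub>R g))" by (rule has_derivative_unique)
  then have "?G = c *\<^sub>R g" by (metis inner_commute vector_eq_ldot)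
  then have "cross2 (\<tau> x) ?G = c * cross2 (\<tau> x) g" by (simp add: cross2_def algebra_simps)
  then show ?thesis using cross by (simp add: cross2_def power2_eq_square algebra_simps)
qed

text \<open>With \<open>q = |d - c x|\<^sup>2\<close> one has \<open>\<tau> = (d - c x) / q\<close> and \<open>|\<tau>|\<^sup>2 = 1 / q\<close>, so any multiple of \<open>\<tau>\<close> by a
  function of \<open>|\<tau>|\<close> is a function of \<open>q\<close> times the gradient of \<open>q\<close> if \<open>c \<noteq> 0\<close>, and constant if
  \<open>c = 0\<close>. The primitive is therefore a function of \<open>q\<close>, respectively linear, and it is single valued
  whatever the topology of \<open>\<Omega>\<close>.\<close>

lemma radial_primitive:
  fixes \<tau> :: "plane \<Rightarrow> plane" and Z :: "real \<Rightarrow> real"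
  assumes \<Omega>: "bounded \<Omega>" "\<Omega> \<noteq> {}" and \<tau>c: "continuous_on (closure \<Omega>) \<tau>"
    and Z: "continuous_on {0..} Z" "\<And>a. a \<ge> 0 \<Longrightarrow> Z a > 0"
    and form: "(\<forall>x\<in>\<Omega>. \<tau> x = 0) \<or> (\<exists>c d. \<forall>x\<in>\<Omega>. cnj (to_complex (\<tau> x)) * (d - of_real c * to_complex x) = 1)"
  shows "\<exists>\<Phi>. continuous_on (closure \<Omega>) \<Phi> \<and> (\<forall>x\<in>\<Omega>. GDERIV \<Phi> x :> inverse (Z ((norm (\<tau> x))\<^sup>2 / 2)) *\<^sub>R \<tau> x)"
  using form
proof
  assume "\<forall>x\<in>\<Omega>. \<tau> x = 0"
  then show ?thesis by (intro exI[of _ "\<lambda>_. 0"]) (auto intro: GDERIV_const)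
next
  assume "\<exists>c d. \<forall>x\<in>\<Omega>. cnj (to_complex (\<tau> x)) * (d - of_real c * to_complex x) = 1"
  then obtain c d where cd: "\<And>x. x \<in> \<Omega> \<Longrightarrow> cnj (to_complex (\<tau> x)) * (d - of_real c * to_complex x) = 1" by blast
  define p where "p = from_complex d"
  define q where "q = (\<lambda>x. (norm (p - c *\<^sub>R x))\<^sup>2)"
  have rep: "\<tau> x = inverse (q x) *\<^sub>R (p - c *\<^sub>R x)" "q x * (norm (\<tau> x))\<^sup>2 = 1" if x: "x \<in> \<Omega>" for x
  proof -
    define w where "w = d - of_real c * to_complex x"
    have wp: "w = to_complex (p - c *\<^sub>R x)" by (simp add: w_def p_def)
    have nw: "norm w = norm (p - c *\<^sub>R x)" unfolding wp by (rule norm_to_complex)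
    have one: "cnj (to_complex (\<tau> x)) * w = 1" using cd[OF x] by (simp add: w_def)
    have "norm (cnj (to_complex (\<tau> x)) * w) = 1" unfolding one by simp
    then have "norm (\<tau> x) * norm w = 1" by (simp add: norm_mult)
    then have "(norm (\<tau> x) * norm w)\<^sup>2 = 1" by simp
    then show qn: "q x * (norm (\<tau> x))\<^sup>2 = 1" by (simp add: q_def nw power_mult_distrib mult.commute)
    have "to_complex (\<tau> x) * cnj w = 1" using arg_cong[OF one, of cnj] by simp
    then have "to_complex (\<tau> x) * (w * cnj w) = w" by (metis mult.left_commute mult.right_neutral)
    moreover have "w * cnj w = of_real (q x)" unfolding q_def nw[symmetric] by (rule complex_norm_square[symmetric])
    ultimately have "to_complex (\<tau> x) * of_real (q x) = w" by simp
    moreover have "q x \<noteq> 0" using qn by auto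
    ultimately have "to_complex (\<tau> x) = of_real (inverse (q x)) * w" by (simp add: field_simps)
    also have "\<dots> = to_complex (inverse (q x) *\<^sub>R (p - c *\<^sub>R x))" unfolding wp by simp
    finally show "\<tau> x = inverse (q x) *\<^sub>R (p - c *\<^sub>R x)" by (metis from_complex_simps(4))
  qed
  show ?thesis
  proof (cases "c = 0")
    case True
    define t0 where "t0 = inverse ((norm p)\<^sup>2) *\<^sub>R p"
    have t: "\<tau> x = t0" if "x \<in> \<Omega>" for x using rep(1)[OF that] True by (simp add: t0_def q_def)
    let ?v = "inverse (Z ((norm t0)\<^sup>2 / 2)) *\<^sub>R t0"
    have "GDERIV (\<lambda>x. x \<bullet> ?v) x :> ?v" for x unfolding gderiv_def by (auto intro!: derivative_eq_intros)
    then show ?thesis using t by (intro exI[of _ "\<lambda>x. x \<bullet> ?v"]) (auto intro!: continuous_intros)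
  next
    case False
    have qc: "continuous_on T q" for T unfolding q_def by (intro continuous_intros)
    have cc: "compact (closure \<Omega>)" using \<Omega>(1) by simp
    obtain M where M: "M > 0" "\<And>x. x \<in> closure \<Omega> \<Longrightarrow> norm (\<tau> x) \<le> M"
      using compact_imp_bounded[OF compact_continuous_image[OF \<tau>c cc]] unfolding bounded_pos by blast
    obtain Q where Q: "\<And>x. x \<in> closure \<Omega> \<Longrightarrow> q x \<le> Q"
    proof -
      have "bounded (q ` closure \<Omega>)" using compact_imp_bounded[OF compact_continuous_image[OF qc cc]] .
      then obtain B where "\<forall>x\<in>closure \<Omega>. norm (q x) \<le> B" unfolding bounded_iff by blast
      then show ?thesis using that[of B] by fastforce
    qed
    \<comment> \<open>A bound on \<open>\<tau>\<close> keeps \<open>q\<close> away from its zero, also on the closure.\<close>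
    define m where "m = 1 / M\<^sup>2"
    have m0: "m > 0" using M(1) by (simp add: m_def)
    have "m \<le> q x" if x: "x \<in> \<Omega>" for x
    proof -
      have "norm (\<tau> x) \<le> M" using M(2) x closure_subset by blast
      then have "(norm (\<tau> x))\<^sup>2 \<le> M\<^sup>2" by (intro power_mono) auto
      moreover have "q x \<ge> 0" by (simp add: q_def)
      ultimately have "1 \<le> q x * M\<^sup>2" using rep(2)[OF x] mult_left_mono[of "(norm (\<tau> x))\<^sup>2" "M\<^sup>2" "q x"] by simp
      then show ?thesis using M(1) by (simp add: m_def field_simps)
    qed
    then have mq: "m \<le> q x" if "x \<in> closure \<Omega>" for x
      using continuous_ge_on_closure[OF qc that] by blast
    \<comment> \<open>Chosen such that \<open>k (q x)\<close> times the gradient \<open>- 2 c (p - c x)\<close> of \<open>q\<close> is the field in question.\<close>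
    define k where "k = (\<lambda>r. - 1 / (2 * c * r * Z (inverse r / 2)))"
    let ?I = "{m/2..Q+1}"
    have "continuous_on ?I (\<lambda>r. Z (inverse r / 2))"
      by (rule continuous_on_compose2[OF Z(1)]) (use m0 in \<open>auto intro!: continuous_intros\<close>)
    then have "continuous_on ?I k" unfolding k_def
    proof (intro continuous_intros)
      show "\<forall>r\<in>?I. 2 * c * r * Z (inverse r / 2) \<noteq> 0"
      proof
        fix r assume "r \<in> ?I"
        then have r: "r > 0" using m0 by auto
        then have "Z (inverse r / 2) > 0" by (intro Z(2)) simp
        then show "2 * c * r * Z (inverse r / 2) \<noteq> 0" using r False by simp
      qed
    qed
    then obtain G where G: "\<And>r. r \<in> ?I \<Longrightarrow> (G has_vector_derivative k r) (at r within ?I)"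
      using antiderivative_continuous by blast
    have Gc: "continuous_on ?I G" using G has_vector_derivative_continuous continuous_on_eq_continuous_within by blast
    have "continuous_on (closure \<Omega>) (\<lambda>x. G (q x))"
      by (rule continuous_on_compose2[OF Gc qc]) (use mq Q m0 in \<open>fastforce\<close>)
    moreover have "GDERIV (\<lambda>x. G (q x)) x :> inverse (Z ((norm (\<tau> x))\<^sup>2 / 2)) *\<^sub>R \<tau> x" if x: "x \<in> \<Omega>" for x
    proof -
      have xc: "x \<in> closure \<Omega>" using x closure_subset by blast
      have I: "m/2 < q x" "q x < Q + 1" using mq[OF xc] Q[OF xc] m0 by auto
      then have "(G has_vector_derivative k (q x)) (at (q x))"
        using G[of "q x"] by (simp add: at_within_Icc_at)
      then have Gd: "(G has_real_derivative k (q x)) (at (q x))" by (simp add: has_real_derivative_iff_has_vector_derivative)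
      have qd: "GDERIV q x :> (- 2 * c) *\<^sub>R (p - c *\<^sub>R x)"
        unfolding gderiv_def q_def power2_norm_eq_inner
        by (auto intro!: derivative_eq_intros simp: inner_commute algebra_simps inner_diff_left inner_diff_right)
      have q0: "q x > 0" using I m0 by linarith
      have "(norm (\<tau> x))\<^sup>2 = inverse (q x)" using rep(2)[OF x] q0 by (simp add: field_simps)
      then have Zx: "Z ((norm (\<tau> x))\<^sup>2 / 2) = Z (inverse (q x) / 2)" by simp
      have Zp: "Z (inverse (q x) / 2) > 0" using q0 by (intro Z(2)) simp
      have "k (q x) * (- 2 * c) = inverse (Z (inverse (q x) / 2)) * inverse (q x)"
        using q0 False Zp by (simp add: k_def field_simps)
      then have "k (q x) *\<^sub>R ((- 2 * c) *\<^sub>R (p - c *\<^sub>R x)) = inverse (Z ((norm (\<tau> x))\<^sup>2 / 2)) *\<^sub>R \<tau> x"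
      proof -
        assume k: "k (q x) * (- 2 * c) = inverse (Z (inverse (q x) / 2)) * inverse (q x)"
        have "inverse (Z (inverse (q x) / 2)) *\<^sub>R \<tau> x = (inverse (Z (inverse (q x) / 2)) * inverse (q x)) *\<^sub>R (p - c *\<^sub>R x)"
          by (subst rep(1)[OF x]) (rule scaleR_scaleR)
        then show ?thesis unfolding Zx scaleR_scaleR k by (rule sym)
      qed
      with GDERIV_DERIV_compose[OF qd Gd] show ?thesis by (rule GDERIV_subst)
    qed
    ultimately show ?thesis by blast
  qed
qed

section \<open>The complementary energy density\<close>

text \<open>Minus this density, with \<open>T = |\<tau>|\<^sup>2\<close>, is the integrand of the dual functional.\<close>

definition complementary :: "real \<Rightarrow> real \<Rightarrow> real \<Rightarrow> real \<Rightarrow> real" where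
  "complementary \<mu> \<nu> T z = T / (2 * z) + (z - \<mu>) * (ln ((z - \<mu>) / \<nu>) - 1) + \<nu>"

text \<open>Divided by \<open>s\<close> and written with \<open>y = \<nu> exp e / s\<close>, the inequality is \<open>ln y \<le> y - 1\<close>.\<close>

lemma exp_young:
  assumes "\<nu> > 0" "s > (0::real)"
  shows "e * s - \<nu> * exp e \<le> s * (ln (s / \<nu>) - 1)"
    "e * s - \<nu> * exp e = s * (ln (s / \<nu>) - 1) \<Longrightarrow> s = \<nu> * exp e"
proof -
  define y where "y = \<nu> * exp e / s"
  have y: "y > 0" using assms by (simp add: y_def)
  have ln_y: "ln y = e - ln (s / \<nu>)" using assms by (simp add: y_def ln_div ln_mult)
  have sy: "s * y = \<nu> * exp e" using assms by (simp add: y_def)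
  have id: "s * (ln (s / \<nu>) - 1) - (e * s - \<nu> * exp e) = s * ((y - 1) - ln y)"
    unfolding ln_y right_diff_distrib sy by (simp add: algebra_simps)
  have "0 \<le> s * ((y - 1) - ln y)" using ln_le_minus_one[OF y] assms by simp
  then show "e * s - \<nu> * exp e \<le> s * (ln (s / \<nu>) - 1)" using id by linarith
  show "s = \<nu> * exp e" if "e * s - \<nu> * exp e = s * (ln (s / \<nu>) - 1)"
  proof -
    have "s * ((y - 1) - ln y) = 0" using id that by simp
    then have "ln y = y - 1" using assms by simp
    then have "y = 1" by (rule ln_eq_minus_one[OF y])
    then show ?thesis using sy by simp
  qed
qed

text \<open>The stationarity condition of \<open>complementary \<mu> \<nu> T\<close> is \<open>dual_strain \<mu> \<nu> z = T / 2\<close>.\<close>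

definition dual_strain :: "real \<Rightarrow> real \<Rightarrow> real \<Rightarrow> real" where
  "dual_strain \<mu> \<nu> z = z\<^sup>2 * ln ((z - \<mu>) / \<nu>)"

definition dual_solution :: "real \<Rightarrow> real \<Rightarrow> real \<Rightarrow> real" where
  "dual_solution \<mu> \<nu> a = (THE z. \<mu> + \<nu> \<le> z \<and> dual_strain \<mu> \<nu> z = a)"

context
  fixes \<mu> \<nu> :: real
  assumes \<mu>: "\<mu> > 0" and \<nu>: "\<nu> > 0"
begin

lemma dual_strain_strict_mono:
  assumes "\<mu> + \<nu> \<le> x" "x < y"
  shows "dual_strain \<mu> \<nu> x < dual_strain \<mu> \<nu> y"
proof -
  have "0 \<le> ln ((x - \<mu>) / \<nu>)" using assms \<nu> by (intro ln_ge_zero) (simp add: field_simps)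
  moreover have "ln ((x - \<mu>) / \<nu>) < ln ((y - \<mu>) / \<nu>)"
    using assms \<nu> by (intro ln_less_cancel_iff[THEN iffD2]) (auto simp: divide_strict_right_mono)
  moreover have "0 < x\<^sup>2" "x\<^sup>2 < y\<^sup>2" using assms \<mu> \<nu> by (auto intro!: power_strict_mono)
  ultimately have "x\<^sup>2 * ln ((x - \<mu>) / \<nu>) \<le> x\<^sup>2 * ln ((y - \<mu>) / \<nu>)" "x\<^sup>2 * ln ((y - \<mu>) / \<nu>) < y\<^sup>2 * ln ((y - \<mu>) / \<nu>)"
    by (auto intro!: mult_left_mono mult_strict_right_mono)
  then show ?thesis unfolding dual_strain_def by linarith
qed

lemma dual_strain_continuous: "continuous_on {\<mu> + \<nu>..B} (dual_strain \<mu> \<nu>)"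
  unfolding dual_strain_def[abs_def] using \<nu> by (intro continuous_intros) auto

text \<open>A point at which \<open>dual_strain\<close> has reached \<open>a\<close>: the logarithm is at least 1 there and the square at
  least \<open>a\<close>.\<close>

definition upper where "upper a = \<mu> + \<nu> * exp 1 + a + 1"

lemma dual_strain_surj:
  assumes "0 \<le> a"
  shows "\<exists>z. \<mu> + \<nu> \<le> z \<and> z \<le> upper a \<and> dual_strain \<mu> \<nu> z = a"
proof -
  have up: "\<mu> + \<nu> \<le> upper a"
  proof -
    have "\<nu> * 1 \<le> \<nu> * exp 1" using \<nu> by (intro mult_left_mono) auto
    then show ?thesis using assms unfolding upper_def by linarith
  qed
  have "a \<le> dual_strain \<mu> \<nu> (upper a)"
  proof -
    have "1 \<le> ln ((upper a - \<mu>) / \<nu>)"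
    proof -
      have "exp 1 \<le> (upper a - \<mu>) / \<nu>" using \<nu> assms by (simp add: upper_def field_simps)
      then show ?thesis using ln_ge_iff exp_gt_zero less_le_trans by blast
    qed
    moreover have "a \<le> (upper a)\<^sup>2"
    proof -
      have "1 \<le> upper a" "a \<le> upper a" using \<mu> \<nu> assms by (auto simp: upper_def add_nonneg_nonneg)
      then have "1 * a \<le> upper a * upper a" using assms by (intro mult_mono) auto
      then show ?thesis by (simp add: power2_eq_square)
    qed
    ultimately have "a * 1 \<le> (upper a)\<^sup>2 * ln ((upper a - \<mu>) / \<nu>)" using assms by (intro mult_mono) auto
    then show ?thesis by (simp add: dual_strain_def)
  qed
  moreover have "dual_strain \<mu> \<nu> (\<mu> + \<nu>) \<le> a" using \<nu> assms by (simp add: dual_strain_def)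
  ultimately obtain z where "\<mu> + \<nu> \<le> z" "z \<le> upper a" "dual_strain \<mu> \<nu> z = a"
    using IVT'[of "dual_strain \<mu> \<nu>" "\<mu> + \<nu>" a "upper a"] up dual_strain_continuous by blast
  then show ?thesis by blast
qed

lemma dual_strain_inj:
  assumes "\<mu> + \<nu> \<le> x" "\<mu> + \<nu> \<le> y" "dual_strain \<mu> \<nu> x = dual_strain \<mu> \<nu> y"
  shows "x = y"
  using dual_strain_strict_mono[of x y] dual_strain_strict_mono[of y x] assms by (cases x y rule: linorder_cases) auto

lemma dual_solution:
  assumes "0 \<le> a"
  shows "\<mu> + \<nu> \<le> dual_solution \<mu> \<nu> a" "dual_strain \<mu> \<nu> (dual_solution \<mu> \<nu> a) = a"
proof -
  obtain z where z: "\<mu> + \<nu> \<le> z" "z \<le> upper a" "dual_strain \<mu> \<nu> z = a" using dual_strain_surj[OF assms] by blast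
  have "dual_solution \<mu> \<nu> a = z" unfolding dual_solution_def
    by (rule the_equality) (use z dual_strain_inj in auto)
  then show "\<mu> + \<nu> \<le> dual_solution \<mu> \<nu> a" "dual_strain \<mu> \<nu> (dual_solution \<mu> \<nu> a) = a"
    using z by auto
qed

text \<open>An inverse of a continuous injection is continuous on the image of a compact interval, and such
  images exhaust the half line.\<close>

lemma dual_solution_continuous: "continuous_on {0..} (dual_solution \<mu> \<nu>)"
proof -
  have loc: "continuous_on {0..A} (dual_solution \<mu> \<nu>)" for A
  proof -
    let ?I = "{\<mu> + \<nu>..upper A}"
    have "continuous_on (dual_strain \<mu> \<nu> ` ?I) (dual_solution \<mu> \<nu>)"
    proof (rule continuous_on_inv[OF dual_strain_continuous])
      show "\<forall>x\<in>?I. dual_solution \<mu> \<nu> (dual_strain \<mu> \<nu> x) = x"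
      proof
        fix x assume x: "x \<in> ?I"
        have "0 \<le> dual_strain \<mu> \<nu> x" using x \<nu> unfolding dual_strain_def
          by (intro mult_nonneg_nonneg ln_ge_zero) (auto simp: field_simps)
        then show "dual_solution \<mu> \<nu> (dual_strain \<mu> \<nu> x) = x" using dual_solution dual_strain_inj x by auto
      qed
    qed simp
    moreover have "{0..A} \<subseteq> dual_strain \<mu> \<nu> ` ?I"
    proof
      fix a assume a: "a \<in> {0..A}"
      then obtain z where "\<mu> + \<nu> \<le> z" "z \<le> upper a" "dual_strain \<mu> \<nu> z = a" using dual_strain_surj[of a] by auto
      moreover have "upper a \<le> upper A" using a by (simp add: upper_def)
      ultimately show "a \<in> dual_strain \<mu> \<nu> ` ?I" by (auto intro!: image_eqI[of _ _ z])
    qed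
    ultimately show ?thesis by (rule continuous_on_subset)
  qed
  show ?thesis unfolding continuous_on_eq_continuous_within
  proof
    fix a :: real assume "a \<in> {0..}"
    then have "continuous (at a within {0..a + 1}) (dual_solution \<mu> \<nu>)"
      using loc[of "a + 1"] by (simp add: continuous_on_eq_continuous_within)
    moreover have "at a within {0..a + 1} = at a within {0..}"
      by (rule at_within_nhd[of _ "{..<a + 1}"]) auto
    ultimately show "continuous (at a within {0..}) (dual_solution \<mu> \<nu>)" by simp
  qed
qed

text \<open>Stationarity means \<open>T = 2 z\<^sup>2 e\<close> with \<open>e = ln ((z - \<mu>) / \<nu>)\<close>. Estimate the two terms of the density
  at \<open>y\<close> separately: \<open>z\<^sup>2 / y \<ge> 2 z - y\<close>, and Young's inequality at the strain energy \<open>e\<close>. The lower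
  bounds add up to the value at \<open>z\<close>, and the equality case of the second one gives uniqueness.\<close>

lemma complementary_minimal:
  assumes z: "\<mu> + \<nu> \<le> z" "dual_strain \<mu> \<nu> z = T / 2" and y: "\<mu> + \<nu> \<le> y"
  shows "complementary \<mu> \<nu> T z \<le> complementary \<mu> \<nu> T y"
    "complementary \<mu> \<nu> T z = complementary \<mu> \<nu> T y \<Longrightarrow> y = z"
proof -
  define e where "e = ln ((z - \<mu>) / \<nu>)"
  have pos: "z > 0" "y > 0" "z - \<mu> > 0" "y - \<mu> > 0" using z y \<mu> \<nu> by auto
  have e0: "e \<ge> 0" unfolding e_def using z \<nu> by (intro ln_ge_zero) (auto simp: field_simps)
  have T: "T = 2 * z\<^sup>2 * e" using z(2) by (simp add: dual_strain_def e_def)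
  have ez: "\<nu> * exp e = z - \<mu>" using pos \<nu> by (simp add: e_def)
  have "z\<^sup>2 / y - (2 * z - y) = (z - y)\<^sup>2 / y" using pos by (simp add: field_simps power2_eq_square)
  moreover have "(z - y)\<^sup>2 / y \<ge> 0" using pos by simp
  ultimately have "2 * z - y \<le> z\<^sup>2 / y" by linarith
  from mult_left_mono[OF this e0] have 1: "e * (2 * z - y) \<le> T / (2 * y)" unfolding T by (simp add: mult_ac)
  note 2 = exp_young(1)[OF \<nu> pos(4), of e]
  have 3: "complementary \<mu> \<nu> T z = e * (2 * z - y) + (e * (y - \<mu>) - \<nu> * exp e) + \<nu>"
  proof -
    have "T / (2 * z) = z * e" unfolding T using pos by (simp add: power2_eq_square)
    then show ?thesis unfolding complementary_def ez e_def[symmetric] by (simp add: algebra_simps)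
  qed
  show "complementary \<mu> \<nu> T z \<le> complementary \<mu> \<nu> T y"
    unfolding 3 unfolding complementary_def using 1 2 by linarith
  assume "complementary \<mu> \<nu> T z = complementary \<mu> \<nu> T y"
  then have "e * (y - \<mu>) - \<nu> * exp e = (y - \<mu>) * (ln ((y - \<mu>) / \<nu>) - 1)"
    unfolding 3 unfolding complementary_def using 1 2 by linarith
  from exp_young(2)[OF \<nu> pos(4) this] show "y = z" using ez by simp
qed

text \<open>The pointwise Fenchel inequality with a quadratic remainder; the remainder identifies the case of
  equality.\<close>

lemma stored_energy_duality:
  fixes g t :: plane
  assumes z: "\<mu> + \<nu> \<le> z"
  shows "(norm (z *\<^sub>R g - t))\<^sup>2 / (2 * z) \<le> \<mu> * (norm g)\<^sup>2 / 2 + \<nu> * (exp ((norm g)\<^sup>2 / 2) - 1) - t \<bullet> g + complementary \<mu> \<nu> ((norm t)\<^sup>2) z"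
    "dual_strain \<mu> \<nu> z = (norm t)\<^sup>2 / 2 \<Longrightarrow> g = inverse z *\<^sub>R t \<Longrightarrow>
       \<mu> * (norm g)\<^sup>2 / 2 + \<nu> * (exp ((norm g)\<^sup>2 / 2) - 1) - t \<bullet> g + complementary \<mu> \<nu> ((norm t)\<^sup>2) z = 0"
proof -
  have pos: "z > 0" "z - \<mu> > 0" using z \<mu> \<nu> by auto
  define E where "E = (norm g)\<^sup>2 / 2"
  have sq: "(norm (z *\<^sub>R g - t))\<^sup>2 / (2 * z) = z * E - t \<bullet> g + (norm t)\<^sup>2 / (2 * z)"
  proof -
    have "(norm (z *\<^sub>R g - t))\<^sup>2 = z\<^sup>2 * (norm g)\<^sup>2 - 2 * z * (t \<bullet> g) + (norm t)\<^sup>2"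
      unfolding power2_norm_eq_inner by (simp add: inner_diff_left inner_diff_right inner_commute power2_eq_square algebra_simps)
    then show ?thesis using pos unfolding E_def by (simp add: field_simps power2_eq_square)
  qed
  have m: "\<mu> * (norm g)\<^sup>2 / 2 = \<mu> * E" "z * E = \<mu> * E + E * (z - \<mu>)" "\<nu> * (exp E - 1) = \<nu> * exp E - \<nu>"
    by (simp add: E_def) (simp_all add: algebra_simps)
  show "(norm (z *\<^sub>R g - t))\<^sup>2 / (2 * z) \<le> \<mu> * (norm g)\<^sup>2 / 2 + \<nu> * (exp ((norm g)\<^sup>2 / 2) - 1) - t \<bullet> g + complementary \<mu> \<nu> ((norm t)\<^sup>2) z"
    using exp_young(1)[OF \<nu> pos(2), of E] m unfolding sq complementary_def E_def[symmetric] by linarith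
  assume s: "dual_strain \<mu> \<nu> z = (norm t)\<^sup>2 / 2" and g: "g = inverse z *\<^sub>R t"
  have E: "E = ln ((z - \<mu>) / \<nu>)"
    using s pos unfolding E_def g dual_strain_def by (simp add: power_mult_distrib field_simps)
  have ez: "\<nu> * exp E = z - \<mu>" using pos \<nu> by (simp add: E)
  have "z *\<^sub>R g - t = 0" using pos g by simp
  then have "z * E - t \<bullet> g + (norm t)\<^sup>2 / (2 * z) = 0" using sq by simp
  moreover have "(z - \<mu>) * (E - 1) = E * (z - \<mu>) - (z - \<mu>)" by (simp add: algebra_simps)
  ultimately show "\<mu> * (norm g)\<^sup>2 / 2 + \<nu> * (exp ((norm g)\<^sup>2 / 2) - 1) - t \<bullet> g + complementary \<mu> \<nu> ((norm t)\<^sup>2) z = 0"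
    unfolding complementary_def E_def[symmetric] E[symmetric] using m ez by linarith
qed

lemma dual_strain_differentiable:
  assumes "\<mu> + \<nu> \<le> z"
  obtains c where "(dual_strain \<mu> \<nu> has_real_derivative c) (at z)"
proof -
  have pos: "z > 0" "z - \<mu> > 0" using assms \<mu> \<nu> by auto
  have "(dual_strain \<mu> \<nu> has_real_derivative (2 * z * ln ((z - \<mu>) / \<nu>) + z\<^sup>2 * (1 / (z - \<mu>)))) (at z)"
    unfolding dual_strain_def[abs_def] using pos \<nu>
    by (auto intro!: derivative_eq_intros simp: field_simps)
  then show ?thesis using that by blast
qed

end

section \<open>Weak gradients\<close>

lemma integrable_lebesgue_on_dominated_compact:
  fixes f :: "plane \<Rightarrow> 'a::euclidean_space" and h :: "plane \<Rightarrow> 'b::euclidean_space"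
  assumes O: "open \<Omega>" and f: "locally_integrable \<Omega> f" and K: "compact K" "K \<subseteq> \<Omega>"
    and m: "h \<in> borel_measurable (lebesgue_on K)"
    and le: "\<And>x. x \<in> K \<Longrightarrow> norm (h x) \<le> B * norm (f x)" and z: "\<And>x. x \<in> \<Omega> - K \<Longrightarrow> h x = 0"
  shows "integrable (lebesgue_on \<Omega>) h"
proof -
  have fK: "integrable (lebesgue_on K) f" using f K by (simp add: locally_integrable_def)
  have sK: "K \<in> sets lebesgue" by (rule fmeasurableD[OF lmeasurable_compact[OF K(1)]])
  have "integrable (lebesgue_on K) h"
  proof (rule Bochner_Integration.integrable_bound[OF _ m])
    show "integrable (lebesgue_on K) (\<lambda>x. B * norm (f x))" using fK by simp
    show "AE x in lebesgue_on K. norm (h x) \<le> norm (B * norm (f x))"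
      using le by (intro AE_I2) (fastforce simp: space_restrict_space)
  qed
  then have "integrable lebesgue (\<lambda>x. indicator K x *\<^sub>R h x)"
    using sK by (simp add: integrable_restrict_space)
  moreover have "(\<lambda>x. indicator K x *\<^sub>R h x) = (\<lambda>x. indicator \<Omega> x *\<^sub>R h x)"
  proof
    fix x show "indicator K x *\<^sub>R h x = indicator \<Omega> x *\<^sub>R h x"
      using K(2) z[of x] by (cases "x \<in> K"; cases "x \<in> \<Omega>") auto
  qed
  ultimately show ?thesis using O by (simp add: integrable_restrict_space)
qed

lemma integrable_multiplier:
  fixes f :: "plane \<Rightarrow> 'a::euclidean_space"
  assumes O: "open \<Omega>" and f: "locally_integrable \<Omega> f" and \<phi>: "test_function \<Omega> \<phi> \<phi>'"
  shows "integrable (lebesgue_on \<Omega>) (\<lambda>x. \<phi> x *\<^sub>R f x)"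
proof -
  obtain K where K: "compact K" "K \<subseteq> \<Omega>" "\<And>x. x \<notin> K \<Longrightarrow> \<phi> x = 0" using test_function_support[OF \<phi>] by metis
  obtain M where M: "\<And>x. \<bar>\<phi> x\<bar> \<le> M" using test_function_bounded[OF \<phi>] by metis
  have sK: "K \<in> sets lebesgue" by (rule fmeasurableD[OF lmeasurable_compact[OF K(1)]])
  have "integrable (lebesgue_on K) f" using f K(1,2) by (simp add: locally_integrable_def)
  then have "f \<in> borel_measurable (lebesgue_on K)" by (rule borel_measurable_integrable)
  moreover have "\<phi> \<in> borel_measurable (lebesgue_on K)"
    using test_function_continuous(1)[OF \<phi>] sK by (rule continuous_imp_measurable_on_sets_lebesgue)
  ultimately have "(\<lambda>x. \<phi> x *\<^sub>R f x) \<in> borel_measurable (lebesgue_on K)" by measurable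
  then show ?thesis
    by (rule integrable_lebesgue_on_dominated_compact[OF O f K(1,2), where B=M]) (use K(3) M in \<open>auto intro: mult_right_mono\<close>)
qed

lemma integrable_gradient_multiplier:
  fixes u :: "plane \<Rightarrow> real"
  assumes O: "open \<Omega>" and u: "locally_integrable \<Omega> u" and \<phi>: "test_function \<Omega> \<phi> \<phi>'"
  shows "integrable (lebesgue_on \<Omega>) (\<lambda>x. u x *\<^sub>R \<phi>' x)"
proof -
  obtain K where K: "compact K" "K \<subseteq> \<Omega>" "\<And>x. x \<notin> K \<Longrightarrow> \<phi>' x = 0" using test_function_support[OF \<phi>] by metis
  obtain M where M: "\<And>x. norm (\<phi>' x) \<le> M" using test_function_bounded[OF \<phi>] by metis
  have sK: "K \<in> sets lebesgue" by (rule fmeasurableD[OF lmeasurable_compact[OF K(1)]])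
  have "integrable (lebesgue_on K) u" using u K(1,2) by (simp add: locally_integrable_def)
  then have "u \<in> borel_measurable (lebesgue_on K)" by (rule borel_measurable_integrable)
  moreover have "\<phi>' \<in> borel_measurable (lebesgue_on K)"
    using test_function_continuous(2)[OF \<phi>] sK by (rule continuous_imp_measurable_on_sets_lebesgue)
  ultimately have "(\<lambda>x. u x *\<^sub>R \<phi>' x) \<in> borel_measurable (lebesgue_on K)" by measurable
  then show ?thesis
    by (rule integrable_lebesgue_on_dominated_compact[OF O u K(1,2), where B=M])
       (use K(3) mult_left_mono[OF M abs_ge_zero] in \<open>auto simp: mult.commute[of M]\<close>)
qed

lemma continuous_imp_locally_integrable:
  fixes f :: "plane \<Rightarrow> 'a::euclidean_space"
  assumes "continuous_on \<Omega> f"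
  shows "locally_integrable \<Omega> f"
  unfolding locally_integrable_def
proof (intro allI impI)
  fix K assume K: "compact K \<and> K \<subseteq> \<Omega>"
  then have c: "continuous_on K f" using assms continuous_on_subset by blast
  have sK: "K \<in> sets borel" using K compact_imp_closed borel_closed by blast
  have i: "integrable lborel (\<lambda>x. indicator K x *\<^sub>R f x)" using K c by (intro borel_integrable_compact) auto
  then have "integrable lebesgue (\<lambda>x. indicator K x *\<^sub>R f x)" by (subst integrable_completion) auto
  then show "integrable (lebesgue_on K) f" using sK by (simp add: integrable_restrict_space)
qed

text \<open>The product of \<open>u\<close> with a test function is a test function, so its gradient integrates to 0.\<close>

lemma classical_weak_gradient:
  assumes O: "open \<Omega>" and u: "\<And>x. x \<in> \<Omega> \<Longrightarrow> GDERIV u x :> F x" and F: "continuous_on \<Omega> F"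
  shows "weak_gradient \<Omega> u F"
proof -
  have cu: "continuous_on \<Omega> u"
    using u unfolding gderiv_def by (meson has_derivative_continuous continuous_at_imp_continuous_on)
  note li = continuous_imp_locally_integrable[OF cu] continuous_imp_locally_integrable[OF F]
  have "integral\<^sup>L (lebesgue_on \<Omega>) (\<lambda>x. u x *\<^sub>R \<phi>' x) = - integral\<^sup>L (lebesgue_on \<Omega>) (\<lambda>x. \<phi> x *\<^sub>R F x)"
    if \<phi>: "test_function \<Omega> \<phi> \<phi>'" for \<phi> \<phi>'
  proof -
    have "integral\<^sup>L (lebesgue_on \<Omega>) (\<lambda>x. \<phi> x *\<^sub>R F x + u x *\<^sub>R \<phi>' x) = 0"
      using test_function_integral_gradient_zero_on(2)[OF O test_function_mult_local[OF O \<phi> u F]] .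
    then have "integral\<^sup>L (lebesgue_on \<Omega>) (\<lambda>x. \<phi> x *\<^sub>R F x) + integral\<^sup>L (lebesgue_on \<Omega>) (\<lambda>x. u x *\<^sub>R \<phi>' x) = 0"
      using Bochner_Integration.integral_add[OF integrable_multiplier[OF O li(2) \<phi>] integrable_gradient_multiplier[OF O li(1) \<phi>]] by simp
    then show ?thesis by (simp add: eq_neg_iff_add_eq_0 add.commute)
  qed
  then show ?thesis unfolding weak_gradient_def
    using li F O by (auto intro!: continuous_imp_measurable_on_sets_lebesgue)
qed

text \<open>Products of four one-sided steps that become steep at the faces of the box.\<close>

lemma box_indicator_limit:
  fixes a b :: plane
  assumes "cbox a b \<subseteq> \<Omega>"
  obtains \<phi> \<phi>' where "\<And>n::nat. test_function \<Omega> (\<phi> n) (\<phi>' n)" "\<And>n x. 0 \<le> \<phi> n x" "\<And>n x. \<phi> n x \<le> 1"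
    "\<And>n x. x \<notin> box a b \<Longrightarrow> \<phi> n x = 0" "\<And>x. x \<in> box a b \<Longrightarrow> (\<lambda>n. \<phi> n x) \<longlonglongrightarrow> 1"
proof -
  define s where "s = (\<lambda>n i x. smooth_step (real n * (x $ i + - a $ i)) * smooth_step (real n * (b $ i + (- 1) * x $ i)))"
  define \<phi> where "\<phi> = (\<lambda>n x. s n 1 x * s n (2::2) x)"
  have "C1_function (\<phi> n)" for n unfolding \<phi>_def s_def
    by (intro C1_function_mult C1_function_smooth_step C1_function_add C1_function_const C1_function_coordinate)
  then have "\<forall>n. \<exists>\<phi>'. (\<forall>x. GDERIV (\<phi> n) x :> \<phi>' x) \<and> continuous_on UNIV \<phi>'" by (simp add: C1_function_def)
  then obtain \<phi>' where \<phi>': "\<And>n x. GDERIV (\<phi> n) x :> \<phi>' n x" "\<And>n. continuous_on UNIV (\<phi>' n)" by metis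
  have s01: "0 \<le> s n i x" "s n i x \<le> 1" for n i x
    unfolding s_def by (auto intro!: mult_nonneg_nonneg mult_le_one smooth_step_props)
  have box: "x \<in> box a b \<longleftrightarrow> (\<forall>i. a $ i < x $ i \<and> x $ i < b $ i)" for x :: plane by (simp add: mem_box_cart)
  have s0: "s n i x = 0" if "\<not> (a $ i < x $ i \<and> x $ i < b $ i)" for n i x
  proof -
    consider "x $ i \<le> a $ i" | "b $ i \<le> x $ i" using \<open>\<not> _\<close> by linarith
    then show ?thesis
    proof cases
      case 1
      then have "real n * (x $ i + - a $ i) \<le> 0" by (intro mult_nonneg_nonpos) auto
      then show ?thesis unfolding s_def by (simp add: smooth_step_props(3))
    next
      case 2
      then have "real n * (b $ i + (- 1) * x $ i) \<le> 0" by (intro mult_nonneg_nonpos) auto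
      then show ?thesis unfolding s_def by (simp add: smooth_step_props(3))
    qed
  qed
  have zero: "\<phi> n x = 0" if "x \<notin> box a b" for n x
    using s0 that unfolding box \<phi>_def forall_2 by auto
  have big: "\<forall>\<^sub>F n in sequentially. smooth_step (real n * r) = 1" if "r > 0" for r
  proof -
    obtain N where "1 / r < real N" using reals_Archimedean2 by blast
    then have "1 \<le> real n * r" if "N \<le> n" for n
    proof -
      have "1 / r \<le> real n" using \<open>1 / r < real N\<close> \<open>N \<le> n\<close> by linarith
      then show ?thesis using \<open>r > 0\<close> by (simp add: field_simps)
    qed
    then show ?thesis unfolding eventually_sequentially using smooth_step_props(4) by blast
  qed
  have lim: "(\<lambda>n. \<phi> n x) \<longlonglongrightarrow> 1" if x: "x \<in> box a b" for x
  proof -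
    have "\<forall>\<^sub>F n in sequentially. s n i x = 1" for i
    proof -
      have "x $ i + - a $ i > 0" "b $ i + (- 1) * x $ i > 0" using x unfolding box by auto
      from big[OF this(1)] big[OF this(2)] show ?thesis by eventually_elim (simp add: s_def)
    qed
    from this[of 1] this[of 2] have "\<forall>\<^sub>F n in sequentially. 1 = \<phi> n x" by eventually_elim (simp add: \<phi>_def)
    then show ?thesis by (rule Lim_transform_eventually[OF tendsto_const])
  qed
  have bc: "box a b \<subseteq> cbox a b" by (rule box_subset_cbox)
  show ?thesis
  proof (rule that[of \<phi> \<phi>'])
    show "test_function \<Omega> (\<phi> n) (\<phi>' n)" for n
    proof -
      have "\<phi> n x = 0" if "x \<notin> cbox a b" for x using zero bc that by blast
      then show ?thesis unfolding test_function_def using \<phi>' assms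
        by (intro conjI allI exI[of _ "cbox a b"]) auto
    qed
    show "0 \<le> \<phi> n x" "\<phi> n x \<le> 1" for n x
      unfolding \<phi>_def using s01 by (auto intro: mult_nonneg_nonneg mult_le_one)
  qed (use zero lim in auto)
qed

text \<open>Approximating box indicators by test functions shows that \<open>h\<close> has integral 0 over every box in \<open>\<Omega>\<close>,
  and Lebesgue's differentiation theorem then makes \<open>h\<close> vanish almost everywhere. Countably many boxes
  cover \<open>\<Omega>\<close>.\<close>

lemma fundamental_lemma_variations:
  fixes h :: "plane \<Rightarrow> plane"
  assumes O: "open \<Omega>" and h: "locally_integrable \<Omega> h"
    and zero: "\<And>\<phi> \<phi>'. test_function \<Omega> \<phi> \<phi>' \<Longrightarrow> integral\<^sup>L (lebesgue_on \<Omega>) (\<lambda>x. \<phi> x *\<^sub>R h x) = 0"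
  shows "\<exists>N. negligible N \<and> (\<forall>x\<in>\<Omega> - N. h x = 0)"
proof -
  have box0: "integral (cbox a b) h = 0" if ab: "cbox a b \<subseteq> \<Omega>" for a b
  proof -
    obtain \<phi> \<phi>' where \<phi>: "\<And>n::nat. test_function \<Omega> (\<phi> n) (\<phi>' n)" "\<And>n x. 0 \<le> \<phi> n x" "\<And>n x. \<phi> n x \<le> 1"
      "\<And>n x. x \<notin> box a b \<Longrightarrow> \<phi> n x = 0" "\<And>x. x \<in> box a b \<Longrightarrow> (\<lambda>n. \<phi> n x) \<longlonglongrightarrow> 1"
      using box_indicator_limit[OF ab] by metis
    have hb: "integrable (lebesgue_on (cbox a b)) h" using h ab by (simp add: locally_integrable_def)
    then have hB: "integrable (lebesgue_on \<Omega>) (\<lambda>x. indicator (cbox a b) x *\<^sub>R h x)"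
    proof -
      have "integrable lebesgue (\<lambda>x. indicator (cbox a b) x *\<^sub>R h x)" using hb by (simp add: integrable_restrict_space)
      moreover have "(\<lambda>x. indicator \<Omega> x *\<^sub>R indicator (cbox a b) x *\<^sub>R h x) = (\<lambda>x. indicator (cbox a b) x *\<^sub>R h x)"
        using ab by (auto simp: fun_eq_iff indicator_def)
      ultimately show ?thesis using O by (simp add: integrable_restrict_space)
    qed
    have bc: "box a b \<subseteq> cbox a b" by (rule box_subset_cbox)
    define k where "k = (\<lambda>x. indicator (box a b) x *\<^sub>R h x)"
    have kb: "integrable lebesgue k"
    proof -
      have i1: "integrable lebesgue (\<lambda>x. indicator (cbox a b) x *\<^sub>R h x)" using hb by (simp add: integrable_restrict_space)
      have "integrable lebesgue (\<lambda>x. indicator (box a b) x *\<^sub>R (indicator (cbox a b) x *\<^sub>R h x))"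
        by (rule integrable_mult_indicator[OF _ i1]) simp
      moreover have "(\<lambda>x. indicator (box a b) x *\<^sub>R (indicator (cbox a b) x *\<^sub>R h x)) = k"
        using bc by (auto simp: k_def fun_eq_iff indicator_def)
      ultimately show ?thesis by simp
    qed
    have kO: "integrable (lebesgue_on \<Omega>) k"
    proof -
      have "(\<lambda>x. indicator \<Omega> x *\<^sub>R k x) = k" using ab bc by (auto simp: k_def fun_eq_iff indicator_def)
      then show ?thesis using kb O by (simp add: integrable_restrict_space)
    qed
    have "(\<lambda>n. integral\<^sup>L (lebesgue_on \<Omega>) (\<lambda>x. \<phi> n x *\<^sub>R h x)) \<longlonglongrightarrow> integral\<^sup>L (lebesgue_on \<Omega>) k"
    proof (rule integral_dominated_convergence[where w="\<lambda>x. norm (indicator (cbox a b) x *\<^sub>R h x)"])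
      show "k \<in> borel_measurable (lebesgue_on \<Omega>)" using kO by auto
      show "(\<lambda>x. \<phi> n x *\<^sub>R h x) \<in> borel_measurable (lebesgue_on \<Omega>)" for n
        using integrable_multiplier[OF O h \<phi>(1)] by auto
      show "integrable (lebesgue_on \<Omega>) (\<lambda>x. norm (indicator (cbox a b) x *\<^sub>R h x))" using hB by (rule integrable_norm)
      show "AE x in lebesgue_on \<Omega>. (\<lambda>n. \<phi> n x *\<^sub>R h x) \<longlonglongrightarrow> k x"
      proof (rule AE_I2)
        fix x show "(\<lambda>n. \<phi> n x *\<^sub>R h x) \<longlonglongrightarrow> k x"
        proof (cases "x \<in> box a b")
          case True
          then show ?thesis using tendsto_scaleR[OF \<phi>(5)[OF True] tendsto_const[of "h x"]] by (simp add: k_def)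
        next
          case False then show ?thesis using \<phi>(4) by (simp add: k_def)
        qed
      qed
      show "AE x in lebesgue_on \<Omega>. norm (\<phi> n x *\<^sub>R h x) \<le> norm (indicator (cbox a b) x *\<^sub>R h x)" for n
      proof (rule AE_I2)
        fix x show "norm (\<phi> n x *\<^sub>R h x) \<le> norm (indicator (cbox a b) x *\<^sub>R h x)"
          using \<phi>(2)[of n x] \<phi>(3)[of n x] \<phi>(4)[of x n] bc
          by (cases "x \<in> box a b") (auto simp: mult_left_le_one_le)
      qed
    qed
    then have "integral\<^sup>L (lebesgue_on \<Omega>) k = 0" using zero[OF \<phi>(1)] by (simp add: LIMSEQ_const_iff)
    moreover have "integral\<^sup>L (lebesgue_on \<Omega>) k = integral\<^sup>L lebesgue k"
    proof -
      have "(\<lambda>x. indicator \<Omega> x *\<^sub>R k x) = k" using ab bc by (auto simp: k_def fun_eq_iff indicator_def)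
      then show ?thesis using O by (simp add: integral_restrict_space)
    qed
    moreover have "integral\<^sup>L lebesgue k = integral (box a b) h"
    proof -
      have "(k has_integral integral\<^sup>L lebesgue k) UNIV" using kb by (rule has_integral_integral_lebesgue)
      moreover have "k = (\<lambda>x. if x \<in> box a b then h x else 0)" by (auto simp: k_def fun_eq_iff)
      ultimately have "(h has_integral integral\<^sup>L lebesgue k) (box a b)" by (simp only: has_integral_restrict_UNIV)
      then show ?thesis by (simp add: integral_unique)
    qed
    ultimately show ?thesis by (simp add: integral_open_interval)
  qed
  have local: "\<exists>N. negligible N \<and> (\<forall>x\<in>box a b - N. h x = 0)" if ab: "cbox a b \<subseteq> \<Omega>" for a b
  proof -
    define k where "k = (\<lambda>x. if x \<in> cbox a b then h x else 0)"
    have "integrable (lebesgue_on (cbox a b)) h" using h ab by (simp add: locally_integrable_def)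
    then have "h integrable_on cbox a b" by (rule integrable_on_lebesgue_on) simp
    then have "k integrable_on UNIV" unfolding k_def by (simp only: integrable_restrict_UNIV)
    then have "k integrable_on cbox c d" for c d by (rule integrable_on_subcbox) simp
    then obtain N where N: "negligible N" "\<And>x e. x \<notin> N \<Longrightarrow> 0 < e \<Longrightarrow>
       \<exists>d>0. \<forall>r. 0 < r \<and> r < d \<longrightarrow> norm (integral (cbox x (x + r *\<^sub>R One)) k /\<^sub>R r ^ DIM(plane) - k x) < e"
      using integrable_ccontinuous_explicit[of k] by blast
    have "h x = 0" if x: "x \<in> box a b - N" for x
    proof (rule ccontr)
      assume "h x \<noteq> 0"
      then obtain d where d: "d > 0" "\<And>r. 0 < r \<Longrightarrow> r < d \<Longrightarrow> norm (integral (cbox x (x + r *\<^sub>R One)) k /\<^sub>R r ^ DIM(plane) - k x) < norm (h x)"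
        using N(2)[of x "norm (h x)"] x by auto
      obtain e where e: "e > 0" "ball x e \<subseteq> box a b" using x open_contains_ball[of "box a b"] open_box by blast
      define r where "r = min d (e / (norm (One::plane) + 1)) / 2"
      have n1: "norm (One::plane) + 1 > 0" by (simp add: add_nonneg_pos)
      have r: "0 < r" "r < d" using d(1) e(1) n1 by (auto simp: r_def)
      have re: "r * norm (One::plane) < e"
      proof -
        have "r \<le> e / (norm (One::plane) + 1) / 2" unfolding r_def by (intro divide_right_mono) auto
        then have "r * (norm (One::plane) + 1) \<le> e / 2" using n1 by (simp add: field_simps)
        then show ?thesis using r(1) e(1) by (simp add: distrib_left)
      qed
      have "cbox x (x + r *\<^sub>R One) \<subseteq> ball x e"
      proof
        fix y assume y: "y \<in> cbox x (x + r *\<^sub>R One)"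
        have "norm (y - x) \<le> norm (r *\<^sub>R (One::plane))"
        proof (rule norm_le_componentwise)
          fix i :: plane assume i: "i \<in> Basis"
          then have "x \<bullet> i \<le> y \<bullet> i" "y \<bullet> i \<le> x \<bullet> i + r" using y by (auto simp: mem_box inner_add_left)
          then show "\<bar>(y - x) \<bullet> i\<bar> \<le> \<bar>(r *\<^sub>R (One::plane)) \<bullet> i\<bar>" using r(1) i by (simp add: inner_diff_left)
        qed
        then show "y \<in> ball x e" using re r(1) by (simp add: dist_norm norm_minus_commute)
      qed
      then have sub: "cbox x (x + r *\<^sub>R One) \<subseteq> cbox a b" using e(2) box_subset_cbox by blast
      then have "integral (cbox x (x + r *\<^sub>R One)) k = integral (cbox x (x + r *\<^sub>R One)) h"
        by (intro Henstock_Kurzweil_Integration.integral_cong) (auto simp: k_def)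
      also have "\<dots> = 0" using box0 sub ab by blast
      finally have "norm (k x) < norm (h x)" using d(2)[OF r] by simp
      moreover have "k x = h x" using x box_subset_cbox by (auto simp: k_def)
      ultimately show False by simp
    qed
    then show ?thesis using N(1) by blast
  qed
  have "\<forall>x\<in>\<Omega>. \<exists>a b. x \<in> box a b \<and> cbox a b \<subseteq> \<Omega>" using O open_contains_cbox by meson
  then have cover: "x \<in> \<Union>{box a b | a b. cbox a b \<subseteq> \<Omega>}" if "x \<in> \<Omega>" for x using that by blast
  obtain F where F: "F \<subseteq> {box a b | a b. cbox a b \<subseteq> \<Omega>}" "countable F" "\<Union>F = \<Union>{box a b | a b. cbox a b \<subseteq> \<Omega>}"
  proof (rule Lindelof[of "{box a b | a b. cbox a b \<subseteq> \<Omega>}"])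
    show "open S" if "S \<in> {box a b | a b. cbox a b \<subseteq> \<Omega>}" for S using that open_box by blast
  qed
  have "\<forall>B\<in>F. \<exists>N. negligible N \<and> (\<forall>x\<in>B - N. h x = 0)" using F(1) local by blast
  then obtain N where N: "\<And>B. B \<in> F \<Longrightarrow> negligible (N B)" "\<And>B x. B \<in> F \<Longrightarrow> x \<in> B - N B \<Longrightarrow> h x = 0" by metis
  have "negligible (\<Union>B\<in>F. N B)" using F(2) N(1) by (intro negligible_countable_Union) auto
  moreover have "h x = 0" if "x \<in> \<Omega> - (\<Union>B\<in>F. N B)" for x
  proof -
    have "x \<in> \<Union>F" unfolding F(3) using cover that by blast
    then show ?thesis using N(2) that by blast
  qed
  ultimately show ?thesis by blast
qed

lemma AE_lebesgue_on_negligible: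
  assumes "\<Omega> \<in> sets lebesgue" "negligible N" "\<And>x. x \<in> \<Omega> - N \<Longrightarrow> P x"
  shows "AE x in lebesgue_on \<Omega>. P x"
proof -
  have "AE x in lebesgue. x \<notin> N" using assms(2) by (intro AE_not_in) (simp add: negligible_iff_null_sets)
  then have "AE x in lebesgue. x \<in> \<Omega> \<longrightarrow> P x" by eventually_elim (use assms(3) in blast)
  then show ?thesis using assms(1) by (subst AE_restrict_space_iff) auto
qed

lemma weak_gradient_AE_unique:
  assumes O: "open \<Omega>" and g: "weak_gradient \<Omega> u g" and g': "weak_gradient \<Omega> u g'"
  shows "AE x in lebesgue_on \<Omega>. g x = g' x"
proof -
  have li: "locally_integrable \<Omega> g" "locally_integrable \<Omega> g'" using g g' by (auto simp: weak_gradient_def)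
  have "locally_integrable \<Omega> (\<lambda>x. g x - g' x)" using li unfolding locally_integrable_def by auto
  moreover have "integral\<^sup>L (lebesgue_on \<Omega>) (\<lambda>x. \<phi> x *\<^sub>R (g x - g' x)) = 0" if \<phi>: "test_function \<Omega> \<phi> \<phi>'" for \<phi> \<phi>'
  proof -
    have "integral\<^sup>L (lebesgue_on \<Omega>) (\<lambda>x. \<phi> x *\<^sub>R (g x - g' x)) = integral\<^sup>L (lebesgue_on \<Omega>) (\<lambda>x. \<phi> x *\<^sub>R g x) - integral\<^sup>L (lebesgue_on \<Omega>) (\<lambda>x. \<phi> x *\<^sub>R g' x)"
      unfolding scaleR_diff_right
      by (rule Bochner_Integration.integral_diff[OF integrable_multiplier[OF O li(1) \<phi>] integrable_multiplier[OF O li(2) \<phi>]])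
    moreover have "integral\<^sup>L (lebesgue_on \<Omega>) (\<lambda>x. u x *\<^sub>R \<phi>' x) = - integral\<^sup>L (lebesgue_on \<Omega>) (\<lambda>x. \<phi> x *\<^sub>R g x)"
      "integral\<^sup>L (lebesgue_on \<Omega>) (\<lambda>x. u x *\<^sub>R \<phi>' x) = - integral\<^sup>L (lebesgue_on \<Omega>) (\<lambda>x. \<phi> x *\<^sub>R g' x)"
      using g g' \<phi> unfolding weak_gradient_def by blast+
    ultimately show ?thesis by simp
  qed
  ultimately have "\<exists>N. negligible N \<and> (\<forall>x\<in>\<Omega> - N. g x - g' x = 0)"
    by (rule fundamental_lemma_variations[OF O])
  then obtain N where N: "negligible N" "\<And>x. x \<in> \<Omega> - N \<Longrightarrow> g x - g' x = 0" by blast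
  have "g x = g' x" if "x \<in> \<Omega> - N" for x using N(2)[OF that] by simp
  then show ?thesis using O N(1) by (intro AE_lebesgue_on_negligible[of _ N]) auto
qed

text \<open>The derivative of the weighted mean in the direction of the centre is the integral of \<open>v\<close> against
  the gradient of a bump, which is assumed to vanish along the segment.\<close>

lemma weighted_bump_integral_constant:
  fixes v :: "plane \<Rightarrow> real"
  assumes v: "continuous_on (cbox p q) v" and "r > 0"
    and orth: "\<And>z. z \<in> closed_segment a y \<Longrightarrow> ((\<lambda>t. v t *\<^sub>R bump_out' z r t) has_integral 0) (cbox p q)"
  shows "integral (cbox p q) (\<lambda>t. v t * (1 - bump_out y r t)) = integral (cbox p q) (\<lambda>t. v t * (1 - bump_out a r t))"
proof -
  define l where "l = (\<lambda>s. a + s *\<^sub>R (y - a))"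
  have lseg: "l s \<in> closed_segment a y" if "s \<in> {0..1}" for s
    using that unfolding l_def closed_segment_def by (auto simp: algebra_simps intro!: exI[of _ s])
  define f where "f = (\<lambda>s t. v t * (1 - bump_out (l s) r t))"
  define fx where "fx = (\<lambda>s t. v t * ((y - a) \<bullet> bump_out' (l s) r t))"
  have cb: "continuous_on S (bump_out z r)" for S z using bump_out_props(5)[OF \<open>r > 0\<close>] by (rule GDERIV_imp_continuous_on)
  have sym: "bump_out z r t = bump_out t r z" "bump_out' t r z = - bump_out' z r t" for z t
    by (simp_all add: bump_out_def bump_out'_def norm_minus_commute scaleR_diff_right)
  have der: "((\<lambda>s. f s t) has_vector_derivative fx s t) (at s within {0..1})" for s t
  proof -
    have "((\<lambda>h. bump_out t r (l s + h *\<^sub>R (y - a))) has_real_derivative (y - a) \<bullet> bump_out' t r (l s)) (at 0)"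
      by (rule GDERIV_along_line[OF bump_out_props(5)[OF \<open>r > 0\<close>]])
    then have "((\<lambda>h. bump_out t r (l (h + s))) has_real_derivative (y - a) \<bullet> bump_out' t r (l s)) (at 0)"
      by (simp add: l_def scaleR_add_left add_ac)
    then have "((\<lambda>s. bump_out t r (l s)) has_real_derivative (y - a) \<bullet> bump_out' t r (l s)) (at s)"
      using DERIV_shift[of "\<lambda>s. bump_out t r (l s)" _ 0 s] by simp
    from DERIV_cmult[OF DERIV_diff[OF DERIV_const[of 1] this], of "v t"]
    have "((\<lambda>s. f s t) has_real_derivative fx s t) (at s)" unfolding f_def fx_def sym(1)[of "l _" t] sym(2)[of t] by simp
    then show ?thesis unfolding has_real_derivative_iff_has_vector_derivative by (rule has_vector_derivative_at_within)
  qed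
  have "continuous_on ({0..1} \<times> cbox p q) (\<lambda>(s, t). fx s t)"
    unfolding fx_def split_def bump_out'_def l_def
    using \<open>r > 0\<close> by (intro continuous_intros continuous_on_compose2[OF v]) auto
  moreover have "f s integrable_on cbox p q" for s
    unfolding f_def using v cb by (intro integrable_continuous continuous_intros)
  ultimately have "((\<lambda>s. integral (cbox p q) (f s)) has_vector_derivative integral (cbox p q) (fx s)) (at s within {0..1})" if "s \<in> {0..1}" for s
    using der that by (intro leibniz_rule_vector_derivative) auto
  moreover have "integral (cbox p q) (fx s) = 0" if s: "s \<in> {0..1}" for s
  proof -
    have "((\<lambda>t. (y - a) \<bullet> (v t *\<^sub>R bump_out' (l s) r t)) has_integral (y - a) \<bullet> 0) (cbox p q)"
      using has_integral_linear[OF orth[OF lseg[OF s]] bounded_linear_inner_right[of "y - a"]] by (simp add: comp_def)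
    then show ?thesis by (intro integral_unique) (simp add: fx_def)
  qed
  ultimately have "\<And>s. s \<in> {0..1} \<Longrightarrow> ((\<lambda>s. integral (cbox p q) (f s)) has_vector_derivative 0) (at s within {0..1})"
    by metis
  then obtain c where "\<And>s. s \<in> {0..1} \<Longrightarrow> integral (cbox p q) (f s) = c"
    using has_vector_derivative_zero_constant[of "{0..1::real}"] by blast
  from this[of 0] this[of 1] show ?thesis by (simp add: f_def l_def)
qed

text \<open>The difference \<open>v\<close> has weak gradient 0, so its weighted means over small discs do not depend on the
  centre, by \<open>weighted_bump_integral_constant\<close>. Letting the discs shrink gives \<open>v y = v a\<close> for nearby
  points, by continuity. Connectedness does the rest.\<close>

lemma weak_gradient_eq_imp_constant:
  assumes O: "open \<Omega>" and conn: "connected \<Omega>"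
    and c: "continuous_on \<Omega> u" "continuous_on \<Omega> w"
    and g: "weak_gradient \<Omega> u g" "weak_gradient \<Omega> w g'" and eq: "AE x in lebesgue_on \<Omega>. g' x = g x"
  shows "(\<lambda>x. w x - u x) constant_on \<Omega>"
proof (rule locally_constant_imp_constant[OF conn])
  define v where "v = (\<lambda>x. w x - u x)"
  have cv: "continuous_on \<Omega> v" unfolding v_def using c by (intro continuous_intros)
  have li: "locally_integrable \<Omega> u" "locally_integrable \<Omega> w" using g by (auto simp: weak_gradient_def)
  have orth: "integral\<^sup>L (lebesgue_on \<Omega>) (\<lambda>x. v x *\<^sub>R \<phi>' x) = 0" if \<phi>: "test_function \<Omega> \<phi> \<phi>'" for \<phi> \<phi>'
  proof -
    have e: "integral\<^sup>L (lebesgue_on \<Omega>) (\<lambda>x. u x *\<^sub>R \<phi>' x) = - integral\<^sup>L (lebesgue_on \<Omega>) (\<lambda>x. \<phi> x *\<^sub>R g x)"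
       "integral\<^sup>L (lebesgue_on \<Omega>) (\<lambda>x. w x *\<^sub>R \<phi>' x) = - integral\<^sup>L (lebesgue_on \<Omega>) (\<lambda>x. \<phi> x *\<^sub>R g' x)"
      using g \<phi> unfolding weak_gradient_def by blast+
    have lg: "locally_integrable \<Omega> g" "locally_integrable \<Omega> g'" using g by (auto simp: weak_gradient_def)
    have "integral\<^sup>L (lebesgue_on \<Omega>) (\<lambda>x. \<phi> x *\<^sub>R g' x) = integral\<^sup>L (lebesgue_on \<Omega>) (\<lambda>x. \<phi> x *\<^sub>R g x)"
      using integrable_multiplier[OF O lg(1) \<phi>] integrable_multiplier[OF O lg(2) \<phi>] eq
      by (intro integral_cong_AE) (auto elim!: eventually_mono)
    then show ?thesis unfolding v_def scaleR_diff_left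
      using Bochner_Integration.integral_diff[OF integrable_gradient_multiplier[OF O li(2) \<phi>] integrable_gradient_multiplier[OF O li(1) \<phi>]] e by simp
  qed
  fix a assume a: "a \<in> \<Omega>"
  have "\<forall>x\<in>\<Omega>. \<exists>p q. x \<in> box p q \<and> cbox p q \<subseteq> \<Omega>" using O open_contains_cbox by meson
  then obtain p q where pq: "a \<in> box p q" "cbox p q \<subseteq> \<Omega>" using a by blast
  obtain R where R: "R > 0" "ball a (2 * R) \<subseteq> box p q"
  proof -
    obtain e where "e > 0" "ball a e \<subseteq> box p q" using pq(1) open_contains_ball[of "box p q"] open_box by blast
    then show ?thesis using that[of "e / 2"] by simp
  qed
  have same: "v y = v a" if y: "y \<in> ball a R" for y
  proof -
    have "\<bar>v y - v a\<bar> \<le> 0 + \<epsilon>" if "\<epsilon> > 0" for \<epsilon>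
    proof -
      have near: "\<exists>d>0. \<forall>t. norm (t - z) < d \<longrightarrow> \<bar>v t - v z\<bar> \<le> \<epsilon> / 2" if z: "z \<in> \<Omega>" for z
      proof -
        have "isCont v z" using cv O z continuous_on_eq_continuous_at by blast
        then obtain d where "d > 0" "\<And>t. dist t z < d \<Longrightarrow> dist (v t) (v z) < \<epsilon> / 2"
          unfolding continuous_at_eps_delta using \<open>\<epsilon> > 0\<close> by (metis half_gt_zero)
        then show ?thesis by (intro exI[of _ d]) (auto simp: dist_norm less_imp_le)
      qed
      have yO: "y \<in> \<Omega>" using y R pq(2) box_subset_cbox by fastforce
      obtain d1 d2 where d: "d1 > 0" "\<And>t. norm (t - a) < d1 \<Longrightarrow> \<bar>v t - v a\<bar> \<le> \<epsilon> / 2"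
          "d2 > 0" "\<And>t. norm (t - y) < d2 \<Longrightarrow> \<bar>v t - v y\<bar> \<le> \<epsilon> / 2" using near[OF a] near[OF yO] by blast
      \<comment> \<open>The bumps of radius \<open>3 r\<close> centred on the segment then stay in the box, and \<open>v\<close> oscillates little on
        the two outermost ones.\<close>
      define r where "r = min (min d1 d2) R / 3"
      have r: "r > 0" "3 * r \<le> d1" "3 * r \<le> d2" "3 * r \<le> R" using d(1,3) R(1) by (auto simp: r_def)
      have seg: "z \<in> ball a R" if "z \<in> closed_segment a y" for z
        using that y R(1) convex_ball[of a R] closed_segment_subset[of a "ball a R" y] by auto
      have test: "test_function \<Omega> (\<lambda>t. 1 - bump_out z r t) (\<lambda>t. - bump_out' z r t)"
        and inside: "\<And>t. t \<notin> box p q \<Longrightarrow> bump_out' z r t = 0" if z: "z \<in> ball a R" for z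
      proof -
        have sub: "t \<in> ball a (2 * R)" if "t \<in> cball z (3 * r)" for t
          using that z r(4) dist_triangle[of a t z] by (simp add: dist_commute)
        have "GDERIV (\<lambda>t. 1 - bump_out z r t) t :> - bump_out' z r t" for t
          using GDERIV_diff[OF GDERIV_const bump_out_props(5)[OF r(1)], of 1 z t] by simp
        moreover have "continuous_on UNIV (\<lambda>t. - bump_out' z r t)" using bump_out_props(6)[OF r(1)] by (intro continuous_intros)
        moreover have "1 - bump_out z r t = 0" if "t \<notin> cball z (3 * r)" for t
          using bump_out_props(4)[OF r(1), of t z] that by (simp add: dist_norm norm_minus_commute)
        moreover have "cball z (3 * r) \<subseteq> \<Omega>" using sub R(2) pq(2) box_subset_cbox by blast
        ultimately show "test_function \<Omega> (\<lambda>t. 1 - bump_out z r t) (\<lambda>t. - bump_out' z r t)"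
          unfolding test_function_def using compact_cball[of z "3 * r"] by blast
        fix t assume t: "t \<notin> box p q"
        then have "t \<notin> cball z (3 * r)" using sub R(2) by blast
        then show "bump_out' z r t = 0" using bump_out_props(7)[OF r(1), of z t] by simp
      qed
      have cvb: "continuous_on (cbox p q) v" using cv pq(2) continuous_on_subset by blast
      have hi: "((\<lambda>t. k t *\<^sub>R bump_out' z r t) has_integral 0) (cbox p q)"
        if ck: "continuous_on \<Omega> k" and ok: "\<And>\<phi> \<phi>'. test_function \<Omega> \<phi> \<phi>' \<Longrightarrow> integral\<^sup>L (lebesgue_on \<Omega>) (\<lambda>x. k x *\<^sub>R \<phi>' x) = 0"
          and z: "z \<in> closed_segment a y" for k z
      proof -
        note z' = seg[OF z]
        have i: "integrable (lebesgue_on \<Omega>) (\<lambda>t. k t *\<^sub>R - bump_out' z r t)"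
          by (rule integrable_gradient_multiplier[OF O continuous_imp_locally_integrable[OF ck] test[OF z']])
        have sO: "\<Omega> \<in> sets lebesgue" using O by simp
        have "((\<lambda>t. k t *\<^sub>R - bump_out' z r t) has_integral 0) \<Omega>"
          using has_integral_integral_lebesgue_on[OF i sO] ok[OF test[OF z']] by simp
        then have "((\<lambda>t. k t *\<^sub>R bump_out' z r t) has_integral 0) \<Omega>"
          using has_integral_neg[of "\<lambda>t. k t *\<^sub>R - bump_out' z r t" 0 \<Omega>] by simp
        moreover have "(\<lambda>t. if t \<in> \<Omega> then k t *\<^sub>R bump_out' z r t else 0) = (\<lambda>t. if t \<in> cbox p q then k t *\<^sub>R bump_out' z r t else 0)"
          using inside[OF z'] pq(2) box_subset_cbox[of p q] by (auto simp: fun_eq_iff)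
        ultimately show ?thesis
          using has_integral_restrict_UNIV[of \<Omega> "\<lambda>t. k t *\<^sub>R bump_out' z r t" 0] has_integral_restrict_UNIV[of "cbox p q" "\<lambda>t. k t *\<^sub>R bump_out' z r t" 0] by simp
      qed
      define I where "I = (\<lambda>k z. integral (cbox p q) (\<lambda>t. k t * (1 - bump_out z r t)))"
      have Iv: "I v y = I v a" unfolding I_def
        by (rule weighted_bump_integral_constant[OF cvb r(1) hi[OF cv orth]])
      have I1: "I (\<lambda>_. 1) y = I (\<lambda>_. 1) a" unfolding I_def
      proof (rule weighted_bump_integral_constant[OF _ r(1) hi])
        show "integral\<^sup>L (lebesgue_on \<Omega>) (\<lambda>x. 1 *\<^sub>R \<phi>' x) = 0" if "test_function \<Omega> \<phi> \<phi>'" for \<phi> \<phi>'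
          using test_function_integral_gradient_zero_on(2)[OF O that] by simp
      qed (auto intro: continuous_intros)
      have cb: "continuous_on S (bump_out z r)" for S z using bump_out_props(5)[OF r(1)] by (rule GDERIV_imp_continuous_on)
      have est: "\<bar>I v z - v z * I (\<lambda>_. 1) z\<bar> \<le> \<epsilon> / 2 * I (\<lambda>_. 1) z"
        if z: "\<And>t. norm (t - z) < 3 * r \<Longrightarrow> \<bar>v t - v z\<bar> \<le> \<epsilon> / 2" for z
      proof -
        have ib: "(\<lambda>t. k t * (1 - bump_out z r t)) integrable_on cbox p q" if "continuous_on (cbox p q) k" for k :: "plane \<Rightarrow> real"
          using that cb by (intro integrable_continuous continuous_intros)
        have "I v z - v z * I (\<lambda>_. 1) z = integral (cbox p q) (\<lambda>t. v t * (1 - bump_out z r t) - v z * (1 - bump_out z r t))"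
          unfolding I_def using Henstock_Kurzweil_Integration.integral_diff[OF ib[OF cvb] ib[of "\<lambda>_. v z"]]
          by (simp add: continuous_on_const)
        also have "norm \<dots> \<le> integral (cbox p q) (\<lambda>t. \<epsilon> / 2 * (1 - bump_out z r t))"
        proof (rule Henstock_Kurzweil_Integration.integral_norm_bound_integral)
          show "(\<lambda>t. v t * (1 - bump_out z r t) - v z * (1 - bump_out z r t)) integrable_on cbox p q"
            using ib[OF cvb] ib[of "\<lambda>_. v z"] by (intro Henstock_Kurzweil_Integration.integrable_diff) (auto simp: continuous_on_const)
          show "(\<lambda>t. \<epsilon> / 2 * (1 - bump_out z r t)) integrable_on cbox p q" using ib[of "\<lambda>_. \<epsilon> / 2"] by (simp add: continuous_on_const)
          show "norm (v t * (1 - bump_out z r t) - v z * (1 - bump_out z r t)) \<le> \<epsilon> / 2 * (1 - bump_out z r t)" for t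
          proof (cases "norm (t - z) < 3 * r")
            case True
            have "norm (v t * (1 - bump_out z r t) - v z * (1 - bump_out z r t)) = \<bar>v t - v z\<bar> * (1 - bump_out z r t)"
              using bump_out_props(2)[OF r(1), of z t] by (simp add: left_diff_distrib[symmetric] abs_mult)
            also have "\<dots> \<le> \<epsilon> / 2 * (1 - bump_out z r t)"
              using z[OF True] bump_out_props(2)[OF r(1), of z t] by (intro mult_right_mono) auto
            finally show ?thesis .
          next
            case False
            then have "bump_out z r t = 1" by (intro bump_out_props(4)[OF r(1)]) simp
            then show ?thesis by simp
          qed
        qed
        also have "\<dots> = \<epsilon> / 2 * I (\<lambda>_. 1) z" by (simp add: I_def)
        finally show ?thesis by simp
      qed
      have pos: "I (\<lambda>_. 1) a > 0"
      proof -
        let ?b = "\<lambda>t. 1 - bump_out a r t"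
        have cbb: "continuous_on (cbox p q) ?b" using cb by (intro continuous_intros)
        have nn: "?b t \<ge> 0" for t using bump_out_props(2)[OF r(1), of a t] by simp
        have "I (\<lambda>_. 1) a \<ge> 0" unfolding I_def using nn by (simp add: Henstock_Kurzweil_Integration.integral_nonneg integrable_continuous cbb)
        moreover have "I (\<lambda>_. 1) a \<noteq> 0"
        proof
          assume "I (\<lambda>_. 1) a = 0"
          then have "(?b has_integral 0) (cbox p q)" unfolding I_def
            using integrable_integral[OF integrable_continuous[OF cbb]] by simp
          moreover have "a \<in> cbox p q" "box p q \<noteq> {}" using pq(1) box_subset_cbox by auto
          ultimately have "?b a = 0" using has_integral_0_cbox_imp_0[OF cbb nn] by blast
          then show False using bump_out_props(3)[OF r(1), of a a] r(1) by simp
        qed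
        ultimately show ?thesis by simp
      qed
      have "\<bar>I v a - v a * I (\<lambda>_. 1) a\<bar> \<le> \<epsilon> / 2 * I (\<lambda>_. 1) a" using d(2) r(2) by (intro est) auto
      moreover have "\<bar>I v a - v y * I (\<lambda>_. 1) a\<bar> \<le> \<epsilon> / 2 * I (\<lambda>_. 1) a"
        using est[of y] d(4) r(3) unfolding Iv I1 by auto
      ultimately have "\<bar>v y * I (\<lambda>_. 1) a - v a * I (\<lambda>_. 1) a\<bar> \<le> \<epsilon> * I (\<lambda>_. 1) a" by linarith
      then have "\<bar>v y - v a\<bar> * I (\<lambda>_. 1) a \<le> \<epsilon> * I (\<lambda>_. 1) a" using pos by (simp add: left_diff_distrib[symmetric] abs_mult)
      then show ?thesis using pos by simp
    qed
    then have "\<bar>v y - v a\<bar> \<le> 0" by (rule field_le_epsilon)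
    then show ?thesis by simp
  qed
  have "ball a R \<subseteq> \<Omega>" using R pq(2) box_subset_cbox[of p q] subset_ball[of R "2 * R" a] by force
  then have "openin (top_of_set \<Omega>) (ball a R)" by (simp add: open_subset)
  then show "\<exists>T. openin (top_of_set \<Omega>) T \<and> a \<in> T \<and> (\<forall>x\<in>T. w x - u x = w a - u a)"
  proof (intro exI[of _ "ball a R"] conjI ballI)
    show "a \<in> ball a R" using R(1) by simp
    show "w x - u x = w a - u a" if "x \<in> ball a R" for x using same[OF that] by (simp add: v_def)
  qed
qed

section \<open>Integrals with extended values\<close>

lemma ext_integral_integrable:
  assumes "integrable (lebesgue_on \<Omega>) f"
  shows "ext_integral \<Omega> f = ereal (integral\<^sup>L (lebesgue_on \<Omega>) f)"
proof -
  have fin: "(\<integral>\<^sup>+x. ennreal (f x) \<partial>lebesgue_on \<Omega>) \<noteq> \<infinity>" "(\<integral>\<^sup>+x. ennreal (- f x) \<partial>lebesgue_on \<Omega>) \<noteq> \<infinity>"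
    using assms unfolding real_integrable_def by auto
  then obtain a b where ab: "(\<integral>\<^sup>+x. ennreal (f x) \<partial>lebesgue_on \<Omega>) = ennreal a" "(\<integral>\<^sup>+x. ennreal (- f x) \<partial>lebesgue_on \<Omega>) = ennreal b" "0 \<le> a" "0 \<le> b"
    by (metis ennreal_cases infinity_ennreal_def)
  then have "integral\<^sup>L (lebesgue_on \<Omega>) f = a - b" using assms by (simp add: real_lebesgue_integral_def)
  then show ?thesis unfolding ext_integral_def ab(1,2) using ab(3,4) by simp
qed

lemma ext_integral_cong_AE:
  assumes "AE x in lebesgue_on \<Omega>. f x = g x"
  shows "ext_integral \<Omega> f = ext_integral \<Omega> g"
proof -
  have "(\<integral>\<^sup>+x. ennreal (f x) \<partial>lebesgue_on \<Omega>) = (\<integral>\<^sup>+x. ennreal (g x) \<partial>lebesgue_on \<Omega>)"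
    "(\<integral>\<^sup>+x. ennreal (- f x) \<partial>lebesgue_on \<Omega>) = (\<integral>\<^sup>+x. ennreal (- g x) \<partial>lebesgue_on \<Omega>)"
    using assms by (auto intro!: nn_integral_cong_AE elim!: eventually_mono)
  then show ?thesis by (simp add: ext_integral_def)
qed

lemma ext_integral_mono_AE:
  assumes "AE x in lebesgue_on \<Omega>. f x \<le> g x"
  shows "ext_integral \<Omega> f \<le> ext_integral \<Omega> g"
proof -
  have "(\<integral>\<^sup>+x. ennreal (f x) \<partial>lebesgue_on \<Omega>) \<le> (\<integral>\<^sup>+x. ennreal (g x) \<partial>lebesgue_on \<Omega>)"
    "(\<integral>\<^sup>+x. ennreal (- g x) \<partial>lebesgue_on \<Omega>) \<le> (\<integral>\<^sup>+x. ennreal (- f x) \<partial>lebesgue_on \<Omega>)"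
    using assms by (auto intro!: nn_integral_mono_AE ennreal_leI elim!: eventually_mono)
  then show ?thesis unfolding ext_integral_def by (intro ereal_minus_mono) (simp_all add: less_eq_ennreal.rep_eq)
qed

text \<open>Equality in the monotonicity of the integral. The two bounds force \<open>g\<close> to be integrable, so the
  difference may be integrated.\<close>

lemma ext_integral_le_imp_AE_eq:
  assumes f: "integrable (lebesgue_on \<Omega>) f" and g: "g \<in> borel_measurable (lebesgue_on \<Omega>)"
    and le: "AE x in lebesgue_on \<Omega>. f x \<le> g x" and ge: "ext_integral \<Omega> g \<le> ext_integral \<Omega> f"
  shows "AE x in lebesgue_on \<Omega>. g x = f x"
proof -
  let ?M = "lebesgue_on \<Omega>"
  have neg: "(\<integral>\<^sup>+x. ennreal (- g x) \<partial>?M) < \<infinity>"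
  proof -
    have "(\<integral>\<^sup>+x. ennreal (- g x) \<partial>?M) \<le> (\<integral>\<^sup>+x. ennreal (- f x) \<partial>?M)"
      using le by (auto intro!: nn_integral_mono_AE ennreal_leI elim!: eventually_mono)
    also have "\<dots> < \<infinity>" using f unfolding real_integrable_def by (simp add: less_top)
    finally show ?thesis .
  qed
  have pos: "(\<integral>\<^sup>+x. ennreal (g x) \<partial>?M) < \<infinity>"
  proof (rule ccontr)
    assume "\<not> ?thesis"
    then have "(\<integral>\<^sup>+x. ennreal (g x) \<partial>?M) = \<infinity>" by (simp add: less_top[symmetric])
    moreover obtain b where "(\<integral>\<^sup>+x. ennreal (- g x) \<partial>?M) = ennreal b" "0 \<le> b" using neg by (cases "(\<integral>\<^sup>+x. ennreal (- g x) \<partial>?M)") auto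
    ultimately have "ext_integral \<Omega> g = \<infinity>" by (simp add: ext_integral_def)
    then show False using ge ext_integral_integrable[OF f] by simp
  qed
  have gi: "integrable ?M g" unfolding real_integrable_def using g neg pos by auto
  have "integral\<^sup>L ?M g \<le> integral\<^sup>L ?M f" using ge ext_integral_integrable[OF f] ext_integral_integrable[OF gi] by simp
  moreover have "integral\<^sup>L ?M (\<lambda>x. g x - f x) = integral\<^sup>L ?M g - integral\<^sup>L ?M f" using gi f by (rule Bochner_Integration.integral_diff)
  moreover have nn: "AE x in ?M. 0 \<le> g x - f x" using le by eventually_elim simp
  then have "0 \<le> integral\<^sup>L ?M (\<lambda>x. g x - f x)" by (rule integral_nonneg_AE)
  ultimately have "integral\<^sup>L ?M (\<lambda>x. g x - f x) = 0" by simp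
  then have "AE x in ?M. g x - f x = 0" using integral_nonneg_eq_0_iff_AE[OF Bochner_Integration.integrable_diff[OF gi f] nn] by simp
  then show ?thesis by eventually_elim simp
qed

lemma AE_eq_continuous_imp_eq:
  fixes f g :: "plane \<Rightarrow> real"
  assumes O: "open \<Omega>" and c: "continuous_on \<Omega> f" "continuous_on \<Omega> g" and ae: "AE x in lebesgue_on \<Omega>. f x = g x" and x: "x \<in> \<Omega>"
  shows "f x = g x"
proof (rule ccontr)
  assume ne: "f x \<noteq> g x"
  let ?U = "{x \<in> \<Omega>. f x - g x \<in> - {0}}"
  have "open ?U" using continuous_open_preimage[OF continuous_on_diff[OF c] O open_Compl[OF closed_singleton[of 0]]] by (simp add: vimage_def Int_def)
  moreover have "x \<in> ?U" using x ne by simp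
  moreover have "negligible ?U"
  proof -
    have "AE x in lebesgue. x \<in> \<Omega> \<longrightarrow> f x = g x" using ae O by (subst (asm) AE_restrict_space_iff) auto
    then have "AE x in lebesgue. x \<notin> ?U" by eventually_elim simp
    moreover have "?U \<in> sets lebesgue" using \<open>open ?U\<close> by simp
    ultimately show ?thesis unfolding negligible_iff_null_sets using AE_iff_null_sets by blast
  qed
  ultimately show False using open_not_negligible by blast
qed

lemma integrable_continuous_closure:
  fixes f :: "plane \<Rightarrow> 'a::euclidean_space"
  assumes O: "open \<Omega>" "bounded \<Omega>" and c: "continuous_on (closure \<Omega>) f"
  shows "integrable (lebesgue_on \<Omega>) f"
proof -
  have "compact (closure \<Omega>)" using O(2) by simp
  then have "integrable (lebesgue_on (closure \<Omega>)) f"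
    using continuous_imp_locally_integrable[OF c] by (simp add: locally_integrable_def)
  then have "integrable lebesgue (\<lambda>x. indicator (closure \<Omega>) x *\<^sub>R f x)" by (simp add: integrable_restrict_space)
  then have "integrable lebesgue (\<lambda>x. indicator \<Omega> x *\<^sub>R (indicator (closure \<Omega>) x *\<^sub>R f x))"
    by (rule integrable_mult_indicator[rotated]) (use O(1) in simp)
  moreover have "(\<lambda>x. indicator \<Omega> x *\<^sub>R (indicator (closure \<Omega>) x *\<^sub>R f x)) = (\<lambda>x. indicator \<Omega> x *\<^sub>R f x)"
    using closure_subset by (auto simp: fun_eq_iff indicator_def)
  ultimately show ?thesis using O(1) by (simp add: integrable_restrict_space)
qed

section \<open>Virtual work and line integrals\<close>

text \<open>Away from finitely many parameters the one-sided tangents agree, because the curves are simple and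
  disjoint, so the outward normal exists and the traction condition may be used. On \<open>\<Gamma>\<^sub>u\<close> both
  integrands vanish with \<open>w\<close>.\<close>

lemma boundary_integral_eq_flux:
  fixes \<tau> :: "plane \<Rightarrow> plane" and w t :: "plane \<Rightarrow> real"
  assumes C: "boundary_cycle C \<Omega>" and G: "\<Gamma>\<^sub>u \<subseteq> frontier \<Omega>" "\<Gamma>\<^sub>t = frontier \<Omega> - \<Gamma>\<^sub>u"
    and normal: "\<And>x n. x \<in> \<Gamma>\<^sub>t \<Longrightarrow> outward_unit_normal C x n \<Longrightarrow> n \<bullet> \<tau> x = t x"
    and w0: "\<And>x. x \<in> \<Gamma>\<^sub>u \<Longrightarrow> w x = 0"
  shows "boundary_integral C \<Gamma>\<^sub>t (\<lambda>x. t x * w x) = flux C (\<lambda>x. w x *\<^sub>R \<tau> x)"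
  unfolding boundary_integral_def flux_def
proof (rule sum.cong[OF refl])
  fix \<gamma> assume \<gamma>: "\<gamma> \<in> C"
  have fr: "frontier \<Omega> = (\<Union>\<gamma>\<in>C. path_image \<gamma>)" and simple: "simple_path \<gamma>" and reg: "piecewise_regular \<gamma>"
    and disj: "\<And>\<gamma>'. \<gamma>' \<in> C \<Longrightarrow> \<gamma>' \<noteq> \<gamma> \<Longrightarrow> path_image \<gamma>' \<inter> path_image \<gamma> = {}"
    using C \<gamma> unfolding boundary_cycle_def by blast+
  obtain P d L where P: "finite P" "{0, 1} \<subseteq> P"
    and dd: "\<And>s. s \<in> {0..1} - P \<Longrightarrow> (\<gamma> has_vector_derivative d s) (at s) \<and> d s \<noteq> 0"
    by (rule piecewise_regular_velocity[OF reg]) blast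
  have eq: "(w (\<gamma> s) *\<^sub>R \<tau> (\<gamma> s)) $ 1 * vector_derivative \<gamma> (at s) $ 2 - (w (\<gamma> s) *\<^sub>R \<tau> (\<gamma> s)) $ 2 * vector_derivative \<gamma> (at s) $ 1
     = indicator \<Gamma>\<^sub>t (\<gamma> s) * (t (\<gamma> s) * w (\<gamma> s)) * norm (vector_derivative \<gamma> (at s))" if s: "s \<in> {0..1} - P" for s
  proof -
    have ds: "(\<gamma> has_vector_derivative d s) (at s)" "d s \<noteq> 0" using dd[OF s] by auto
    then have vd: "vector_derivative \<gamma> (at s) = d s" by (intro vector_derivative_at)
    have s01: "0 < s" "s < 1" using s P(2) by (auto simp: less_le)
    have xim: "\<gamma> s \<in> path_image \<gamma>" using s01 by (auto simp: path_image_def)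
    show ?thesis
    proof (cases "\<gamma> s \<in> \<Gamma>\<^sub>u")
      case True
      then show ?thesis using w0 by simp
    next
      case False
      then have xt: "\<gamma> s \<in> \<Gamma>\<^sub>t" using xim \<gamma> fr G(2) by blast
      define n where "n = (1 / norm (d s)) *\<^sub>R (vector [d s $ 2, - d s $ 1] :: plane)"
      have "outward_unit_normal C (\<gamma> s) n"
        unfolding outward_unit_normal_def
      proof (intro conjI ballI allI impI)
        show "\<gamma> s \<in> (\<Union>\<gamma>\<in>C. path_image \<gamma>)" using xim \<gamma> by blast
        fix \<gamma>' s' d' assume a: "\<gamma>' \<in> C" "s' \<in> {0..1}" "\<gamma>' s' = \<gamma> s" "one_sided_derivative \<gamma>' s' d'"
        have "\<gamma> s \<in> path_image \<gamma>'" using a(2,3) by (metis image_eqI path_image_def)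
        then have g: "\<gamma>' = \<gamma>" using disj[OF a(1)] xim by blast
        have "s' = s" using simple a(2,3) s01 unfolding g simple_path_def loop_free_def by fastforce
        then have one: "one_sided_derivative \<gamma> s d'" using a(4) g by simp
        have "d' = d s"
        proof -
          have w: "(\<gamma> has_vector_derivative d s) (at s within A)" for A using ds(1) by (rule has_vector_derivative_at_within)
          consider "(\<gamma> has_vector_derivative d') (at s within {0..s})" | "(\<gamma> has_vector_derivative d') (at s within {s..1})"
            using one unfolding one_sided_derivative_def by blast
          then show ?thesis
          proof cases
            case 1 then show ?thesis using vector_derivative_unique_within_closed_interval[of 0 s s \<gamma> d' "d s"] w s01 by simp
          next
            case 2 then show ?thesis using vector_derivative_unique_within_closed_interval[of s 1 s \<gamma> d' "d s"] w s01 by simp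
          qed
        qed
        then show "n = (1 / norm d') *\<^sub>R vector [d' $ 2, - d' $ 1]" by (simp add: n_def)
      qed
      from normal[OF xt this] have "t (\<gamma> s) = n \<bullet> \<tau> (\<gamma> s)" by simp
      also have "\<dots> = (d s $ 2 * \<tau> (\<gamma> s) $ 1 - d s $ 1 * \<tau> (\<gamma> s) $ 2) / norm (d s)"
        by (simp add: n_def inner_vec_def sum_2 diff_divide_distrib mult.commute)
      finally have "t (\<gamma> s) * norm (d s) = d s $ 2 * \<tau> (\<gamma> s) $ 1 - d s $ 1 * \<tau> (\<gamma> s) $ 2"
        using ds(2) by simp
      then have "w (\<gamma> s) * (t (\<gamma> s) * norm (d s)) = w (\<gamma> s) * (d s $ 2 * \<tau> (\<gamma> s) $ 1 - d s $ 1 * \<tau> (\<gamma> s) $ 2)" by simp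
      then show ?thesis using xt unfolding vd by (simp add: algebra_simps)
    qed
  qed
  show "integral {0..1} (\<lambda>s. indicator \<Gamma>\<^sub>t (\<gamma> s) * (t (\<gamma> s) * w (\<gamma> s)) * norm (vector_derivative \<gamma> (at s)))
     = integral {0..1} (\<lambda>s. (w (\<gamma> s) *\<^sub>R \<tau> (\<gamma> s)) $ 1 * vector_derivative \<gamma> (at s) $ 2 - (w (\<gamma> s) *\<^sub>R \<tau> (\<gamma> s)) $ 2 * vector_derivative \<gamma> (at s) $ 1)"
    by (rule integral_spike[OF negligible_finite[OF P(1)]]) (rule eq)
qed

text \<open>The field \<open>w \<tau>\<close> has weak divergence \<open>\<tau> \<bullet> g\<close>, as \<open>\<tau>\<close> is divergence free. To see this, use \<open>\<phi> \<tau>\<^sub>i\<close> as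
  test functions in the definition of the weak gradient of \<open>w\<close>, which is where the continuity of the
  derivatives of \<open>\<tau>\<close> enters.\<close>

lemma virtual_work:
  fixes \<tau> T1 T2 g :: "plane \<Rightarrow> plane" and w t :: "plane \<Rightarrow> real"
  assumes C: "boundary_cycle C \<Omega>" and G: "\<Gamma>\<^sub>u \<subseteq> frontier \<Omega>" "\<Gamma>\<^sub>t = frontier \<Omega> - \<Gamma>\<^sub>u"
    and \<tau>c: "continuous_on (closure \<Omega>) \<tau>"
    and \<tau>1: "\<And>x. x \<in> \<Omega> \<Longrightarrow> GDERIV (\<lambda>x. \<tau> x $ 1) x :> T1 x" "continuous_on \<Omega> T1"
    and \<tau>2: "\<And>x. x \<in> \<Omega> \<Longrightarrow> GDERIV (\<lambda>x. \<tau> x $ 2) x :> T2 x" "continuous_on \<Omega> T2"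
    and div: "\<And>x. x \<in> \<Omega> \<Longrightarrow> T1 x $ 1 + T2 x $ 2 = 0"
    and normal: "\<And>x n. x \<in> \<Gamma>\<^sub>t \<Longrightarrow> outward_unit_normal C x n \<Longrightarrow> n \<bullet> \<tau> x = t x"
    and w: "continuous_on (closure \<Omega>) w" "\<And>x. x \<in> \<Gamma>\<^sub>u \<Longrightarrow> w x = 0" "weak_gradient \<Omega> w g" "integrable (lebesgue_on \<Omega>) g"
  shows "integrable (lebesgue_on \<Omega>) (\<lambda>x. \<tau> x \<bullet> g x)"
    "boundary_integral C \<Gamma>\<^sub>t (\<lambda>x. t x * w x) = integral\<^sup>L (lebesgue_on \<Omega>) (\<lambda>x. \<tau> x \<bullet> g x)"
proof -
  have O: "open \<Omega>" "bounded \<Omega>" using C unfolding boundary_cycle_def by auto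
  have sp: "space (lebesgue_on \<Omega>) = \<Omega>" by simp
  have c\<tau>: "continuous_on \<Omega> \<tau>" using \<tau>c closure_subset continuous_on_subset by blast
  have \<tau>m: "\<tau> \<in> borel_measurable (lebesgue_on \<Omega>)" using c\<tau> O(1) by (intro continuous_imp_measurable_on_sets_lebesgue) auto
  have "compact (\<tau> ` closure \<Omega>)" using \<tau>c O(2) by (intro compact_continuous_image) auto
  then have "bounded (\<tau> ` closure \<Omega>)" by (rule compact_imp_bounded)
  then obtain M where M: "\<And>x. x \<in> closure \<Omega> \<Longrightarrow> norm (\<tau> x) \<le> M" unfolding bounded_iff by blast
  show i: "integrable (lebesgue_on \<Omega>) (\<lambda>x. \<tau> x \<bullet> g x)"
  proof (rule Bochner_Integration.integrable_bound)
    show "integrable (lebesgue_on \<Omega>) (\<lambda>x. M * norm (g x))" using w(4) by simp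
    show "(\<lambda>x. \<tau> x \<bullet> g x) \<in> borel_measurable (lebesgue_on \<Omega>)"
      using \<tau>m borel_measurable_integrable[OF w(4)] by (rule borel_measurable_inner)
    show "AE x in lebesgue_on \<Omega>. norm (\<tau> x \<bullet> g x) \<le> norm (M * norm (g x))"
    proof (rule AE_I2)
      fix x assume "x \<in> space (lebesgue_on \<Omega>)"
      then have "norm (\<tau> x) \<le> M" using M closure_subset sp by blast
      have "norm (\<tau> x \<bullet> g x) \<le> norm (\<tau> x) * norm (g x)" using Cauchy_Schwarz_ineq2 by simp
      also have "\<dots> \<le> M * norm (g x)" using \<open>norm (\<tau> x) \<le> M\<close> by (intro mult_right_mono) auto
      also have "\<dots> \<le> norm (M * norm (g x))" by simp
      finally show "norm (\<tau> x \<bullet> g x) \<le> norm (M * norm (g x))" .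
    qed
  qed
  have li: "locally_integrable \<Omega> w" "locally_integrable \<Omega> g" using w(3) by (auto simp: weak_gradient_def)
  have "flux C (\<lambda>x. w x *\<^sub>R \<tau> x) = integral\<^sup>L (lebesgue_on \<Omega>) (\<lambda>x. \<tau> x \<bullet> g x)"
  proof (rule flux_weak_divergence[OF C _ i])
    show "continuous_on (closure \<Omega>) (\<lambda>x. w x *\<^sub>R \<tau> x)" using w(1) \<tau>c by (intro continuous_intros)
    fix \<phi> \<phi>' assume \<phi>: "test_function \<Omega> \<phi> \<phi>'"
    have part: "integrable (lebesgue_on \<Omega>) (\<lambda>x. w x * (\<phi> x * T x $ i + \<tau> x $ i * \<phi>' x $ i))"
      "integrable (lebesgue_on \<Omega>) (\<lambda>x. \<phi> x * \<tau> x $ i * g x $ i)"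
      "integral\<^sup>L (lebesgue_on \<Omega>) (\<lambda>x. w x * (\<phi> x * T x $ i + \<tau> x $ i * \<phi>' x $ i)) = - integral\<^sup>L (lebesgue_on \<Omega>) (\<lambda>x. \<phi> x * \<tau> x $ i * g x $ i)"
      if T: "\<And>x. x \<in> \<Omega> \<Longrightarrow> GDERIV (\<lambda>x. \<tau> x $ i) x :> T x" "continuous_on \<Omega> T" for i and T :: "plane \<Rightarrow> plane"
    proof -
      note t = test_function_mult_local[OF O(1) \<phi> T]
      let ?D = "\<lambda>x. \<phi> x *\<^sub>R T x + \<tau> x $ i *\<^sub>R \<phi>' x"
      note i1 = integrable_gradient_multiplier[OF O(1) li(1) t] and i2 = integrable_multiplier[OF O(1) li(2) t]
      show "integrable (lebesgue_on \<Omega>) (\<lambda>x. w x * (\<phi> x * T x $ i + \<tau> x $ i * \<phi>' x $ i))"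
        using integrable_bounded_linear[OF bounded_linear_vec_nth i1, of i] by simp
      show "integrable (lebesgue_on \<Omega>) (\<lambda>x. \<phi> x * \<tau> x $ i * g x $ i)"
        using integrable_bounded_linear[OF bounded_linear_vec_nth i2, of i] by simp
      have "integral\<^sup>L (lebesgue_on \<Omega>) (\<lambda>x. w x *\<^sub>R ?D x) = - integral\<^sup>L (lebesgue_on \<Omega>) (\<lambda>x. (\<phi> x * \<tau> x $ i) *\<^sub>R g x)"
        using w(3) t unfolding weak_gradient_def by blast
      then have "integral\<^sup>L (lebesgue_on \<Omega>) (\<lambda>x. w x *\<^sub>R ?D x) $ i = - integral\<^sup>L (lebesgue_on \<Omega>) (\<lambda>x. (\<phi> x * \<tau> x $ i) *\<^sub>R g x) $ i" by simp
      then show "integral\<^sup>L (lebesgue_on \<Omega>) (\<lambda>x. w x * (\<phi> x * T x $ i + \<tau> x $ i * \<phi>' x $ i)) = - integral\<^sup>L (lebesgue_on \<Omega>) (\<lambda>x. \<phi> x * \<tau> x $ i * g x $ i)"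
        using integral_bounded_linear[OF bounded_linear_vec_nth i1, of i] integral_bounded_linear[OF bounded_linear_vec_nth i2, of i] by simp
    qed
    note p1 = part[OF \<tau>1] and p2 = part[OF \<tau>2]
    have "integral\<^sup>L (lebesgue_on \<Omega>) (\<lambda>x. (w x *\<^sub>R \<tau> x) \<bullet> \<phi>' x)
       = integral\<^sup>L (lebesgue_on \<Omega>) (\<lambda>x. w x * (\<phi> x * T1 x $ 1 + \<tau> x $ 1 * \<phi>' x $ 1) + w x * (\<phi> x * T2 x $ 2 + \<tau> x $ 2 * \<phi>' x $ 2))"
    proof (rule Bochner_Integration.integral_cong[OF refl])
      fix x assume "x \<in> space (lebesgue_on \<Omega>)"
      then have "T2 x $ 2 = - T1 x $ 1" using div[of x] sp by simp
      then show "(w x *\<^sub>R \<tau> x) \<bullet> \<phi>' x = w x * (\<phi> x * T1 x $ 1 + \<tau> x $ 1 * \<phi>' x $ 1) + w x * (\<phi> x * T2 x $ 2 + \<tau> x $ 2 * \<phi>' x $ 2)"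
        by (simp add: inner_vec_def sum_2 algebra_simps)
    qed
    also have "\<dots> = - (integral\<^sup>L (lebesgue_on \<Omega>) (\<lambda>x. \<phi> x * \<tau> x $ 1 * g x $ 1) + integral\<^sup>L (lebesgue_on \<Omega>) (\<lambda>x. \<phi> x * \<tau> x $ 2 * g x $ 2))"
      using Bochner_Integration.integral_add[OF p1(1) p2(1)] p1(3) p2(3) by simp
    also have "\<dots> = - integral\<^sup>L (lebesgue_on \<Omega>) (\<lambda>x. \<phi> x * \<tau> x $ 1 * g x $ 1 + \<phi> x * \<tau> x $ 2 * g x $ 2)"
      using Bochner_Integration.integral_add[OF p1(2) p2(2)] by simp
    also have "(\<lambda>x. \<phi> x * \<tau> x $ 1 * g x $ 1 + \<phi> x * \<tau> x $ 2 * g x $ 2) = (\<lambda>x. \<phi> x * (\<tau> x \<bullet> g x))"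
      by (simp add: fun_eq_iff inner_vec_def sum_2 algebra_simps)
    finally show "integral\<^sup>L (lebesgue_on \<Omega>) (\<lambda>x. (w x *\<^sub>R \<tau> x) \<bullet> \<phi>' x) = - integral\<^sup>L (lebesgue_on \<Omega>) (\<lambda>x. \<phi> x * (\<tau> x \<bullet> g x))" .
  qed
  then show "boundary_integral C \<Gamma>\<^sub>t (\<lambda>x. t x * w x) = integral\<^sup>L (lebesgue_on \<Omega>) (\<lambda>x. \<tau> x \<bullet> g x)"
    using boundary_integral_eq_flux[OF C G normal w(2)] by simp
qed

text \<open>The fundamental theorem of calculus along a path with interior in \<open>\<Omega>\<close>; continuity of \<open>\<Phi>\<close> on the
  closure takes care of the end points.\<close>

lemma line_integral_of_gradient:
  assumes c: "continuous_on (closure \<Omega>) \<Phi>" and grad: "\<And>x. x \<in> \<Omega> \<Longrightarrow> GDERIV \<Phi> x :> F x"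
    and pts: "x\<^sub>0 \<in> closure \<Omega>" "x \<in> closure \<Omega>" and l: "line_integral_value \<Omega> F x\<^sub>0 x v"
  shows "v = \<Phi> x - \<Phi> x\<^sub>0"
proof -
  obtain \<gamma> where \<gamma>: "valid_path \<gamma>" "pathstart \<gamma> = x\<^sub>0" "pathfinish \<gamma> = x" "\<gamma> ` {0<..<1} \<subseteq> \<Omega>"
    "((\<lambda>s. F (\<gamma> s) \<bullet> vector_derivative \<gamma> (at s)) has_integral v) {0..1}"
    using l unfolding line_integral_value_def by blast
  obtain S where S: "finite S" "\<And>s. s \<in> {0..1} - S \<Longrightarrow> \<gamma> differentiable (at s)" and c\<gamma>: "continuous_on {0..1} \<gamma>"
    using \<gamma>(1) unfolding valid_path_def piecewise_C1_differentiable_on_def C1_differentiable_on_eq by blast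
  have im: "\<gamma> s \<in> closure \<Omega>" if s: "s \<in> {0..1}" for s
  proof -
    consider "s = 0" | "s = 1" | "s \<in> {0<..<1}" using s by fastforce
    then show ?thesis
    proof cases
      case 3
      then show ?thesis using \<gamma>(4) closure_subset[of \<Omega>] by blast
    qed (use \<gamma>(2,3) pts in \<open>auto simp: pathstart_def pathfinish_def\<close>)
  qed
  have "((\<lambda>s. F (\<gamma> s) \<bullet> vector_derivative \<gamma> (at s)) has_integral (\<Phi> (\<gamma> 1) - \<Phi> (\<gamma> 0))) {0..1}"
  proof (rule fundamental_theorem_of_calculus_interior_strong[OF S(1)])
    show "continuous_on {0..1} (\<lambda>s. \<Phi> (\<gamma> s))" by (rule continuous_on_compose2[OF c c\<gamma>]) (use im in auto)
    fix s :: real assume s: "s \<in> {0<..<1} - S"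
    have "(\<gamma> has_vector_derivative vector_derivative \<gamma> (at s)) (at s)" using S(2)[of s] s by (simp add: vector_derivative_works[symmetric])
    moreover have "\<gamma> s \<in> \<Omega>" using s \<gamma>(4) by blast
    then have "(\<Phi> has_derivative (\<lambda>h. h \<bullet> F (\<gamma> s))) (at (\<gamma> s))" using grad[of "\<gamma> s"] by (simp add: gderiv_def)
    ultimately have "((\<lambda>s. \<Phi> (\<gamma> s)) has_derivative (\<lambda>r. (r *\<^sub>R vector_derivative \<gamma> (at s)) \<bullet> F (\<gamma> s))) (at s)"
      unfolding has_vector_derivative_def by (rule has_derivative_compose)
    then show "((\<lambda>s. \<Phi> (\<gamma> s)) has_vector_derivative F (\<gamma> s) \<bullet> vector_derivative \<gamma> (at s)) (at s)"
      unfolding has_vector_derivative_def by (simp add: inner_commute)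
  qed simp
  then have "v = \<Phi> (\<gamma> 1) - \<Phi> (\<gamma> 0)" using \<gamma>(5) has_integral_unique by blast
  then show ?thesis using \<gamma>(2,3) by (simp add: pathstart_def pathfinish_def)
qed

section \<open>The duality theorem\<close>

text \<open>The pointwise minimiser of the complementary density minimises its integral. A competitor with the
  same value agrees with it almost everywhere, hence everywhere by continuity.\<close>

lemma dual_problem_solution:
  assumes O: "open \<Omega>" "bounded \<Omega>" and \<tau>: "continuous_on (closure \<Omega>) \<tau>" and \<mu>: "\<mu> > 0" and \<nu>: "\<nu> > 0"
    and \<zeta>: "\<zeta> = (\<lambda>x. dual_solution \<mu> \<nu> ((norm (\<tau> x))\<^sup>2 / 2))"
  shows "continuous_on (closure \<Omega>) \<zeta>" "\<And>x. \<mu> + \<nu> \<le> \<zeta> x" "\<And>x. dual_strain \<mu> \<nu> (\<zeta> x) = (norm (\<tau> x))\<^sup>2 / 2"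
    "integrable (lebesgue_on \<Omega>) (\<lambda>x. complementary \<mu> \<nu> ((norm (\<tau> x))\<^sup>2) (\<zeta> x))"
    "dual_energy \<mu> \<nu> \<Omega> \<tau> \<zeta> = ereal (- integral\<^sup>L (lebesgue_on \<Omega>) (\<lambda>x. complementary \<mu> \<nu> ((norm (\<tau> x))\<^sup>2) (\<zeta> x)))"
    "unique_maximizer \<Omega> (dual_space \<mu> \<nu> \<Omega>) (dual_energy \<mu> \<nu> \<Omega> \<tau>) \<zeta>"
proof -
  have nn: "0 \<le> (norm (\<tau> x))\<^sup>2 / 2" for x by simp
  note ds = dual_solution[OF \<mu> \<nu> nn]
  show ge: "\<mu> + \<nu> \<le> \<zeta> x" for x using ds(1) by (simp add: \<zeta>)
  show st: "dual_strain \<mu> \<nu> (\<zeta> x) = (norm (\<tau> x))\<^sup>2 / 2" for x using ds(2) by (simp add: \<zeta>)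
  show c: "continuous_on (closure \<Omega>) \<zeta>" unfolding \<zeta>
    by (rule continuous_on_compose2[OF dual_solution_continuous[OF \<mu> \<nu>]]) (use \<tau> in \<open>auto intro!: continuous_intros\<close>)
  define q where "q = (\<lambda>\<eta> x. complementary \<mu> \<nu> ((norm (\<tau> x))\<^sup>2) (\<eta> x))"
  have cq: "continuous_on S (q \<eta>)" if "continuous_on S \<eta>" "continuous_on S \<tau>" "\<And>x. x \<in> S \<Longrightarrow> \<mu> + \<nu> \<le> \<eta> x" for S \<eta>
  proof -
    have "\<eta> x > \<mu>" "\<eta> x > 0" if "x \<in> S" for x using \<open>\<And>x. x \<in> S \<Longrightarrow> \<mu> + \<nu> \<le> \<eta> x\<close>[OF that] \<mu> \<nu> by auto
    then show ?thesis unfolding q_def complementary_def using that(1,2) \<nu>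
      by (intro continuous_intros) fastforce+
  qed
  have E: "dual_energy \<mu> \<nu> \<Omega> \<tau> \<eta> = - ext_integral \<Omega> (q \<eta>)" for \<eta>
    unfolding dual_energy_def q_def complementary_def ..
  show iq: "integrable (lebesgue_on \<Omega>) (\<lambda>x. complementary \<mu> \<nu> ((norm (\<tau> x))\<^sup>2) (\<zeta> x))"
    using integrable_continuous_closure[OF O cq[OF c \<tau> ge]] by (simp add: q_def)
  then have iq': "integrable (lebesgue_on \<Omega>) (q \<zeta>)" by (simp add: q_def)
  show "dual_energy \<mu> \<nu> \<Omega> \<tau> \<zeta> = ereal (- integral\<^sup>L (lebesgue_on \<Omega>) (\<lambda>x. complementary \<mu> \<nu> ((norm (\<tau> x))\<^sup>2) (\<zeta> x)))"
    unfolding E ext_integral_integrable[OF iq'] by (simp add: q_def)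
  have cO: "continuous_on \<Omega> \<zeta>" "continuous_on \<Omega> \<tau>" using c \<tau> closure_subset continuous_on_subset by blast+
  have min: "q \<zeta> x \<le> q \<eta> x" "q \<eta> x = q \<zeta> x \<Longrightarrow> \<eta> x = \<zeta> x" if "\<mu> + \<nu> \<le> \<eta> x" for \<eta> x
    using complementary_minimal[OF \<mu> \<nu> ge st that] unfolding q_def by auto
  show "unique_maximizer \<Omega> (dual_space \<mu> \<nu> \<Omega>) (dual_energy \<mu> \<nu> \<Omega> \<tau>) \<zeta>"
    unfolding unique_maximizer_def
  proof (intro conjI ballI impI)
    show z: "\<zeta> \<in> dual_space \<mu> \<nu> \<Omega>" using ge cO by (simp add: dual_space_def)
    have le: "AE x in lebesgue_on \<Omega>. q \<zeta> x \<le> q \<eta> x" if "\<eta> \<in> dual_space \<mu> \<nu> \<Omega>" for \<eta>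
      using that min(1) by (intro AE_I2) (simp add: dual_space_def)
    show "dual_energy \<mu> \<nu> \<Omega> \<tau> \<eta> \<le> dual_energy \<mu> \<nu> \<Omega> \<tau> \<zeta>" if "\<eta> \<in> dual_space \<mu> \<nu> \<Omega>" for \<eta>
      unfolding E using ext_integral_mono_AE[OF le[OF that]] by simp
    fix \<eta> x assume \<eta>: "\<eta> \<in> dual_space \<mu> \<nu> \<Omega>" and opt: "\<forall>w\<in>dual_space \<mu> \<nu> \<Omega>. dual_energy \<mu> \<nu> \<Omega> \<tau> w \<le> dual_energy \<mu> \<nu> \<Omega> \<tau> \<eta>" and x: "x \<in> \<Omega>"
    have c\<eta>: "continuous_on \<Omega> \<eta>" and g\<eta>: "\<And>x. x \<in> \<Omega> \<Longrightarrow> \<mu> + \<nu> \<le> \<eta> x" using \<eta> by (auto simp: dual_space_def)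
    have "q \<eta> \<in> borel_measurable (lebesgue_on \<Omega>)"
      using cq[OF c\<eta> cO(2) g\<eta>] O(1) by (intro continuous_imp_measurable_on_sets_lebesgue) auto
    moreover have "ext_integral \<Omega> (q \<eta>) \<le> ext_integral \<Omega> (q \<zeta>)" using opt z unfolding E by simp
    ultimately have "AE x in lebesgue_on \<Omega>. q \<eta> x = q \<zeta> x" using ext_integral_le_imp_AE_eq[OF iq' _ le[OF \<eta>]] by blast
    moreover have "AE x in lebesgue_on \<Omega>. x \<in> \<Omega>" by (intro AE_I2) simp
    ultimately have "AE x in lebesgue_on \<Omega>. \<eta> x = \<zeta> x"
      by eventually_elim (use min(2) g\<eta> in blast)
    then show "\<eta> x = \<zeta> x" by (rule AE_eq_continuous_imp_eq[OF O(1) c\<eta> cO(1) _ x])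
  qed
qed

text \<open>Besides the primitive of \<open>\<tau> / \<zeta>\<close>, holomorphy supplies continuous gradients of the components of \<open>\<tau>\<close>,
  as the principle of virtual work requires.\<close>

lemma collinear_field_primitive:
  fixes \<tau> :: "plane \<Rightarrow> plane"
  assumes O: "open \<Omega>" "bounded \<Omega>" "connected \<Omega>" "\<Omega> \<noteq> {}" and \<tau>c: "continuous_on (closure \<Omega>) \<tau>"
    and div: "\<And>x. x \<in> \<Omega> \<Longrightarrow> \<exists>D. (\<tau> has_derivative D) (at x) \<and> (\<Sum>i\<in>UNIV. D (axis i 1) $ i) = 0"
    and pot: "potential_field \<Omega> \<tau>" and \<mu>: "\<mu> > 0" and \<nu>: "\<nu> > 0"
    and \<zeta>: "\<zeta> = (\<lambda>x. dual_solution \<mu> \<nu> ((norm (\<tau> x))\<^sup>2 / 2))"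
    and coll: "\<And>x. x \<in> \<Omega> \<Longrightarrow> \<exists>g. GDERIV \<zeta> x :> g \<and> cross2 (\<tau> x) g = 0"
  obtains \<Phi> and T1 T2 :: "plane \<Rightarrow> plane" where "continuous_on (closure \<Omega>) \<Phi>" "\<And>x. x \<in> \<Omega> \<Longrightarrow> GDERIV \<Phi> x :> inverse (\<zeta> x) *\<^sub>R \<tau> x"
    "\<And>x. x \<in> \<Omega> \<Longrightarrow> GDERIV (\<lambda>x. \<tau> x $ 1) x :> T1 x" "continuous_on \<Omega> T1"
    "\<And>x. x \<in> \<Omega> \<Longrightarrow> GDERIV (\<lambda>x. \<tau> x $ 2) x :> T2 x" "continuous_on \<Omega> T2"
    "\<And>x. x \<in> \<Omega> \<Longrightarrow> T1 x $ 1 + T2 x $ 2 = 0"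
proof -
  obtain \<phi> where \<phi>: "\<And>x. x \<in> \<Omega> \<Longrightarrow> GDERIV \<phi> x :> \<tau> x" using pot unfolding potential_field_def by blast
  define f where "f = (\<lambda>z. cnj (to_complex (\<tau> (from_complex z))))"
  define S where "S = from_complex -` \<Omega>"
  have H: "open S" "f holomorphic_on S"
    "\<And>x. x \<in> \<Omega> \<Longrightarrow> (\<tau> has_derivative (\<lambda>h. from_complex (cnj (deriv f (to_complex x) * to_complex h)))) (at x)"
    using potential_divergence_free_holomorphic[OF O(1) \<phi> div f_def S_def] by blast+
  note dual = dual_problem_solution[OF O(1,2) \<tau>c \<mu> \<nu> \<zeta>]
  have SO: "S = to_complex ` \<Omega>" unfolding S_def using from_complex_simps(3,4) by (force intro: image_eqI[where x="from_complex _"])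
  have conn: "connected S" unfolding SO by (intro connected_continuous_image continuous_intros O(3))
  have "Im (deriv f z * (cnj (f z))\<^sup>2) = 0" if z: "z \<in> S" for z
  proof -
    define x where "x = from_complex z"
    have x: "x \<in> \<Omega>" "z = to_complex x" using z by (auto simp: S_def x_def)
    obtain c where c: "(dual_strain \<mu> \<nu> has_real_derivative c) (at (\<zeta> x))"
      using dual_strain_differentiable[OF \<mu> \<nu> dual(2)] by blast
    obtain g where g: "GDERIV \<zeta> x :> g" "cross2 (\<tau> x) g = 0" using coll[OF x(1)] by blast
    have "Im (deriv f (to_complex x) * (to_complex (\<tau> x))\<^sup>2) = 0"
      by (rule collinear_gradient_condition[OF O(1) x(1) H(3)[OF x(1)] dual(3) c g])
    then show ?thesis by (simp add: f_def x(2))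
  qed
  from holomorphic_reciprocal_linear[OF H(1) conn H(2) this]
  have "(\<forall>x\<in>\<Omega>. \<tau> x = 0) \<or> (\<exists>c d. \<forall>x\<in>\<Omega>. cnj (to_complex (\<tau> x)) * (d - of_real c * to_complex x) = 1)"
    unfolding SO by (auto simp: f_def)
  then have "\<exists>\<Phi>. continuous_on (closure \<Omega>) \<Phi> \<and> (\<forall>x\<in>\<Omega>. GDERIV \<Phi> x :> inverse (dual_solution \<mu> \<nu> ((norm (\<tau> x))\<^sup>2 / 2)) *\<^sub>R \<tau> x)"
  proof (rule radial_primitive[OF O(2,4) \<tau>c dual_solution_continuous[OF \<mu> \<nu>], rotated])
    show "dual_solution \<mu> \<nu> a > 0" if "a \<ge> 0" for a using dual_solution(1)[OF \<mu> \<nu> that] \<mu> \<nu> by linarith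
  qed
  then obtain \<Phi> where \<Phi>: "continuous_on (closure \<Omega>) \<Phi>" "\<And>x. x \<in> \<Omega> \<Longrightarrow> GDERIV \<Phi> x :> inverse (\<zeta> x) *\<^sub>R \<tau> x"
    unfolding \<zeta> by blast
  define A where "A = (\<lambda>x. deriv f (to_complex x))"
  have "continuous_on S (deriv f)" using H(1,2) holomorphic_deriv holomorphic_on_imp_continuous_on by blast
  then have cA: "continuous_on \<Omega> A" unfolding A_def
    by (rule continuous_on_compose2) (auto simp: SO intro: continuous_intros)
  note cf = bounded_linear.continuous_on[OF bounded_linear_from_complex]
  show ?thesis
  proof (rule that[OF \<Phi>])
    show "GDERIV (\<lambda>x. \<tau> x $ 1) x :> from_complex (cnj (A x))" "GDERIV (\<lambda>x. \<tau> x $ 2) x :> from_complex (- \<i> * cnj (A x))" if "x \<in> \<Omega>" for x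
      using GDERIV_components[OF H(3)[OF that]] unfolding A_def by blast+
    show "continuous_on \<Omega> (\<lambda>x. from_complex (cnj (A x)))" "continuous_on \<Omega> (\<lambda>x. from_complex (- \<i> * cnj (A x)))"
      using cA by (auto intro!: cf continuous_intros)
  qed auto
qed

theorem theorem5:
  fixes C :: "(real \<Rightarrow> plane) set" and \<Omega> \<Gamma>\<^sub>u \<Gamma>\<^sub>t :: "plane set"
    and t :: "plane \<Rightarrow> real" and \<tau> :: "plane \<Rightarrow> plane" and \<mu> \<nu> p :: real
  assumes "boundary_cycle C \<Omega>"
    and "\<Gamma>\<^sub>u \<subseteq> frontier \<Omega>" and "\<Gamma>\<^sub>u \<noteq> {}" and "\<Gamma>\<^sub>t = frontier \<Omega> - \<Gamma>\<^sub>u"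
    and "\<mu> > 0" and "\<nu> > 0" and "p > 0"
    and "\<tau> \<in> static_space C \<Omega> \<Gamma>\<^sub>t t"
  shows "\<exists>\<zeta>. unique_maximizer \<Omega> (dual_space \<mu> \<nu> \<Omega>) (dual_energy \<mu> \<nu> \<Omega> \<tau>) \<zeta> \<and>
     (\<forall>x\<in>\<Omega>. \<zeta> x \<ge> \<mu> + \<nu>) \<and>
     (potential_field \<Omega> \<tau> \<and> (\<forall>x\<in>\<Omega>. \<exists>g. GDERIV \<zeta> x :> g \<and> cross2 (\<tau> x) g = 0) \<longrightarrow>
        (\<forall>x\<^sub>0\<in>\<Gamma>\<^sub>u. \<forall>x\<in>closure \<Omega>. \<forall>v v'.
           line_integral_value \<Omega> (\<lambda>y. inverse (\<zeta> y) *\<^sub>R \<tau> y) x\<^sub>0 x v \<longrightarrow>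
           line_integral_value \<Omega> (\<lambda>y. inverse (\<zeta> y) *\<^sub>R \<tau> y) x\<^sub>0 x v' \<longrightarrow> v = v') \<and>
        (\<forall>u. (\<forall>x\<^sub>0\<in>\<Gamma>\<^sub>u. \<forall>x\<in>closure \<Omega>.
                line_integral_value \<Omega> (\<lambda>y. inverse (\<zeta> y) *\<^sub>R \<tau> y) x\<^sub>0 x (u x)) \<longrightarrow>
           unique_minimizer (closure \<Omega>) (kinematic_space p \<Omega> \<Gamma>\<^sub>u)
             (primal_energy \<mu> \<nu> C \<Omega> \<Gamma>\<^sub>t t) u \<and>
           primal_energy \<mu> \<nu> C \<Omega> \<Gamma>\<^sub>t t u =
             (INF w\<in>kinematic_space p \<Omega> \<Gamma>\<^sub>u. primal_energy \<mu> \<nu> C \<Omega> \<Gamma>\<^sub>t t w) \<and>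
           (INF w\<in>kinematic_space p \<Omega> \<Gamma>\<^sub>u. primal_energy \<mu> \<nu> C \<Omega> \<Gamma>\<^sub>t t w) =
             (SUP \<eta>\<in>dual_space \<mu> \<nu> \<Omega>. dual_energy \<mu> \<nu> \<Omega> \<tau> \<eta>) \<and>
           (SUP \<eta>\<in>dual_space \<mu> \<nu> \<Omega>. dual_energy \<mu> \<nu> \<Omega> \<tau> \<eta>) = dual_energy \<mu> \<nu> \<Omega> \<tau> \<zeta>))"
proof -
  note C = assms(1) and \<Gamma> = assms(2,4) and \<mu> = \<open>\<mu> > 0\<close> and \<nu> = \<open>\<nu> > 0\<close>
  have O: "open \<Omega>" "bounded \<Omega>" "connected \<Omega>" "\<Omega> \<noteq> {}" using C unfolding boundary_cycle_def by auto
  have \<tau>c: "continuous_on (closure \<Omega>) \<tau>"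
    and div: "\<And>x. x \<in> \<Omega> \<Longrightarrow> \<exists>D. (\<tau> has_derivative D) (at x) \<and> (\<Sum>i\<in>UNIV. D (axis i 1) $ i) = 0"
    and normal: "\<And>x n. x \<in> \<Gamma>\<^sub>t \<Longrightarrow> outward_unit_normal C x n \<Longrightarrow> n \<bullet> \<tau> x = t x"
    using assms(8) unfolding static_space_def by auto
  define \<zeta> where "\<zeta> = (\<lambda>x. dual_solution \<mu> \<nu> ((norm (\<tau> x))\<^sup>2 / 2))"
  note dual = dual_problem_solution[OF O(1,2) \<tau>c \<mu> \<nu> \<zeta>_def]
  let ?M = "lebesgue_on \<Omega>"
  define F where "F = (\<lambda>y. inverse (\<zeta> y) *\<^sub>R \<tau> y)"
  define q where "q = (\<lambda>x. complementary \<mu> \<nu> ((norm (\<tau> x))\<^sup>2) (\<zeta> x))"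
  have qi: "integrable ?M q" using dual(4) by (simp add: q_def)
  let ?J = "primal_energy \<mu> \<nu> C \<Omega> \<Gamma>\<^sub>t t" and ?U = "kinematic_space p \<Omega> \<Gamma>\<^sub>u"
  have main: "(\<forall>x\<^sub>0\<in>\<Gamma>\<^sub>u. \<forall>x\<in>closure \<Omega>. \<forall>v v'. line_integral_value \<Omega> F x\<^sub>0 x v \<longrightarrow> line_integral_value \<Omega> F x\<^sub>0 x v' \<longrightarrow> v = v') \<and>
    (\<forall>u. (\<forall>x\<^sub>0\<in>\<Gamma>\<^sub>u. \<forall>x\<in>closure \<Omega>. line_integral_value \<Omega> F x\<^sub>0 x (u x)) \<longrightarrow>
       unique_minimizer (closure \<Omega>) ?U ?J u \<and> ?J u = dual_energy \<mu> \<nu> \<Omega> \<tau> \<zeta>)"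
    if pot: "potential_field \<Omega> \<tau>" and coll: "\<And>x. x \<in> \<Omega> \<Longrightarrow> \<exists>g. GDERIV \<zeta> x :> g \<and> cross2 (\<tau> x) g = 0"
  proof -
    obtain \<Phi> and T1 T2 :: "plane \<Rightarrow> plane"
      where \<Phi>': "continuous_on (closure \<Omega>) \<Phi>" "\<And>x. x \<in> \<Omega> \<Longrightarrow> GDERIV \<Phi> x :> inverse (\<zeta> x) *\<^sub>R \<tau> x"
      and T: "\<And>x. x \<in> \<Omega> \<Longrightarrow> GDERIV (\<lambda>x. \<tau> x $ 1) x :> T1 x" "continuous_on \<Omega> T1"
        "\<And>x. x \<in> \<Omega> \<Longrightarrow> GDERIV (\<lambda>x. \<tau> x $ 2) x :> T2 x" "continuous_on \<Omega> T2"
        "\<And>x. x \<in> \<Omega> \<Longrightarrow> T1 x $ 1 + T2 x $ 2 = 0"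
      by (rule collinear_field_primitive[OF O \<tau>c div pot \<mu> \<nu> \<zeta>_def coll]; (assumption | (rule that; assumption)))
    have \<Phi>: "continuous_on (closure \<Omega>) \<Phi>" "\<And>x. x \<in> \<Omega> \<Longrightarrow> GDERIV \<Phi> x :> F x"
      using \<Phi>' unfolding F_def by auto
    have \<Gamma>c: "x \<in> closure \<Omega>" if "x \<in> \<Gamma>\<^sub>u" for x using that \<Gamma>(1) by (auto simp: frontier_def)
    have line: "v = \<Phi> x - \<Phi> x\<^sub>0" if "x\<^sub>0 \<in> \<Gamma>\<^sub>u" "x \<in> closure \<Omega>" "line_integral_value \<Omega> F x\<^sub>0 x v" for x\<^sub>0 x v
      using line_integral_of_gradient[OF \<Phi> \<Gamma>c[OF that(1)] that(2,3)] .
    have zn: "\<zeta> x \<noteq> 0" for x using dual(2)[of x] \<mu> \<nu> by linarith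
    have Fc: "continuous_on (closure \<Omega>) F" unfolding F_def
      using dual(1) \<tau>c zn by (intro continuous_intros) auto
    define W where "W = (\<lambda>g::plane. \<mu> * (norm g)\<^sup>2 / 2 + \<nu> * (exp ((norm g)\<^sup>2 / 2) - 1))"
    have W0: "W g \<ge> 0" for g unfolding W_def using \<mu> \<nu> by simp
    define D where "D = - integral\<^sup>L ?M q"
    have Dz: "dual_energy \<mu> \<nu> \<Omega> \<tau> \<zeta> = ereal D" using dual(5) by (simp add: D_def q_def)
    have J: "?J w = ext_integral \<Omega> (\<lambda>x. W (grad \<Omega> w x)) - ereal (boundary_integral C \<Gamma>\<^sub>t (\<lambda>x. t x * w x))" for w
      unfolding primal_energy_def W_def ..
    have gw: "weak_gradient \<Omega> w (grad \<Omega> w)" if mem: "w \<in> ?U" for w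
    proof -
      obtain g where "weak_gradient \<Omega> w g" using mem by (auto simp: kinematic_space_def)
      then show ?thesis unfolding grad_def by (rule someI[of "weak_gradient \<Omega> w"])
    qed
    have Wm: "(\<lambda>x. W (grad \<Omega> w x)) \<in> borel_measurable ?M" if "w \<in> ?U" for w
    proof -
      have "grad \<Omega> w \<in> borel_measurable ?M" using gw[OF that] by (simp add: weak_gradient_def)
      then show ?thesis unfolding W_def by measurable
    qed
    have vw: "integrable ?M (\<lambda>x. \<tau> x \<bullet> grad \<Omega> w x - q x)"
       "ereal (integral\<^sup>L ?M (\<lambda>x. \<tau> x \<bullet> grad \<Omega> w x - q x)) = ereal D + ereal (boundary_integral C \<Gamma>\<^sub>t (\<lambda>x. t x * w x))"
      if w: "w \<in> ?U" and i: "integrable ?M (grad \<Omega> w)" for w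
    proof -
      have cw: "continuous_on (closure \<Omega>) w" "\<And>x. x \<in> \<Gamma>\<^sub>u \<Longrightarrow> w x = 0" using w by (auto simp: kinematic_space_def)
      have V: "integrable ?M (\<lambda>x. \<tau> x \<bullet> grad \<Omega> w x)"
        "boundary_integral C \<Gamma>\<^sub>t (\<lambda>x. t x * w x) = integral\<^sup>L ?M (\<lambda>x. \<tau> x \<bullet> grad \<Omega> w x)"
        by (rule virtual_work[OF C \<Gamma> \<tau>c T normal cw gw[OF w] i]; assumption)+
      show "integrable ?M (\<lambda>x. \<tau> x \<bullet> grad \<Omega> w x - q x)" using V(1) qi by (rule Bochner_Integration.integrable_diff)
      show "ereal (integral\<^sup>L ?M (\<lambda>x. \<tau> x \<bullet> grad \<Omega> w x - q x)) = ereal D + ereal (boundary_integral C \<Gamma>\<^sub>t (\<lambda>x. t x * w x))"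
        using Bochner_Integration.integral_diff[OF V(1) qi] V(2) by (simp add: D_def)
    qed
    \<comment> \<open>Weak duality at a point, with its case of equality.\<close>
    have le: "\<tau> x \<bullet> g - q x \<le> W g" and le_eq: "\<tau> x \<bullet> g - q x = W g \<Longrightarrow> g = F x" and eq_F: "W (F x) = \<tau> x \<bullet> F x - q x" for x g
    proof -
      have zp: "\<zeta> x > 0" using dual(2)[of x] \<mu> \<nu> by linarith
      note s = stored_energy_duality(1)[OF \<mu> \<nu> dual(2)[of x], of g "\<tau> x", folded W_def q_def]
      have "0 \<le> (norm (\<zeta> x *\<^sub>R g - \<tau> x))\<^sup>2 / (2 * \<zeta> x)" using zp by simp
      then show "\<tau> x \<bullet> g - q x \<le> W g" using s unfolding W_def q_def by linarith
      show "g = F x" if "\<tau> x \<bullet> g - q x = W g"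
      proof -
        have "(norm (\<zeta> x *\<^sub>R g - \<tau> x))\<^sup>2 / (2 * \<zeta> x) \<le> 0" using s that unfolding W_def q_def by linarith
        then have "(norm (\<zeta> x *\<^sub>R g - \<tau> x))\<^sup>2 \<le> 0" using zp by (simp add: divide_le_0_iff)
        then have "\<zeta> x *\<^sub>R g = \<tau> x" by simp
        then have "inverse (\<zeta> x) *\<^sub>R (\<zeta> x *\<^sub>R g) = F x" by (simp add: F_def)
        then show ?thesis using zp by simp
      qed
      show "W (F x) = \<tau> x \<bullet> F x - q x"
        using stored_energy_duality(2)[OF \<mu> \<nu> dual(2)[of x] dual(3)[of x] fun_cong[OF F_def, of x]] unfolding W_def q_def by linarith
    qed
    \<comment> \<open>Virtual work needs an integrable gradient. Fields of infinite energy may lack it, but they cannot be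
      minimisers.\<close>
    have gi: "integrable ?M (grad \<Omega> w)" if w: "w \<in> ?U" and fin: "ext_integral \<Omega> (\<lambda>x. W (grad \<Omega> w x)) \<noteq> \<infinity>" for w
    proof -
      have Wi: "integrable ?M (\<lambda>x. W (grad \<Omega> w x))"
      proof (rule integrableI_nonneg[OF Wm[OF w]])
        have "(\<integral>\<^sup>+x. ennreal (- W (grad \<Omega> w x)) \<partial>?M) = 0" using W0 by (simp add: ennreal_neg)
        then have "ext_integral \<Omega> (\<lambda>x. W (grad \<Omega> w x)) = enn2ereal (\<integral>\<^sup>+x. ennreal (W (grad \<Omega> w x)) \<partial>?M)"
          by (simp add: ext_integral_def zero_ennreal.rep_eq)
        then have "(\<integral>\<^sup>+x. ennreal (W (grad \<Omega> w x)) \<partial>?M) \<noteq> \<infinity>" using fin by auto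
        then show "(\<integral>\<^sup>+x. ennreal (W (grad \<Omega> w x)) \<partial>?M) < \<infinity>" by (simp add: less_top)
      qed (use W0 in auto)
      show ?thesis
      proof (rule Bochner_Integration.integrable_bound)
        show "integrable ?M (\<lambda>x. 1 / 2 + W (grad \<Omega> w x) / \<mu>)"
          using integrable_continuous_closure[OF O(1,2), of "\<lambda>_. 1/2 :: real"] Wi by (intro Bochner_Integration.integrable_add) auto
        show "grad \<Omega> w \<in> borel_measurable ?M" using gw[OF w] by (simp add: weak_gradient_def)
        \<comment> \<open>Finite energy controls the gradient in \<open>L\<^sup>2\<close>, hence in \<open>L\<^sup>1\<close>.\<close>
        have "norm g \<le> 1 / 2 + W g / \<mu>" for g :: plane
        proof -
          have "0 \<le> (norm g - 1)\<^sup>2" by simp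
          then have "2 * norm g \<le> 1 + (norm g)\<^sup>2" by (simp add: power2_eq_square algebra_simps)
          then have "norm g \<le> 1 / 2 + (norm g)\<^sup>2 / 2" by simp
          moreover have "(norm g)\<^sup>2 / 2 \<le> W g / \<mu>"
          proof -
            have "\<mu> * ((norm g)\<^sup>2 / 2) \<le> W g" unfolding W_def using \<nu> by simp
            then show ?thesis using \<mu> by (simp add: pos_le_divide_eq mult.commute)
          qed
          ultimately show ?thesis by linarith
        qed
        then show "AE x in ?M. norm (grad \<Omega> w x) \<le> norm (1 / 2 + W (grad \<Omega> w x) / \<mu>)"
          by (intro AE_I2) (use order_trans abs_ge_self in \<open>fastforce\<close>)
      qed
    qed
    have lower: "ereal D \<le> ?J w" and unique_grad: "?J w \<le> ereal D \<Longrightarrow> AE x in ?M. grad \<Omega> w x = F x" if w: "w \<in> ?U" for w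
    proof -
      let ?b = "boundary_integral C \<Gamma>\<^sub>t (\<lambda>x. t x * w x)"
      have "ereal D \<le> ?J w \<and> (?J w \<le> ereal D \<longrightarrow> (AE x in ?M. grad \<Omega> w x = F x))"
      proof (cases "ext_integral \<Omega> (\<lambda>x. W (grad \<Omega> w x)) = \<infinity>")
        case True
        then show ?thesis unfolding J by simp
      next
        case False
        note v = vw[OF w gi[OF w False]]
        have AEle: "AE x in ?M. \<tau> x \<bullet> grad \<Omega> w x - q x \<le> W (grad \<Omega> w x)" using le by (intro AE_I2) auto
        have e: "ext_integral \<Omega> (\<lambda>x. \<tau> x \<bullet> grad \<Omega> w x - q x) = ereal D + ereal ?b"
          using ext_integral_integrable[OF v(1)] v(2) by simp
        have l: "ereal D + ereal ?b \<le> ext_integral \<Omega> (\<lambda>x. W (grad \<Omega> w x))" using ext_integral_mono_AE[OF AEle] e by simp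
        then have "ereal D \<le> ?J w" unfolding J by (cases "ext_integral \<Omega> (\<lambda>x. W (grad \<Omega> w x))") auto
        moreover have "AE x in ?M. grad \<Omega> w x = F x" if "?J w \<le> ereal D"
        proof -
          have "ext_integral \<Omega> (\<lambda>x. W (grad \<Omega> w x)) \<le> ext_integral \<Omega> (\<lambda>x. \<tau> x \<bullet> grad \<Omega> w x - q x)"
            using that unfolding J e by (cases "ext_integral \<Omega> (\<lambda>x. W (grad \<Omega> w x))") auto
          from ext_integral_le_imp_AE_eq[OF v(1) Wm[OF w] AEle this]
          show ?thesis by eventually_elim (use le_eq in metis)
        qed
        ultimately show ?thesis by blast
      qed
      then show "ereal D \<le> ?J w" "?J w \<le> ereal D \<Longrightarrow> AE x in ?M. grad \<Omega> w x = F x" by auto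
    qed
    have sol: "unique_minimizer (closure \<Omega>) ?U ?J u \<and> ?J u = dual_energy \<mu> \<nu> \<Omega> \<tau> \<zeta>"
      if u: "\<forall>x\<^sub>0\<in>\<Gamma>\<^sub>u. \<forall>x\<in>closure \<Omega>. line_integral_value \<Omega> F x\<^sub>0 x (u x)" for u
    proof -
      obtain x\<^sub>0 where x0: "x\<^sub>0 \<in> \<Gamma>\<^sub>u" using assms(3) by blast
      have uv: "u x = \<Phi> x - \<Phi> x1" if "x1 \<in> \<Gamma>\<^sub>u" "x \<in> closure \<Omega>" for x x1 using line[OF that] u that by blast
      have u0: "u x = 0" if "x \<in> \<Gamma>\<^sub>u" for x using uv[OF that \<Gamma>c[OF that]] by simp
      have uc: "continuous_on (closure \<Omega>) u"
        by (rule continuous_on_eq[of _ "\<lambda>x. \<Phi> x - \<Phi> x\<^sub>0"]) (use uv[OF x0] \<Phi>(1) in \<open>auto intro!: continuous_intros\<close>)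
      have ud: "GDERIV u x :> F x" if x: "x \<in> \<Omega>" for x
      proof -
        have "((\<lambda>x. \<Phi> x - \<Phi> x\<^sub>0) has_derivative (\<lambda>h. h \<bullet> F x)) (at x)"
          using GDERIV_diff[OF \<Phi>(2)[OF x] GDERIV_const] by (simp add: gderiv_def)
        then show ?thesis unfolding gderiv_def
          by (rule has_derivative_transform_within_open[OF _ O(1) x]) (simp add: uv[OF x0 subsetD[OF closure_subset]])
      qed
      have cF: "continuous_on \<Omega> F" using Fc closure_subset continuous_on_subset by blast
      have ug: "weak_gradient \<Omega> u F" by (rule classical_weak_gradient[OF O(1) ud cF])
      have "continuous_on (closure \<Omega>) (\<lambda>x. norm (F x) powr (2 * p))"
        using Fc \<open>p > 0\<close> by (intro continuous_on_powr' continuous_intros) auto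
      then have uU: "u \<in> ?U" unfolding kinematic_space_def
        using uc ug u0 integrable_continuous_closure[OF O(1,2)] by blast
      have gF: "AE x in ?M. grad \<Omega> u x = F x" by (rule weak_gradient_AE_unique[OF O(1) gw[OF uU] ug])
      have Fi: "integrable ?M F" by (rule integrable_continuous_closure[OF O(1,2) Fc])
      have gm: "grad \<Omega> u \<in> borel_measurable ?M" using gw[OF uU] by (simp add: weak_gradient_def)
      have gui: "integrable ?M (grad \<Omega> u)"
        by (rule integrable_cong_AE_imp[OF Fi gm]) (use gF in eventually_elim, simp)
      have "AE x in ?M. W (grad \<Omega> u x) = \<tau> x \<bullet> grad \<Omega> u x - q x" using gF by eventually_elim (simp add: eq_F)
      from ext_integral_cong_AE[OF this] vw[OF uU gui] ext_integral_integrable[OF vw(1)[OF uU gui]]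
      have Ju: "?J u = ereal D" unfolding J by simp
      have "unique_minimizer (closure \<Omega>) ?U ?J u"
        unfolding unique_minimizer_def
      proof (intro conjI ballI impI)
        show "u \<in> ?U" by (rule uU)
        show "?J u \<le> ?J v" if "v \<in> ?U" for v using lower[OF that] Ju by simp
        fix v x assume v: "v \<in> ?U" and opt: "\<forall>w\<in>?U. ?J v \<le> ?J w" and x: "x \<in> closure \<Omega>"
        have "?J v \<le> ereal D" using opt uU Ju by metis
        then have ae: "AE x in ?M. grad \<Omega> v x = F x" by (rule unique_grad[OF v])
        have vc: "continuous_on (closure \<Omega>) v" and v0: "\<And>x. x \<in> \<Gamma>\<^sub>u \<Longrightarrow> v x = 0" using v by (auto simp: kinematic_space_def)
        have cO: "continuous_on \<Omega> u" "continuous_on \<Omega> v" using uc vc closure_subset continuous_on_subset by blast+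
        obtain k where k: "\<And>x. x \<in> \<Omega> \<Longrightarrow> v x - u x = k"
          using weak_gradient_eq_imp_constant[OF O(1,3) cO ug gw[OF v] ae] unfolding constant_on_def by blast
        have k': "v x - u x = k" if "x \<in> closure \<Omega>" for x
          using continuous_constant_on_closure[OF continuous_on_diff[OF vc uc] k that] .
        have "k = 0" using k'[OF \<Gamma>c[OF x0]] u0[OF x0] v0[OF x0] by simp
        then show "v x = u x" using k'[OF x] by simp
      qed
      then show ?thesis using Ju Dz by simp
    qed
    show ?thesis using line sol by blast
  qed
  have sup: "(SUP \<eta>\<in>dual_space \<mu> \<nu> \<Omega>. dual_energy \<mu> \<nu> \<Omega> \<tau> \<eta>) = dual_energy \<mu> \<nu> \<Omega> \<tau> \<zeta>"
    using dual(6) unfolding unique_maximizer_def by (intro antisym SUP_least SUP_upper) auto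
  have inf: "(INF w\<in>?U. ?J w) = ?J u" if "unique_minimizer (closure \<Omega>) ?U ?J u" for u
    using that unfolding unique_minimizer_def by (intro antisym INF_lower INF_greatest) auto
  show ?thesis
  proof (intro exI[of _ \<zeta>] conjI impI)
    show "unique_maximizer \<Omega> (dual_space \<mu> \<nu> \<Omega>) (dual_energy \<mu> \<nu> \<Omega> \<tau>) \<zeta>" by (rule dual(6))
    show "\<forall>x\<in>\<Omega>. \<mu> + \<nu> \<le> \<zeta> x" using dual(2) by blast
    assume a: "potential_field \<Omega> \<tau> \<and> (\<forall>x\<in>\<Omega>. \<exists>g. GDERIV \<zeta> x :> g \<and> cross2 (\<tau> x) g = 0)"
    then have m: "(\<forall>x\<^sub>0\<in>\<Gamma>\<^sub>u. \<forall>x\<in>closure \<Omega>. \<forall>v v'. line_integral_value \<Omega> F x\<^sub>0 x v \<longrightarrow> line_integral_value \<Omega> F x\<^sub>0 x v' \<longrightarrow> v = v')"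
      "\<And>u. (\<forall>x\<^sub>0\<in>\<Gamma>\<^sub>u. \<forall>x\<in>closure \<Omega>. line_integral_value \<Omega> F x\<^sub>0 x (u x)) \<Longrightarrow>
       unique_minimizer (closure \<Omega>) ?U ?J u \<and> ?J u = dual_energy \<mu> \<nu> \<Omega> \<tau> \<zeta>"
      using main by blast+
    show "\<forall>x\<^sub>0\<in>\<Gamma>\<^sub>u. \<forall>x\<in>closure \<Omega>. \<forall>v v'.
           line_integral_value \<Omega> (\<lambda>y. inverse (\<zeta> y) *\<^sub>R \<tau> y) x\<^sub>0 x v \<longrightarrow>
           line_integral_value \<Omega> (\<lambda>y. inverse (\<zeta> y) *\<^sub>R \<tau> y) x\<^sub>0 x v' \<longrightarrow> v = v'"
      using m(1) unfolding F_def .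
    show "\<forall>u. (\<forall>x\<^sub>0\<in>\<Gamma>\<^sub>u. \<forall>x\<in>closure \<Omega>.
                line_integral_value \<Omega> (\<lambda>y. inverse (\<zeta> y) *\<^sub>R \<tau> y) x\<^sub>0 x (u x)) \<longrightarrow>
           unique_minimizer (closure \<Omega>) ?U ?J u \<and> ?J u = (INF w\<in>?U. ?J w) \<and>
           (INF w\<in>?U. ?J w) = (SUP \<eta>\<in>dual_space \<mu> \<nu> \<Omega>. dual_energy \<mu> \<nu> \<Omega> \<tau> \<eta>) \<and>
           (SUP \<eta>\<in>dual_space \<mu> \<nu> \<Omega>. dual_energy \<mu> \<nu> \<Omega> \<tau> \<eta>) = dual_energy \<mu> \<nu> \<Omega> \<tau> \<zeta>"
    proof (intro allI impI)
      fix u assume "\<forall>x\<^sub>0\<in>\<Gamma>\<^sub>u. \<forall>x\<in>closure \<Omega>. line_integral_value \<Omega> (\<lambda>y. inverse (\<zeta> y) *\<^sub>R \<tau> y) x\<^sub>0 x (u x)"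
      then have "unique_minimizer (closure \<Omega>) ?U ?J u \<and> ?J u = dual_energy \<mu> \<nu> \<Omega> \<tau> \<zeta>"
        by (intro m(2)) (simp only: F_def)
      then show "unique_minimizer (closure \<Omega>) ?U ?J u \<and> ?J u = (INF w\<in>?U. ?J w) \<and>
           (INF w\<in>?U. ?J w) = (SUP \<eta>\<in>dual_space \<mu> \<nu> \<Omega>. dual_energy \<mu> \<nu> \<Omega> \<tau> \<eta>) \<and>
           (SUP \<eta>\<in>dual_space \<mu> \<nu> \<Omega>. dual_energy \<mu> \<nu> \<Omega> \<tau> \<eta>) = dual_energy \<mu> \<nu> \<Omega> \<tau> \<zeta>"
        using inf[of u] sup by auto
    qed
  qed
qed

end
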